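(* Any extremal number is $\mathrm{GL}_2(\mathbb Z)$-equivalent to a unique balanced extremal number.
   Context: Let $\gamma=(1+\sqrt5)/2$. A real number $\xi$ is \emph{extremal} if it is neither rational nor quadratic over $\mathbb Q$ and there is a constant $c>0$ such that, for each real $X\ge 1$, the inequalities $|x_0|\le X$, $|x_0\xi-x_1|\le cX^{-1/\gamma}$, $|x_0\xi^2-x_2|\le cX^{-1/\gamma}$ admit a non-zero solution $(x_0,x_1,x_2)\in\mathbb Z^3$. $\mathrm{GL}_2(\mathbb Z)$ acts on $\mathbb R\setminus\mathbb Q$ by $\begin{pmatrix}a&b\\c&d\end{pmatrix}\cdot\xi=\frac{a\xi+b}{c\xi+d}$; two numbers are equivalent if they lie in the same orbit. Let $\mathcal P$ be the set of $2\times2$ integer matrices with non-zero determinant and relatively prime coefficients; it is a group under $\mathbf y_1*\mathbf y_2=c^{-1}\mathbf y_1\mathbf y_2$, where $c$ is the greatest positive common divisor of the coefficients of $\mathbf y_1\mathbf y_2$. The norm of a real matrix or vector is the largest absolute value of its coefficients. It is known that for each extremal $\xi$ there is an unbounded sequence $(\mathbf x_i)_{i\ge1}$ of symmetric matrices in $\mathcal P$ with $\|\mathbf x_{i+1}\|\asymp\|\mathbf x_i\|^\gamma$, $\|(\xi,-1)\mathbf x_i\|\asymp\|\mathbf x_i\|^{-1}$ and $|\det\mathbf x_i|\asymp1$ (implied constants independent of $i$), and a matrix $M=\begin{pmatrix}a&b\\c&d\end{pmatrix}\in\mathcal P$, neither symmetric nor skew-symmetric, such that, for each sufficiently large $i$,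 $\mathbf x_{i+2}=\pm\,\mathbf x_{i+1}*M*\mathbf x_i$ if $i$ is odd and $\mathbf x_{i+2}=\pm\,\mathbf x_{i+1}*{}^tM*\mathbf x_i$ if $i$ is even; moreover $M$ is uniquely determined by $\xi$ within the set $\{\pm M,\pm{}^tM\}$. The \emph{conjugates} of $\xi$ are the extremal numbers $\xi'=-\frac{a+b\xi}{c+d\xi}$ and $\xi''=-\frac{a+c\xi}{b+d\xi}$; the set $\{\xi',\xi''\}$ depends only on $\xi$. An extremal number $\xi$ is \emph{reduced} if $0<\xi<1$ and its conjugates satisfy $\xi'<-1$ and $\xi''<-1$. It is \emph{balanced} if it is reduced and its conjugates have distinct integral parts. *)

theory Defs
  imports "HOL-Analysis.Analysis"
begin

definition golden :: real where
  "golden = (1 + sqrt 5) / 2"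

definition quadratic_number :: "real \<Rightarrow> bool" where
  "quadratic_number \<xi> \<longleftrightarrow>
     \<xi> \<notin> \<rat> \<and> (\<exists>a\<in>\<rat>. \<exists>b\<in>\<rat>. \<exists>c\<in>\<rat>. a \<noteq> 0 \<and> a * \<xi>^2 + b * \<xi> + c = 0)"

definition extremal :: "real \<Rightarrow> bool" where
  "extremal \<xi> \<longleftrightarrow> \<xi> \<notin> \<rat> \<and> \<not> quadratic_number \<xi> \<and>
     (\<exists>c>0. \<forall>X\<ge>1. \<exists>x0 x1 x2 :: int. (x0, x1, x2) \<noteq> (0, 0, 0) \<and>
        \<bar>real_of_int x0\<bar> \<le> X \<and>
        \<bar>real_of_int x0 * \<xi> - real_of_int x1\<bar> \<le> c * X powr (- 1 / golden) \<and>
        \<bar>real_of_int x0 * \<xi>^2 - real_of_int x2\<bar> \<le> c * X powr (- 1 / golden))"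

(* The denominator does not vanish when A has non-zero determinant and \<xi> is irrational. *)
definition moebius :: "int^2^2 \<Rightarrow> real \<Rightarrow> real" where
  "moebius A \<xi> =
     (real_of_int (A$1$1) * \<xi> + real_of_int (A$1$2)) /
     (real_of_int (A$2$1) * \<xi> + real_of_int (A$2$2))"

(* "invertible" is taken over the integers here, so A ranges over GL_2(Z). *)
definition GL2Z_equivalent :: "real \<Rightarrow> real \<Rightarrow> bool" where
  "GL2Z_equivalent \<xi> \<eta> \<longleftrightarrow>
     \<xi> \<notin> \<rat> \<and> \<eta> \<notin> \<rat> \<and> (\<exists>A :: int^2^2. invertible A \<and> \<eta> = moebius A \<xi>)"

definition content :: "int^2^2 \<Rightarrow> int" where
  "content A = Gcd {A$i$j | i j. True}"

definition prim_matrices :: "(int^2^2) set" where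
  "prim_matrices = {A. det A \<noteq> 0 \<and> content A = 1}"

definition prim_mult :: "int^2^2 \<Rightarrow> int^2^2 \<Rightarrow> int^2^2"  (infixl \<open>\<star>\<close> 70) where
  "A \<star> B = map_matrix (\<lambda>t. t div content (A ** B)) (A ** B)"

(* infnorm on a Euclidean space is the largest absolute value of the coordinates
   in the standard basis, i.e. of the coefficients for vectors and matrices. *)
definition mat_norm :: "int^2^2 \<Rightarrow> real" where
  "mat_norm A = infnorm (map_matrix real_of_int A)"

definition comparable :: "(nat \<Rightarrow> real) \<Rightarrow> (nat \<Rightarrow> real) \<Rightarrow> bool" where
  "comparable f g \<longleftrightarrow> (\<exists>c1>0. \<exists>c2>0. \<forall>i\<ge>1. c1 * g i \<le> f i \<and> f i \<le> c2 * g i)"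

(* Sequences are indexed from 1; the value at index 0 is irrelevant. *)
definition approximating_sequence :: "real \<Rightarrow> (nat \<Rightarrow> int^2^2) \<Rightarrow> bool" where
  "approximating_sequence \<xi> x \<longleftrightarrow>
     (\<forall>i\<ge>1. x i \<in> prim_matrices \<and> transpose (x i) = x i) \<and>
     (\<forall>B. \<exists>i\<ge>1. mat_norm (x i) > B) \<and>
     comparable (\<lambda>i. mat_norm (x (Suc i))) (\<lambda>i. mat_norm (x i) powr golden) \<and>
     comparable (\<lambda>i. infnorm ((vector [\<xi>, -1] :: real^2) v* map_matrix real_of_int (x i)))
       (\<lambda>i. 1 / mat_norm (x i)) \<and>
     comparable (\<lambda>i. \<bar>real_of_int (det (x i))\<bar>) (\<lambda>i. 1)"

definition associated_matrix :: "real \<Rightarrow> int^2^2 \<Rightarrow> bool" where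
  "associated_matrix \<xi> M \<longleftrightarrow>
     M \<in> prim_matrices \<and> transpose M \<noteq> M \<and> transpose M \<noteq> - M \<and>
     (\<exists>x. approximating_sequence \<xi> x \<and>
        (\<forall>\<^sub>F i in sequentially.
           let y = x (i + 1) \<star> (if odd i then M else transpose M) \<star> x i
           in x (i + 2) = y \<or> x (i + 2) = - y))"

(* For extremal \<xi>, an associated matrix exists and is unique up to M \<mapsto> - M and
   M \<mapsto> transpose M.  The first replacement leaves the two conjugates below unchanged,
   the second swaps them, so every notion symmetric in the two conjugates is
   independent of the choice made here. *)
definition extremal_matrix :: "real \<Rightarrow> int^2^2" where
  "extremal_matrix \<xi> = (SOME M. associated_matrix \<xi> M)"

definition conjugate1 :: "real \<Rightarrow> real" where
  "conjugate1 \<xi> = (let M = extremal_matrix \<xi> in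
     - ((real_of_int (M$1$1) + real_of_int (M$1$2) * \<xi>) /
        (real_of_int (M$2$1) + real_of_int (M$2$2) * \<xi>)))"

definition conjugate2 :: "real \<Rightarrow> real" where
  "conjugate2 \<xi> = (let M = extremal_matrix \<xi> in
     - ((real_of_int (M$1$1) + real_of_int (M$2$1) * \<xi>) /
        (real_of_int (M$1$2) + real_of_int (M$2$2) * \<xi>)))"

definition reduced :: "real \<Rightarrow> bool" where
  "reduced \<xi> \<longleftrightarrow>
     extremal \<xi> \<and> 0 < \<xi> \<and> \<xi> < 1 \<and> conjugate1 \<xi> < -1 \<and> conjugate2 \<xi> < -1"

definition balanced :: "real \<Rightarrow> bool" where
  "balanced \<xi> \<longleftrightarrow> reduced \<xi> \<and> \<lfloor>conjugate1 \<xi>\<rfloor> \<noteq> \<lfloor>conjugate2 \<xi>\<rfloor>"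

end

theory Submission
  imports Defs
begin

text \<open>
Symmetric integer matrices close to the line spanned by (1, \<xi>)^T (1, \<xi>) are studied through the logarithms of
their norm and of their error, which turns the multiplicative estimates into linear inequalities with
coefficients in the field generated by the golden ratio. Among the minimal points of an extremal number,
those where three consecutive ones are linearly independent form a sequence y with norms growing like a
\<gamma>-th power, bounded product of norm and error, and independent consecutive triples. Any good
approximation must be proportional to a member of y, because two determinants with neighbouring
members are integers smaller than 1. Applied to y(k+2) y(k+3)^(-1) y(k+2) this yields y(k), hence
y(k+1)^(-1) y(k+2) y(k)^(-1) and its successor are transposes of each other up to proportionality; this gives
the matrix M, and applied to an arbitrary approximating sequence it gives the uniqueness of M. Consequently the
unordered pair of conjugates is equivariant under the modular group, and what remains concerns triples of
distinct irrational numbers: the Gauss map expands distances, so iterating it forward separates \<xi> from its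
conjugates, and iterating it backward makes the integral parts of the conjugates differ. For uniqueness, a
modular transformation between reduced triples which is not trivial sends the half-line below -1 into an
interval between two Farey neighbours, or its inverse does, so it forces equal integral parts.
\<close>

section \<open>Integer matrices up to proportionality\<close>

text \<open>The products \<open>\<star>\<close> in P, the signs and the inverses are absorbed by
  working up to \<open>\<simeq>\<close> with the adjugate as inverse, so that recurrences become
  identities between integer matrices. The relation y(k+3) = y(k+2) y(k)^(-1) y(k+2) has to be
  derived backwards: for the forward product the available error bound is only of order N(k)^(-1),
  where N(k) is the norm of y(k), far above the N(k+3)^(-1) required of y(k+3); whereas in y(k+2)
  y(k+3)^(-1) y(k+2) a cancellation brings the norm down to order N(k), which an error of order
  N(k)^(-1) matches. The logarithmic inequalities close up because \<gamma> (\<gamma> - 1) = 1 and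
  (\<gamma> + 1)(2 - \<gamma>) = 1: these factors invert the coefficients that occur. Since the
  conjugates are defined through a matrix picked by \<open>SOME\<close>, existence of an associated
  matrix has to come before any statement about them, and only its class up to sign and
  transposition is under control; the conjugates are therefore known only as an unordered
  pair.\<close>

definition mat2 :: "'a::zero \<Rightarrow> 'a \<Rightarrow> 'a \<Rightarrow> 'a \<Rightarrow> 'a^2^2" where
  "mat2 a b c d = vector [vector [a, b], vector [c, d]]"

lemma mat2_nth [simp]:
  "mat2 a b c d $ 1 $ 1 = a" "mat2 a b c d $ 1 $ 2 = b"
  "mat2 a b c d $ 2 $ 1 = c" "mat2 a b c d $ 2 $ 2 = d"
  by (simp_all add: mat2_def)

lemma mat_eq_iff2:
  "(A :: 'a^2^2) = B \<longleftrightarrow> A$1$1 = B$1$1 \<and> A$1$2 = B$1$2 \<and> A$2$1 = B$2$1 \<and> A$2$2 = B$2$2"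
  by (auto simp: vec_eq_iff forall_2)

lemma mult_nth2:
  fixes A B :: "'a::semiring_1^2^2"
  shows "(A ** B) $ i $ j = A$i$1 * B$1$j + A$i$2 * B$2$j"
  by (simp add: matrix_matrix_mult_def sum_2)

lemma transpose_nth2 [simp]: "transpose A $ i $ j = A $ j $ i"
  by (simp add: transpose_def)

lemma mat1_nth2 [simp]:
  "(mat c :: 'a::zero^2^2) $ 1 $ 1 = c" "(mat c :: 'a^2^2) $ 1 $ 2 = 0"
  "(mat c :: 'a^2^2) $ 2 $ 1 = 0" "(mat c :: 'a^2^2) $ 2 $ 2 = c"
  by (simp_all add: mat_def)

definition smul :: "int \<Rightarrow> int^2^2 \<Rightarrow> int^2^2" where
  "smul s A = map_matrix ((*) s) A"

lemma smul_nth [simp]: "smul s A $ i $ j = s * A $ i $ j"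
  by (simp add: smul_def map_matrix_def)

text \<open>Serves as an inverse up to the scalar \<open>det A\<close> without leaving the integer
  matrices; it commutes with transposition, so it preserves symmetry.\<close>

definition adj :: "int^2^2 \<Rightarrow> int^2^2" where
  "adj A = mat2 (A$2$2) (- A$1$2) (- A$2$1) (A$1$1)"

lemma adj_nth [simp]:
  "adj A $ 1 $ 1 = A$2$2" "adj A $ 1 $ 2 = - A$1$2"
  "adj A $ 2 $ 1 = - A$2$1" "adj A $ 2 $ 2 = A$1$1"
  by (simp_all add: adj_def)

lemma adj_mult: "A ** adj A = smul (det A) (mat 1)" "adj A ** A = smul (det A) (mat 1)"
  by (auto simp: mat_eq_iff2 mult_nth2 det_2 algebra_simps)

lemma adj_transpose: "adj (transpose A) = transpose (adj A)"
  by (simp add: mat_eq_iff2)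

lemma det_adj [simp]: "det (adj A) = det A"
  by (simp add: det_2 algebra_simps)

lemma smul_mult: "smul s A ** B = smul s (A ** B)" "A ** smul s B = smul s (A ** B)"
  by (auto simp: mat_eq_iff2 mult_nth2 algebra_simps)

lemma smul_smul: "smul s (smul t A) = smul (s * t) A"
  by (simp add: mat_eq_iff2 algebra_simps)

lemma smul_transpose: "transpose (smul s A) = smul s (transpose A)"
  by (simp add: mat_eq_iff2)

lemma smul_one [simp]: "smul 1 A = A"
  by (simp add: mat_eq_iff2)

lemma det_smul: "det (smul s A) = s^2 * det A"
  by (simp add: det_2 algebra_simps power2_eq_square)

lemma smul_cancel: "s \<noteq> 0 \<Longrightarrow> smul s A = smul s B \<longleftrightarrow> A = B"
  by (simp add: mat_eq_iff2)

lemma det_transpose_int [simp]: "det (transpose A :: int^2^2) = det A"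
  by (simp add: det_2)

text \<open>For matrices of non-zero determinant this is equality in PGL_2(Q); one scalar on each
  side keeps it over the integers and visibly symmetric.\<close>

definition proportional :: "int^2^2 \<Rightarrow> int^2^2 \<Rightarrow> bool"  (infix \<open>\<simeq>\<close> 50) where
  "A \<simeq> B \<longleftrightarrow> (\<exists>s t. s \<noteq> 0 \<and> t \<noteq> 0 \<and> smul s A = smul t B)"

lemma prop_refl [simp]: "A \<simeq> A"
  unfolding proportional_def by (rule exI[of _ 1], rule exI[of _ 1]) simp

lemma prop_sym: "A \<simeq> B \<Longrightarrow> B \<simeq> A"
  unfolding proportional_def by metis

lemma prop_trans [trans]: "A \<simeq> B \<Longrightarrow> B \<simeq> C \<Longrightarrow> A \<simeq> C"
  unfolding proportional_def
proof (elim exE conjE)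
  fix s t s' t' assume h: "s \<noteq> 0" "t \<noteq> 0" "smul s A = smul t B" "s' \<noteq> 0" "t' \<noteq> 0" "smul s' B = smul t' C"
  have "smul (s' * s) A = smul s' (smul t B)" using h by (simp flip: smul_smul)
  also have "\<dots> = smul t (smul s' B)" by (simp add: smul_smul mult.commute)
  also have "\<dots> = smul (t * t') C" using h by (simp add: smul_smul)
  finally show "\<exists>s t. s \<noteq> 0 \<and> t \<noteq> 0 \<and> smul s A = smul t C"
    using h by (metis mult_eq_0_iff)
qed

lemma prop_mult: "A \<simeq> B \<Longrightarrow> C \<simeq> D \<Longrightarrow> A ** C \<simeq> B ** D"
  unfolding proportional_def
proof (elim exE conjE)
  fix s t s' t' assume h: "s \<noteq> 0" "t \<noteq> 0" "smul s A = smul t B" "s' \<noteq> 0" "t' \<noteq> 0" "smul s' C = smul t' D"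
  have "smul s A ** smul s' C = smul t B ** smul t' D" using h by simp
  then have "smul (s * s') (A ** C) = smul (t * t') (B ** D)"
    by (simp add: smul_mult smul_smul mult.commute)
  then show "\<exists>s t. s \<noteq> 0 \<and> t \<noteq> 0 \<and> smul s (A ** C) = smul t (B ** D)"
    using h by (metis mult_eq_0_iff)
qed

lemma prop_smul: "s \<noteq> 0 \<Longrightarrow> smul s A \<simeq> A"
  unfolding proportional_def by (rule exI[of _ 1], rule exI[of _ s]) simp

lemma prop_uminus: "- A \<simeq> A"
  using prop_smul[of "-1" A] by (simp add: smul_def map_matrix_def vec_eq_iff proportional_def)

lemma prop_transpose: "A \<simeq> B \<Longrightarrow> transpose A \<simeq> transpose B"
  unfolding proportional_def by (metis smul_transpose)

lemma prop_det: "A \<simeq> B \<Longrightarrow> det A \<noteq> 0 \<longleftrightarrow> det B \<noteq> 0"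
  unfolding proportional_def
proof (elim exE conjE)
  fix s t assume h: "s \<noteq> 0" "t \<noteq> 0" "smul s A = smul t B"
  then have "s^2 * det A = t^2 * det B" by (metis det_smul)
  then show "det A \<noteq> 0 \<longleftrightarrow> det B \<noteq> 0" using h by auto
qed

lemma prop_adj_cancel:
  assumes "det A \<noteq> 0"
  shows "adj A ** (A ** B) \<simeq> B" "(B ** A) ** adj A \<simeq> B" "A ** (adj A ** B) \<simeq> B" "(B ** adj A) ** A \<simeq> B"
  using assms
  by (simp_all add: matrix_mul_assoc adj_mult smul_mult prop_smul)
     (simp_all add: matrix_mul_assoc[symmetric] adj_mult smul_mult prop_smul)

lemma proportionalI:
  assumes "A \<noteq> 0" "B \<noteq> 0" and *: "\<And>i j k l. A$i$j * B$k$l = A$k$l * B$i$j"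
  shows "A \<simeq> B"
proof -
  obtain k l where kl: "B$k$l \<noteq> 0" using assms(2) by (auto simp: vec_eq_iff)
  obtain i j where ij: "A$i$j \<noteq> 0" using assms(1) by (auto simp: vec_eq_iff)
  have "A$k$l \<noteq> 0" using *[of i j k l] kl ij by auto
  moreover have "smul (B$k$l) A = smul (A$k$l) B"
    using *[of _ _ k l] by (simp add: vec_eq_iff mult.commute)
  ultimately show ?thesis unfolding proportional_def using kl by blast
qed

section \<open>Content, primitive matrices and the product of P\<close>

lemma content_eq: "content A = gcd (gcd (A$1$1) (A$1$2)) (gcd (A$2$1) (A$2$2))"
proof -
  have "{A$i$j | i j. True} = {A$1$1, A$1$2, A$2$1, A$2$2}"
  proof (intro equalityI subsetI)
    fix t assume "t \<in> {A$i$j | i j. True}"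
    then obtain i j where "t = A$i$j" by blast
    then show "t \<in> {A$1$1, A$1$2, A$2$1, A$2$2}"
      using exhaust_2[of i] exhaust_2[of j] by auto
  qed auto
  then show ?thesis by (simp add: content_def gcd.assoc)
qed

lemma content_bezout: "\<exists>a b c d. a * A$1$1 + b * A$1$2 + c * A$2$1 + d * A$2$2 = content A"
proof -
  obtain u v where 1: "u * A$1$1 + v * A$1$2 = gcd (A$1$1) (A$1$2)" using bezout_int by blast
  obtain u' v' where 2: "u' * A$2$1 + v' * A$2$2 = gcd (A$2$1) (A$2$2)" using bezout_int by blast
  obtain p q where 3: "p * gcd (A$1$1) (A$1$2) + q * gcd (A$2$1) (A$2$2) = content A"
    unfolding content_eq using bezout_int by blast
  have "(p * u) * A$1$1 + (p * v) * A$1$2 + (q * u') * A$2$1 + (q * v') * A$2$2 = content A"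
    using 3 unfolding 1[symmetric] 2[symmetric] by (simp add: algebra_simps)
  then show ?thesis by blast
qed

lemma content_dvd: "content A dvd A$i$j"
  unfolding content_def by (rule Gcd_dvd) auto

lemma content_greatest: "(\<And>i j. c dvd A$i$j) \<Longrightarrow> c dvd content A"
  unfolding content_def by (rule Gcd_greatest) auto

lemma content_nonneg: "content A \<ge> 0"
  unfolding content_eq by simp

lemma content_transpose [simp]: "content (transpose A) = content A"
  unfolding content_eq by (simp add: ac_simps)

lemma prim_transpose: "A \<in> prim_matrices \<Longrightarrow> transpose A \<in> prim_matrices"
  by (simp add: prim_matrices_def)

lemma prim_det: "A \<in> prim_matrices \<Longrightarrow> det A \<noteq> 0"
  by (simp add: prim_matrices_def)

lemma prim_content: "A \<in> prim_matrices \<Longrightarrow> content A = 1"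
  by (simp add: prim_matrices_def)

lemma smul_prim:
  assumes "content B = 1" "smul s A = smul t B" "s \<noteq> 0"
  obtains r where "A = smul r B"
proof -
  obtain a b c d where abcd: "a * B$1$1 + b * B$1$2 + c * B$2$1 + d * B$2$2 = 1"
    using content_bezout[of B] assms by auto
  \<comment> \<open>The Bezout combination that yields 1 on \<open>B\<close> is evaluated on
    \<open>A\<close>; comparing the two gives \<open>s * r = t\<close>, so the ratio is an
    integer.\<close>
  define r where "r = a * A$1$1 + b * A$1$2 + c * A$2$1 + d * A$2$2"
  have e: "s * A$i$j = t * B$i$j" for i j using arg_cong[OF assms(2), of "\<lambda>X. X$i$j"] by simp
  have "s * r = t * (a * B$1$1 + b * B$1$2 + c * B$2$1 + d * B$2$2)"
    using e[of 1 1] e[of 1 2] e[of 2 1] e[of 2 2] unfolding r_def by algebra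
  then have "s * r = t" using abcd by simp
  then have "A = smul r B" using assms(2,3)
    by (metis smul_cancel smul_smul)
  then show ?thesis by (rule that)
qed

lemma prop_prim:
  assumes "content A = 1" "content B = 1" "A \<simeq> B"
  shows "A = B \<or> A = - B"
proof -
  obtain s t where st: "s \<noteq> 0" "t \<noteq> 0" "smul s A = smul t B"
    using assms(3) unfolding proportional_def by blast
  obtain r where r: "A = smul r B" using smul_prim[OF assms(2) st(3,1)] .
  have "r dvd content A" unfolding r by (rule content_greatest) simp
  then have "r = 1 \<or> r = -1" using assms(1) by auto
  then show ?thesis unfolding r by (auto simp: mat_eq_iff2)
qed

lemma prim_mult_scale:
  assumes "det A \<noteq> 0" "det B \<noteq> 0"
  obtains c where "c > 0" "smul c (A \<star> B) = A ** B" "content (A \<star> B) = 1"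
proof -
  define P where "P = A ** B"
  define c where "c = content P"
  have "det P \<noteq> 0" using assms by (simp add: P_def det_mul)
  then have "P \<noteq> 0" by (auto simp: det_2)
  then have "c \<noteq> 0" using content_dvd[of P] unfolding c_def by (auto simp: vec_eq_iff)
  then have c: "c > 0" using content_nonneg[of P] c_def by auto
  have e: "smul c (A \<star> B) = P"
    using content_dvd[of P] by (simp add: prim_mult_def vec_eq_iff flip: P_def) (simp add: c_def map_matrix_def)
  \<comment> \<open>A common divisor left in the quotient would multiply up to a common divisor of
    \<open>P\<close> larger than its content \<open>c\<close>.\<close>
  have "c * content (A \<star> B) dvd c"
    unfolding c_def 
    by (rule content_greatest, subst (2) e[symmetric]) (simp add: c_def content_dvd mult_dvd_mono)
  then have "content (A \<star> B) dvd 1" using c by (metis dvd_mult_cancel_left mult.right_neutral order_less_irrefl)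
  then have "content (A \<star> B) = 1" using content_nonneg[of "A \<star> B"] by simp
  with c e show ?thesis using that unfolding P_def by blast
qed

lemma prim_mult_proportional:
  assumes "det A \<noteq> 0" "det B \<noteq> 0"
  shows "A \<star> B \<simeq> A ** B" "A \<star> B \<in> prim_matrices"
proof -
  obtain c where c: "c > 0" "smul c (A \<star> B) = A ** B" "content (A \<star> B) = 1"
    using prim_mult_scale[OF assms] .
  show 1: "A \<star> B \<simeq> A ** B"
    unfolding proportional_def using c by (intro exI[of _ c] exI[of _ 1]) auto
  have "det (A \<star> B) \<noteq> 0" using prop_det[OF 1] assms by (simp add: det_mul)
  then show "A \<star> B \<in> prim_matrices" using c by (simp add: prim_matrices_def)
qed

text \<open>Turns the recurrence in the definition of the associated matrix, with its normalised
  products and undetermined sign, into a single proportionality; primitive representatives are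
  unique up to sign.\<close>

lemma prim_mult3_iff:
  assumes "A \<in> prim_matrices" "M \<in> prim_matrices" "B \<in> prim_matrices" "X \<in> prim_matrices"
  shows "X = A \<star> M \<star> B \<or> X = - (A \<star> M \<star> B) \<longleftrightarrow> X \<simeq> A ** M ** B"
proof -
  have d: "det (A \<star> M) \<noteq> 0" "det A \<noteq> 0" "det B \<noteq> 0" "det M \<noteq> 0"
    using assms prim_mult_proportional(2) prim_det by blast+
  have 1: "A \<star> M \<star> B \<simeq> A ** M ** B"
    by (meson d prim_mult_proportional(1) prop_mult prop_refl prop_trans)
  have 2: "content (A \<star> M \<star> B) = 1" using prim_mult_proportional(2)[OF d(1,3)] prim_content by blast
  have 3: "X = A \<star> M \<star> B \<or> X = - (A \<star> M \<star> B) \<longleftrightarrow> X \<simeq> A \<star> M \<star> B"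
    using prop_prim[OF prim_content[OF assms(4)] 2] prop_uminus by auto
  show ?thesis
    unfolding 3 using 1 prop_sym prop_trans by blast
qed

lemma prim_part_exists:
  assumes "det A \<noteq> 0"
  obtains P where "P \<in> prim_matrices" "P \<simeq> A"
  using prim_mult_proportional[OF assms, of "mat 1"] that by (simp add: matrix_mul_rid)

section \<open>Estimates for symmetric matrices near a conic point\<close>

abbreviation symmetric :: "int^2^2 \<Rightarrow> bool" where
  "symmetric x \<equiv> transpose x = x"

lemma symmetric_iff: "symmetric x \<longleftrightarrow> x$2$1 = x$1$2"
  by (auto simp: mat_eq_iff2)

lemma symmetric_nth: "symmetric x \<Longrightarrow> x$2$1 = x$1$2"
  by (simp add: symmetric_iff)

definition err :: "real \<Rightarrow> int^2^2 \<Rightarrow> real" where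
  "err \<xi> x = infnorm ((vector [\<xi>, -1] :: real^2) v* map_matrix real_of_int x)"

lemma infnorm_vec2: "infnorm (v :: real^2) = max \<bar>v$1\<bar> \<bar>v$2\<bar>"
proof -
  have "{\<bar>v $ i\<bar> |i. i \<in> UNIV} = {\<bar>v$1\<bar>, \<bar>v$2\<bar>}"
    by (auto simp: UNIV_2)
  then have "infnorm v = Sup {\<bar>v$1\<bar>, \<bar>v$2\<bar>}" by (simp add: infnorm_cart)
  then show ?thesis by (simp add: cSup_eq_Max)
qed

lemma err_eq:
  "err \<xi> x = max \<bar>\<xi> * x$1$1 - x$2$1\<bar> \<bar>\<xi> * x$1$2 - x$2$2\<bar>"
  unfolding err_def infnorm_vec2
  by (simp add: vector_matrix_mult_def sum_2 map_matrix_def vector_2 algebra_simps)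

lemma abs_nth_le_mat_norm: "\<bar>real_of_int (A$i$j)\<bar> \<le> mat_norm A"
proof -
  have "\<bar>map_matrix real_of_int A \<bullet> axis i (axis j 1)\<bar> \<le> infnorm (map_matrix real_of_int A)"
    by (intro Basis_le_infnorm) (simp add: axis_in_Basis_iff)
  then show ?thesis
    by (simp add: mat_norm_def inner_axis map_matrix_def)
qed

lemma mat_norm_le:
  assumes "\<And>i j. \<bar>real_of_int (A$i$j)\<bar> \<le> b"
  shows "mat_norm A \<le> b"
  unfolding mat_norm_def infnorm_Max
proof (subst Max_le_iff)
  show "\<forall>a\<in>(\<lambda>i. \<bar>map_matrix real_of_int A \<bullet> i\<bar>) ` Basis. a \<le> b"
    using assms by (auto simp: Basis_vec_def inner_axis map_matrix_def)
qed auto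

lemma mat_norm_eq:
  "mat_norm A = real_of_int (max (max \<bar>A$1$1\<bar> \<bar>A$1$2\<bar>) (max \<bar>A$2$1\<bar> \<bar>A$2$2\<bar>))" (is "_ = real_of_int ?m")
proof (rule antisym)
  show "mat_norm A \<le> real_of_int ?m"
  proof (rule mat_norm_le)
    fix i j :: 2
    have "\<bar>A$i$j\<bar> \<le> ?m" using exhaust_2[of i] exhaust_2[of j] by (auto simp: le_max_iff_disj)
    then show "\<bar>real_of_int (A$i$j)\<bar> \<le> real_of_int ?m" by linarith
  qed
  show "real_of_int ?m \<le> mat_norm A"
    using abs_nth_le_mat_norm[of A 1 1] abs_nth_le_mat_norm[of A 1 2]
      abs_nth_le_mat_norm[of A 2 1] abs_nth_le_mat_norm[of A 2 2]
    by (auto simp: max_def)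
qed

lemma mat_norm_nonneg: "mat_norm A \<ge> 0"
  using abs_nth_le_mat_norm[of A 1 1] by linarith

lemma mat_norm_ge1:
  assumes "A \<noteq> 0" shows "mat_norm A \<ge> 1"
proof -
  obtain i j where "A$i$j \<noteq> 0" using assms by (auto simp: vec_eq_iff)
  then have "\<bar>real_of_int (A$i$j)\<bar> \<ge> 1" by linarith
  then show ?thesis using abs_nth_le_mat_norm[of A i j] by linarith
qed

lemma mat_norm_smul: "mat_norm (smul s A) = \<bar>real_of_int s\<bar> * mat_norm A"
  unfolding mat_norm_eq by (simp add: abs_mult max_mult_distrib_left of_int_max)

lemma err_smul: "err \<xi> (smul s A) = \<bar>real_of_int s\<bar> * err \<xi> A"
proof -
  have "\<xi> * (smul s A)$1$1 - (smul s A)$2$1 = s * (\<xi> * A$1$1 - A$2$1)"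
       "\<xi> * (smul s A)$1$2 - (smul s A)$2$2 = s * (\<xi> * A$1$2 - A$2$2)" by (simp_all add: algebra_simps)
  then show ?thesis unfolding err_eq by (simp add: abs_mult max_mult_distrib_left)
qed

lemma mat_norm_uminus: "mat_norm (- A) = mat_norm A"
  unfolding mat_norm_eq by simp

lemma finite_mat_norm_le: "finite {A. mat_norm A \<le> b}"
proof -
  let ?S = "{- \<lfloor>b\<rfloor>..\<lfloor>b\<rfloor>}"
  have "{A. mat_norm A \<le> b} \<subseteq> (\<lambda>(p,q,r,s). mat2 p q r s) ` (?S \<times> ?S \<times> ?S \<times> ?S)"
  proof
    fix A assume "A \<in> {A. mat_norm A \<le> b}"
    then have *: "\<bar>real_of_int (A$i$j)\<bar> \<le> b" for i j
      using abs_nth_le_mat_norm[of A i j] by simp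
    have "A$i$j \<in> ?S" for i j using *[of i j] by simp linarith
    then show "A \<in> (\<lambda>(p,q,r,s). mat2 p q r s) ` (?S \<times> ?S \<times> ?S \<times> ?S)"
      by (intro image_eqI[of _ _ "(A$1$1, A$1$2, A$2$1, A$2$2)"]) (simp_all add: mat_eq_iff2)
  qed
  then show ?thesis by (rule finite_subset) simp
qed

lemma err_pos:
  assumes "\<xi> \<notin> \<rat>" "A \<noteq> 0" shows "err \<xi> A > 0"
proof (rule ccontr)
  assume "\<not> err \<xi> A > 0"
  then have e: "\<xi> * A$1$1 = A$2$1" "\<xi> * A$1$2 = A$2$2" unfolding err_eq by auto
  have "x = 0" if "\<xi> * real_of_int x = real_of_int y" for x y :: int
  proof (rule ccontr)
    assume "x \<noteq> 0"
    then have "\<xi> = real_of_int y / real_of_int x" using that by (simp add: field_simps)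
    then show False using assms(1) by auto
  qed
  then have "A$1$1 = 0" "A$1$2 = 0" using e by blast+
  with e have "A = 0" by (simp add: mat_eq_iff2)
  then show False using assms by simp
qed

section \<open>Symmetric matrices as vectors (x11, x12, x22) of Z^3\<close>

definition dot3 :: "int^2^2 \<Rightarrow> int^2^2 \<Rightarrow> int" where
  "dot3 u x = u$1$1 * x$1$1 + u$1$2 * x$1$2 + u$2$2 * x$2$2"

text \<open>The vector product in the coordinates (x11, x12, x22), stored again as a symmetric
  matrix so that norms and further products apply to it.\<close>

definition cross :: "int^2^2 \<Rightarrow> int^2^2 \<Rightarrow> int^2^2" where
  "cross x y = mat2 (x$1$2 * y$2$2 - x$2$2 * y$1$2) (x$2$2 * y$1$1 - x$1$1 * y$2$2)
     (x$2$2 * y$1$1 - x$1$1 * y$2$2) (x$1$1 * y$1$2 - x$1$2 * y$1$1)"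

definition det3 :: "int^2^2 \<Rightarrow> int^2^2 \<Rightarrow> int^2^2 \<Rightarrow> int" where
  "det3 x y z = dot3 (cross x y) z"

lemma symmetric_cross [simp]: "symmetric (cross x y)"
  by (simp add: symmetric_iff cross_def)

lemma det3_rotate: "det3 x y z = det3 y z x"
  by (simp add: det3_def dot3_def cross_def algebra_simps)

lemma dot3_cross_self [simp]: "dot3 (cross x y) x = 0" "dot3 (cross x y) y = 0"
  by (simp_all add: dot3_def cross_def algebra_simps)

text \<open>The expansion u x (z x w) = (u.w) z - (u.z) w, with the second term gone.\<close>

lemma cross_cross:
  assumes "dot3 u z = 0" "symmetric z"
  shows "cross u (cross z w) = smul (dot3 u w) z"
proof -
  have h: "u$1$1 * z$1$1 + u$1$2 * z$1$2 + u$2$2 * z$2$2 = 0" using assms(1) by (simp add: dot3_def)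
  show ?thesis
    unfolding mat_eq_iff2 symmetric_nth[OF assms(2)] dot3_def cross_def mat2_nth smul_nth
  proof (intro conjI)
  qed (use h in algebra)+
qed

lemma cross_eq_0_imp:
  assumes "symmetric x" "symmetric y" "x \<noteq> 0" "y \<noteq> 0" "cross x y = 0"
  shows "x \<simeq> y"
proof (rule proportionalI[OF assms(3,4)])
  have e: "x$1$2 * y$2$2 = x$2$2 * y$1$2" "x$2$2 * y$1$1 = x$1$1 * y$2$2" "x$1$1 * y$1$2 = x$1$2 * y$1$1"
    using assms(5) by (auto simp: cross_def mat_eq_iff2)
  fix i j k l :: 2
  show "x$i$j * y$k$l = x$k$l * y$i$j"
    using exhaust_2[of i] exhaust_2[of j] exhaust_2[of k] exhaust_2[of l] e
      symmetric_nth[OF assms(1)] symmetric_nth[OF assms(2)]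
    by (elim disjE) (simp_all add: mult.commute)
qed

text \<open>The normal of the plane through \<open>a\<close> and \<open>b\<close> is unique up to
  proportionality, so any such \<open>u\<close> may replace \<open>cross a b\<close> when testing
  whether \<open>z\<close> lies in that plane.\<close>

lemma orthogonal_iff_det3:
  assumes "symmetric a" "symmetric b" "a \<noteq> 0" "b \<noteq> 0" "\<not> a \<simeq> b"
    and "symmetric u" "u \<noteq> 0" "dot3 u a = 0" "dot3 u b = 0"
  shows "dot3 u z = 0 \<longleftrightarrow> det3 a b z = 0"
proof -
  have c: "cross a b \<noteq> 0" using cross_eq_0_imp assms by blast
  have "cross u (cross a b) = 0"
    using cross_cross[OF assms(8,1), of b] assms(9) by (simp add: mat_eq_iff2)
  then have "u \<simeq> cross a b"
    using cross_eq_0_imp[OF assms(6) symmetric_cross assms(7) c] by blast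
  then obtain s t where st: "s \<noteq> 0" "t \<noteq> 0" "smul s u = smul t (cross a b)"
    unfolding proportional_def by blast
  have "s * dot3 u z = t * det3 a b z"
  proof -
    have "s * u$1$1 = t * cross a b$1$1" "s * u$1$2 = t * cross a b$1$2" "s * u$2$2 = t * cross a b$2$2"
      using st(3) by (simp_all add: mat_eq_iff2)
    then show ?thesis unfolding det3_def dot3_def by algebra
  qed
  then show ?thesis using st by auto
qed

section \<open>Determinants and products bounded by norm and error\<close>

context
  fixes \<xi> K :: real
  assumes K: "K = 1 + \<bar>\<xi>\<bar>"
begin

text \<open>Eliminating x12 and x22 through these offsets cancels the main terms of any alternating expression.\<close>

definition offset1 :: "int^2^2 \<Rightarrow> real" where "offset1 x = \<xi> * x$1$1 - x$1$2"
definition offset2 :: "int^2^2 \<Rightarrow> real" where "offset2 x = \<xi> * x$1$2 - x$2$2"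

lemma offsets:
  shows "real_of_int (x$1$2) = \<xi> * x$1$1 - offset1 x" "real_of_int (x$2$2) = \<xi> * x$1$2 - offset2 x"
    and "symmetric x \<Longrightarrow> \<bar>offset1 x\<bar> \<le> err \<xi> x" "symmetric x \<Longrightarrow> \<bar>offset2 x\<bar> \<le> err \<xi> x"
  using symmetric_nth[of x] by (simp_all add: offset1_def offset2_def err_eq)

lemma abs_mult_le: "\<bar>a\<bar> \<le> A \<Longrightarrow> \<bar>b\<bar> \<le> B \<Longrightarrow> \<bar>a * b\<bar> \<le> A * (B::real)"
  unfolding abs_mult by (rule mult_mono) auto

lemma abs_det_le:
  assumes "symmetric x"
  shows "\<bar>real_of_int (det x)\<bar> \<le> 2 * mat_norm x * err \<xi> x"
proof -
  note e = offsets(1,2)[of x] offsets(3,4)[OF assms]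
  have "real_of_int (det x) = x$1$2 * offset1 x - x$1$1 * offset2 x"
    by (simp add: det_2 e(1,2) symmetric_nth[OF assms] algebra_simps)
  moreover have "\<bar>x$1$2 * offset1 x\<bar> \<le> mat_norm x * err \<xi> x" "\<bar>x$1$1 * offset2 x\<bar> \<le> mat_norm x * err \<xi> x"
    by (intro abs_mult_le abs_nth_le_mat_norm e)+
  ultimately show ?thesis by linarith
qed

lemma six_terms_le:
  fixes a a1 a2 b b1 b2 c c1 c2 :: real
  assumes "\<bar>a1\<bar> \<le> a" "\<bar>a2\<bar> \<le> a" "\<bar>b1\<bar> \<le> b" "\<bar>b2\<bar> \<le> b" "\<bar>c1\<bar> \<le> c" "\<bar>c2\<bar> \<le> c"
  shows "\<bar>(a1 - a2) - (b1 - b2) + (c1 - c2)\<bar> \<le> 2 * (a + b + c)"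
proof -
  have "\<bar>a1 - a2\<bar> \<le> 2 * a" "\<bar>b1 - b2\<bar> \<le> 2 * b" "\<bar>c1 - c2\<bar> \<le> 2 * c"
    using assms by linarith+
  then show ?thesis unfolding distrib_left by linarith
qed

text \<open>All three vectors are close to the line of (1, \<xi>, \<xi>^2); column operations along
  this line leave one entry and two offsets in each term of the determinant.\<close>

lemma abs_det3_le:
  assumes "symmetric x" "symmetric y" "symmetric z"
  shows "\<bar>real_of_int (det3 x y z)\<bar> \<le> 2 * (mat_norm x * err \<xi> y * err \<xi> z
     + mat_norm y * err \<xi> x * err \<xi> z + mat_norm z * err \<xi> x * err \<xi> y)"
proof -
  note e = offsets(1,2)[of x] offsets(3,4)[OF assms(1)]
  note f = offsets(1,2)[of y] offsets(3,4)[OF assms(2)]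
  note g = offsets(1,2)[of z] offsets(3,4)[OF assms(3)]
  have eq: "real_of_int (det3 x y z) = (x$1$1 * offset1 y * offset2 z - x$1$1 * offset2 y * offset1 z)
    - (y$1$1 * offset1 x * offset2 z - y$1$1 * offset2 x * offset1 z) + (z$1$1 * offset1 x * offset2 y - z$1$1 * offset2 x * offset1 y)"
    by (simp add: det3_def dot3_def cross_def e(1) f(1) g(1) e(2) f(2) g(2) algebra_simps)
  show ?thesis
    unfolding eq
    by (rule six_terms_le; intro abs_mult_le abs_nth_le_mat_norm e f g)
qed

text \<open>The common size of the 2x2 minors formed with \<open>x\<close> and \<open>y\<close>:
  both are nearly of rank one in the same direction, so each minor reduces to products of one entry
  and one offset.\<close>

definition mixed :: "int^2^2 \<Rightarrow> int^2^2 \<Rightarrow> real" where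
  "mixed x y = mat_norm x * err \<xi> y + mat_norm y * err \<xi> x"

lemma abs_minor_le:
  assumes "symmetric x" "symmetric y"
  shows "\<bar>real_of_int (x$1$1 * y$1$2 - x$1$2 * y$1$1)\<bar> \<le> mixed x y"
    "\<bar>real_of_int (x$1$2 * y$2$2 - x$2$2 * y$1$2)\<bar> \<le> mixed x y"
    "\<bar>real_of_int (x$1$1 * y$2$2 - x$1$2 * y$1$2)\<bar> \<le> mixed x y"
    "\<bar>real_of_int (x$2$2 * y$1$1 - x$1$2 * y$1$2)\<bar> \<le> mixed x y"
    "\<bar>real_of_int (x$2$2 * y$1$1 - x$1$1 * y$2$2)\<bar> \<le> 2 * mixed x y"
proof -
  note e = offsets(1,2)[of x] offsets(3,4)[OF assms(1)]
  note f = offsets(1,2)[of y] offsets(3,4)[OF assms(2)]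
  have m: "\<bar>x$i$j * offset1 y\<bar> \<le> mat_norm x * err \<xi> y" "\<bar>x$i$j * offset2 y\<bar> \<le> mat_norm x * err \<xi> y"
    "\<bar>y$i$j * offset1 x\<bar> \<le> mat_norm y * err \<xi> x" "\<bar>y$i$j * offset2 x\<bar> \<le> mat_norm y * err \<xi> x" for i j
    by (intro abs_mult_le abs_nth_le_mat_norm e f)+
  have 1: "real_of_int (x$1$1 * y$1$2 - x$1$2 * y$1$1) = y$1$1 * offset1 x - x$1$1 * offset1 y"
    by (simp add: e(1) f(1) algebra_simps)
  have 2: "real_of_int (x$1$2 * y$2$2 - x$2$2 * y$1$2) = y$1$2 * offset2 x - x$1$2 * offset2 y"
    by (simp add: e(2) f(2) algebra_simps)
  have 3: "real_of_int (x$1$1 * y$2$2 - x$1$2 * y$1$2) = y$1$2 * offset1 x - x$1$1 * offset2 y"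
    by (simp add: e(1) f(2) algebra_simps)
  have 4: "real_of_int (x$2$2 * y$1$1 - x$1$2 * y$1$2) = x$1$2 * offset1 y - y$1$1 * offset2 x"
    by (simp add: e(2) f(1) algebra_simps)
  show "\<bar>real_of_int (x$1$1 * y$1$2 - x$1$2 * y$1$1)\<bar> \<le> mixed x y"
    unfolding 1 mixed_def using m[of 1 1] by linarith
  show "\<bar>real_of_int (x$1$2 * y$2$2 - x$2$2 * y$1$2)\<bar> \<le> mixed x y"
    unfolding 2 mixed_def using m[of 1 2] by linarith
  show t: "\<bar>real_of_int (x$1$1 * y$2$2 - x$1$2 * y$1$2)\<bar> \<le> mixed x y"
    unfolding 3 mixed_def using m[of 1 2] m[of 1 1] by linarith
  show t': "\<bar>real_of_int (x$2$2 * y$1$1 - x$1$2 * y$1$2)\<bar> \<le> mixed x y"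
    unfolding 4 mixed_def using m[of 1 2] m[of 1 1] by linarith
  show "\<bar>real_of_int (x$2$2 * y$1$1 - x$1$1 * y$2$2)\<bar> \<le> 2 * mixed x y"
    using t t' by simp
qed

lemma mat_norm_cross_le:
  assumes "symmetric x" "symmetric y"
  shows "mat_norm (cross x y) \<le> 2 * mixed x y"
proof (rule mat_norm_le)
  fix i j :: 2
  have "mixed x y \<ge> 0" using abs_minor_le(1)[OF assms] by linarith
  then show "\<bar>real_of_int (cross x y $ i $ j)\<bar> \<le> 2 * mixed x y"
    using abs_minor_le[OF assms] exhaust_2[of i] exhaust_2[of j]
    by (elim disjE) (auto simp: cross_def)
qed

lemma mat_norm_cross_le':
  "mat_norm (cross x y) \<le> 2 * mat_norm x * mat_norm y"
proof (rule mat_norm_le)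
  fix i j :: 2
  have *: "\<bar>real_of_int (x$a$b) * real_of_int (y$c$d)\<bar> \<le> mat_norm x * mat_norm y" for a b c d
    by (intro abs_mult_le abs_nth_le_mat_norm)
  show "\<bar>real_of_int (cross x y $ i $ j)\<bar> \<le> 2 * mat_norm x * mat_norm y"
    using exhaust_2[of i] exhaust_2[of j] *[of 1 2 2 2] *[of 2 2 1 2] *[of 2 2 1 1] *[of 1 1 2 2] *[of 1 1 1 2] *[of 1 2 1 1]
    by (elim disjE) (simp_all add: cross_def)
qed

lemma err_le_mat_norm: "err \<xi> x \<le> K * mat_norm x"
proof -
  have *: "\<bar>\<xi> * real_of_int (x$i$j)\<bar> \<le> \<bar>\<xi>\<bar> * mat_norm x" for i j
    by (intro abs_mult_le abs_nth_le_mat_norm) simp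
  show ?thesis
    using *[of 1 1] *[of 1 2] abs_nth_le_mat_norm[of x 2 1] abs_nth_le_mat_norm[of x 2 2]
    unfolding err_eq K by (simp add: algebra_simps) linarith
qed

text \<open>The entries are close to x11 (1, \<xi>, \<xi>^2); if x11 vanished, the integers x12 and
  x22 would in turn have absolute value less than 1.\<close>

lemma mat_norm_le_corner:
  assumes "symmetric x" "err \<xi> x < 1" "x \<noteq> 0"
  shows "x$1$1 \<noteq> 0" "mat_norm x \<le> 2 * K^2 * \<bar>x$1$1\<bar>"
proof -
  note e = offsets(1,2)[of x] offsets(3,4)[OF assms(1)]
  show nz: "x$1$1 \<noteq> 0"
  proof
    assume z: "x$1$1 = 0"
    have z': "x$1$2 = 0" using e(1,3) assms(2) z by simp
    have "x$2$2 = 0" using e(2,4) assms(2) z' by simp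
    then show False using z z' assms(1,3) symmetric_iff by (auto simp: mat_eq_iff2)
  qed
  define p where "p = \<bar>real_of_int (x$1$1)\<bar>"
  have p: "p \<ge> 1" using nz unfolding p_def by linarith
  have K1: "K \<ge> 1" using K by simp
  have 1: "\<bar>real_of_int (x$1$2)\<bar> \<le> K * p"
  proof -
    have "\<bar>real_of_int (x$1$2)\<bar> \<le> \<bar>\<xi>\<bar> * p + 1"
      using e(1,3) assms(2) unfolding p_def abs_mult[symmetric] by linarith
    also have "\<dots> \<le> K * p" using p K by (simp add: algebra_simps)
    finally show ?thesis .
  qed
  have 2: "\<bar>real_of_int (x$2$2)\<bar> \<le> 2 * K^2 * p"
  proof -
    have "\<bar>real_of_int (x$2$2)\<bar> \<le> \<bar>\<xi>\<bar> * \<bar>real_of_int (x$1$2)\<bar> + 1"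
      using e(2,4) assms(2) unfolding abs_mult[symmetric] by linarith
    also have "\<dots> \<le> K * (K * p) + 1 * 1"
      using 1 K by (intro add_mono mult_mono) auto
    also have "\<dots> \<le> K * (K * p) + K * (K * p)"
    proof -
      have "1 * 1 \<le> K * (K * p)" using K1 p by (intro mult_mono) (auto intro: order_trans[OF _ mult_mono[of 1 K 1 p]])
      then show ?thesis by simp
    qed
    finally show ?thesis by (simp add: power2_eq_square)
  qed
  have KK: "1 * 1 \<le> K * K" "K * 1 \<le> K * K" using K1 by (intro mult_mono; simp)+
  have 3: "p \<le> 2 * K^2 * p" "K * p \<le> 2 * K^2 * p"
    using mult_right_mono[OF KK(1), of p] mult_right_mono[OF KK(2), of p] p K1
    by (simp_all add: power2_eq_square) 
  show "mat_norm x \<le> 2 * K^2 * \<bar>x$1$1\<bar>"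
  proof (rule mat_norm_le)
    fix i j :: 2
    show "\<bar>real_of_int (x$i$j)\<bar> \<le> 2 * K^2 * \<bar>x$1$1\<bar>"
      using exhaust_2[of i] exhaust_2[of j] 1 2 3 symmetric_nth[OF assms(1)]
      unfolding p_def by (elim disjE) auto
  qed
qed

text \<open>The row (\<xi>, -1) \<open>x\<close> consists of the offsets of \<open>x\<close>, and
  the entries of \<open>adj y ** x\<close> are minors formed with \<open>x\<close> and
  \<open>y\<close>, whence the first bound. In the corner entry the terms without offsets cancel;
  bounding this entry suffices, as \<open>mat_norm_le_corner\<close> recovers the norm from
  it.\<close>

lemma sandwich_bounds:
  assumes "symmetric x" "symmetric y"
  defines "T \<equiv> (mat_norm x)^2 * err \<xi> y + (err \<xi> x)^2 * mat_norm y"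
  defines "w \<equiv> x ** adj y ** x"
  shows "err \<xi> w \<le> 2 * err \<xi> x * mixed x y" "\<bar>real_of_int (w$1$1)\<bar> \<le> 3 * K * T"
proof -
  note e = offsets(1,2)[of x] offsets(3,4)[OF assms(1)]
  note f = offsets(1,2)[of y] offsets(3,4)[OF assms(2)]
  have s: "x$2$1 = x$1$2" "y$2$1 = y$1$2" using symmetric_nth assms by auto
  note minor = abs_minor_le[OF assms(1,2)]
  have r: "\<xi> * w$1$1 - w$2$1 = offset1 x * real_of_int (x$1$1 * y$2$2 - x$1$2 * y$1$2) + offset2 x * - real_of_int (x$1$1 * y$1$2 - x$1$2 * y$1$1)"
    "\<xi> * w$1$2 - w$2$2 = offset1 x * - real_of_int (x$2$2 * y$1$2 - x$1$2 * y$2$2) + offset2 x * real_of_int (x$2$2 * y$1$1 - x$1$2 * y$1$2)"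
    unfolding w_def by (simp_all add: mult_nth2 s e(1) e(2) algebra_simps)
  have M: "\<bar>offset1 x * real_of_int (x$1$1 * y$2$2 - x$1$2 * y$1$2)\<bar> \<le> err \<xi> x * mixed x y"
    "\<bar>offset2 x * - real_of_int (x$1$1 * y$1$2 - x$1$2 * y$1$1)\<bar> \<le> err \<xi> x * mixed x y"
    "\<bar>offset1 x * - real_of_int (x$2$2 * y$1$2 - x$1$2 * y$2$2)\<bar> \<le> err \<xi> x * mixed x y"
    "\<bar>offset2 x * real_of_int (x$2$2 * y$1$1 - x$1$2 * y$1$2)\<bar> \<le> err \<xi> x * mixed x y"
    by (rule abs_mult_le[OF e(3)] abs_mult_le[OF e(4)], use minor in simp)+
  show "err \<xi> w \<le> 2 * err \<xi> x * mixed x y"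
    unfolding err_eq[of \<xi> w] r mult.assoc[of 2]
    using abs_triangle_ineq[THEN order_trans, OF add_mono[OF M(1,2)]]
      abs_triangle_ineq[THEN order_trans, OF add_mono[OF M(3,4)]]
    unfolding mult_2 by (rule max.boundedI)
  define D where "D = err \<xi> x" define N where "N = mat_norm x"
  define D' where "D' = err \<xi> y" define N' where "N' = mat_norm y"
  have nn: "D \<ge> 0" "N \<ge> 0" "D' \<ge> 0" "N' \<ge> 0"
    unfolding D_def D'_def N_def N'_def by (auto simp: err_eq mat_norm_nonneg)
  have T: "T = N^2 * D' + D^2 * N'" unfolding T_def N_def D_def D'_def N'_def ..
  have DN: "D \<le> K * N" unfolding D_def N_def by (rule err_le_mat_norm)
  have K1: "K \<ge> 1" using K by simp
  have q: "N * D * D' \<le> K * (N^2 * D')"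
    using mult_right_mono[OF mult_left_mono[OF DN nn(2)] nn(3)] by (simp add: power2_eq_square ac_simps)
  have q': "D^2 * N' \<le> K * (D^2 * N')" "N^2 * D' \<le> K * (N^2 * D')" using K1 nn mult_right_mono[of 1 K] by (simp_all del: mult_le_cancel_right2)
  show "\<bar>real_of_int (w$1$1)\<bar> \<le> 3 * K * T"
  proof -
    have eq: "real_of_int (w$1$1) = real_of_int (x$1$1) * real_of_int (x$1$1) * (\<xi> * offset1 y) - real_of_int (x$1$1) * real_of_int (x$1$1) * offset2 y - 2 * (x$1$1 * offset1 x * offset1 y) + offset1 x * offset1 x * y$1$1"
      unfolding w_def by (simp add: mult_nth2 s e(1) f(1) f(2) algebra_simps)
    have "\<bar>real_of_int (x$1$1) * real_of_int (x$1$1) * (\<xi> * offset1 y)\<bar> \<le> N * N * (\<bar>\<xi>\<bar> * D')" "\<bar>real_of_int (x$1$1) * real_of_int (x$1$1) * offset2 y\<bar> \<le> N * N * D'"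
      "\<bar>x$1$1 * offset1 x * offset1 y\<bar> \<le> N * D * D'" "\<bar>offset1 x * offset1 x * y$1$1\<bar> \<le> D * D * N'"
      unfolding D_def D'_def N_def N'_def by (intro abs_mult_le abs_nth_le_mat_norm e f abs_ge_self order_refl)+
    then have "\<bar>real_of_int (w$1$1)\<bar> \<le> N * N * (\<bar>\<xi>\<bar> * D') + N * N * D' + 2 * (N * D * D') + D * D * N'"
      unfolding eq by linarith
    also have "\<dots> = K * (N^2 * D') + 2 * (N * D * D') + D^2 * N'"
      unfolding K by (simp add: algebra_simps power2_eq_square)
    also have "\<dots> \<le> 3 * (K * (N^2 * D')) + 3 * (K * (D^2 * N'))" using q q' mult_nonneg_nonneg[OF zero_le_power[OF nn(1), of 2] nn(4)] by linarith
    also have "\<dots> = 3 * K * T" unfolding T by (simp add: algebra_simps)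
    finally show ?thesis .
  qed
qed

end

section \<open>Minimal points\<close>

lemma golden: "golden * golden = golden + 1" "1.6 < golden" "golden < 1.7" "1 / golden = golden - 1"
proof -
  have s: "sqrt 5 * sqrt 5 = 5" by simp
  show 1: "golden * golden = golden + 1" using s by (simp add: golden_def algebra_simps)
  have "2.2 < sqrt 5" by (rule real_less_rsqrt) (simp add: power2_eq_square)
  moreover have "sqrt 5 < 2.4" by (rule real_less_lsqrt) (simp_all add: power2_eq_square)
  ultimately show 2: "1.6 < golden" "golden < 1.7" by (simp_all add: golden_def)
  show "1 / golden = golden - 1" using 1 2 by (simp add: field_simps)
qed

abbreviation lnorm :: "int^2^2 \<Rightarrow> real" where
  "lnorm x \<equiv> ln (mat_norm x)"

definition approximates :: "real \<Rightarrow> real \<Rightarrow> real \<Rightarrow> int^2^2 \<Rightarrow> bool" where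
  "approximates \<xi> b e x \<longleftrightarrow> symmetric x \<and> x \<noteq> 0 \<and> mat_norm x \<le> b \<and> err \<xi> x \<le> e"

definition approximable :: "real \<Rightarrow> bool" where
  "approximable \<xi> \<longleftrightarrow> (\<exists>c>0. \<forall>X\<ge>1. \<exists>x. approximates \<xi> X (c * X powr (- 1 / golden)) x)"

text \<open>A constant factor in the bound on the norm can be moved into the bound on the error by
  applying the hypothesis at X / k'.\<close>

lemma approximableI:
  assumes "c > 0" and *: "\<And>X. X \<ge> 1 \<Longrightarrow> \<exists>x. approximates \<xi> (k * X) (c * X powr (- 1 / golden)) x"
  shows "approximable \<xi>"
proof -
  define k' where "k' = max k 1"
  \<comment> \<open>The power of \<open>k'\<close> pays for the rescaling; the summand
    \<open>1 + \<bar>\<xi>\<bar>\<close> covers the fixed matrix that serves when X is less than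
    \<open>k'\<close>.\<close>
  define c' where "c' = (c + 1 + \<bar>\<xi>\<bar>) * k' powr (1 / golden)"
  have g: "golden > 0" using golden by simp
  have k': "k' \<ge> 1" "k' \<ge> k" by (auto simp: k'_def)
  have c': "c' > 0" using assms(1) k' by (simp add: c'_def)
  have "\<exists>x. approximates \<xi> X (c' * X powr (- 1 / golden)) x"
    if X: "X \<ge> 1" for X
  proof (cases "X \<ge> k'")
    case True
    then have "X / k' \<ge> 1" using k' by simp
    then obtain x where x: "symmetric x" "x \<noteq> 0" "mat_norm x \<le> k * (X / k')"
      "err \<xi> x \<le> c * (X / k') powr (- 1 / golden)"
      using * unfolding approximates_def by blast
    have "k * (X / k') \<le> k' * (X / k')" using k' X by (intro mult_right_mono) auto
    also have "\<dots> = X" using k' by simp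
    finally have 1: "mat_norm x \<le> X" using x(3) by simp
    have "c * (X / k') powr (- 1 / golden) = c * k' powr (1 / golden) * X powr (- 1 / golden)"
      using k' X by (simp add: powr_divide powr_minus_divide)
    also have "\<dots> \<le> c' * X powr (- 1 / golden)"
      unfolding c'_def using k' by (intro mult_right_mono) auto
    finally have "err \<xi> x \<le> c' * X powr (- 1 / golden)" using x(4) by linarith
    then show ?thesis using x 1 unfolding approximates_def by blast
  next
    case False
    let ?x = "mat2 1 0 0 0 :: int^2^2"
    have 1: "symmetric ?x" "?x \<noteq> 0" "mat_norm ?x = 1" "err \<xi> ?x = \<bar>\<xi>\<bar>"
      by (simp_all add: mat_eq_iff2 mat_norm_eq err_eq)
    have "1 \<le> (k' / X) powr (1 / golden)"
      using False X g by (intro ge_one_powr_ge_zero) auto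
    also have "\<dots> = k' powr (1 / golden) * X powr (- 1 / golden)"
      using k' X by (simp add: powr_divide powr_minus_divide)
    finally have 2: "1 \<le> k' powr (1 / golden) * X powr (- 1 / golden)" .
    have "\<bar>\<xi>\<bar> * 1 \<le> (c + 1 + \<bar>\<xi>\<bar>) * (k' powr (1 / golden) * X powr (- 1 / golden))"
      using assms(1) 2 by (intro mult_mono) auto
    then show ?thesis using 1 X unfolding c'_def approximates_def by (intro exI[of _ ?x]) (simp add: mult.assoc)
  qed
  then show ?thesis unfolding approximable_def using c' by blast
qed

lemma second_error:
  fixes x0 x1 x2 e \<xi> :: real
  assumes "\<bar>x0 * \<xi> - x1\<bar> \<le> e"
  shows "\<bar>x0 * \<xi>^2 - x2\<bar> \<le> \<bar>\<xi> * x1 - x2\<bar> + \<bar>\<xi>\<bar> * e" "\<bar>\<xi> * x1 - x2\<bar> \<le> \<bar>x0 * \<xi>^2 - x2\<bar> + \<bar>\<xi>\<bar> * e"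
proof -
  have "\<bar>\<xi> * (x0 * \<xi> - x1)\<bar> \<le> \<bar>\<xi>\<bar> * e" unfolding abs_mult using assms by (intro mult_left_mono) auto
  moreover have "x0 * \<xi>^2 - x2 = (\<xi> * x1 - x2) + \<xi> * (x0 * \<xi> - x1)" by (simp add: algebra_simps power2_eq_square)
  ultimately show "\<bar>x0 * \<xi>^2 - x2\<bar> \<le> \<bar>\<xi> * x1 - x2\<bar> + \<bar>\<xi>\<bar> * e" "\<bar>\<xi> * x1 - x2\<bar> \<le> \<bar>x0 * \<xi>^2 - x2\<bar> + \<bar>\<xi>\<bar> * e"
    by linarith+
qed

text \<open>The definition bounds only the coordinate x0 and measures the second error as x0 \<xi>^2
  - x2 instead of \<xi> x1 - x2; either change costs a constant factor.\<close>

lemma extremal_iff: "extremal \<xi> \<longleftrightarrow> \<xi> \<notin> \<rat> \<and> \<not> quadratic_number \<xi> \<and> approximable \<xi>"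
proof -
  define S where "S e X = (\<exists>x0 x1 x2 :: int. (x0, x1, x2) \<noteq> (0, 0, 0) \<and> \<bar>real_of_int x0\<bar> \<le> X \<and>
      \<bar>real_of_int x0 * \<xi> - real_of_int x1\<bar> \<le> e \<and> \<bar>real_of_int x0 * \<xi>^2 - real_of_int x2\<bar> \<le> e)" for e X :: real
  define r where "r c X = c * X powr (- 1 / golden)" for c X :: real
  have r: "c > 0 \<Longrightarrow> r c X \<ge> 0" "r ((1 + \<bar>\<xi>\<bar>) * c) X = r c X + \<bar>\<xi>\<bar> * r c X" for c X
    by (simp_all add: r_def algebra_simps)
  have def: "extremal \<xi> \<longleftrightarrow> \<xi> \<notin> \<rat> \<and> \<not> quadratic_number \<xi> \<and> (\<exists>c>0. \<forall>X\<ge>1. S (r c X) X)"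
    unfolding extremal_def S_def r_def ..
  have pos: "c > 0 \<Longrightarrow> (1 + \<bar>\<xi>\<bar>) * c > 0" for c by (intro mult_pos_pos) auto
  have ap: "approximable \<xi>" if c: "c > 0" and *: "\<And>X. X \<ge> 1 \<Longrightarrow> S (r c X) X" for c
  \<comment> \<open>Norm factor: x1 and x2 are X |\<xi>| and X \<xi>^2 at most, up to an error not
    exceeding c, hence not exceeding c X.\<close>
  proof (rule approximableI[of "(1 + \<bar>\<xi>\<bar>) * c" _ "1 + \<bar>\<xi>\<bar> + \<xi>^2 + c", folded r_def])
    fix X :: real assume X: "X \<ge> 1"
    define e where "e = r c X"
    obtain x0 x1 x2 :: int where x: "(x0, x1, x2) \<noteq> (0, 0, 0)" "\<bar>real_of_int x0\<bar> \<le> X"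
      "\<bar>x0 * \<xi> - x1\<bar> \<le> e" "\<bar>x0 * \<xi>^2 - x2\<bar> \<le> e"
      using *[OF X] unfolding S_def e_def by blast
    let ?x = "mat2 x0 x1 x1 x2"
    have "X powr (- 1 / golden) \<le> X powr 0" using X golden by (intro powr_mono) auto
    then have "e \<le> c * 1" unfolding e_def r_def using c X by (intro mult_left_mono) auto
    then have e1: "e \<le> c * X" using mult_left_mono[OF X, of c] c by linarith
    have "\<bar>x0 * \<xi>\<bar> \<le> X * \<bar>\<xi>\<bar>" "\<bar>x0 * \<xi>^2\<bar> \<le> X * \<xi>^2"
      using x(2) by (auto simp: abs_mult intro: mult_right_mono)
    then have b: "\<bar>real_of_int x1\<bar> \<le> X * \<bar>\<xi>\<bar> + c * X" "\<bar>real_of_int x2\<bar> \<le> X * \<xi>^2 + c * X"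
      using x(3,4) e1 by linarith+
    have "X * \<xi>^2 \<ge> 0" "X * \<bar>\<xi>\<bar> \<ge> 0" "c * X \<ge> 0"
      "(1 + \<bar>\<xi>\<bar> + \<xi>^2 + c) * X = X + X * \<bar>\<xi>\<bar> + X * \<xi>^2 + c * X"
      using X c by (auto simp: algebra_simps)
    then have "\<bar>real_of_int x0\<bar> \<le> (1 + \<bar>\<xi>\<bar> + \<xi>^2 + c) * X" "\<bar>real_of_int x1\<bar> \<le> (1 + \<bar>\<xi>\<bar> + \<xi>^2 + c) * X"
      "\<bar>real_of_int x2\<bar> \<le> (1 + \<bar>\<xi>\<bar> + \<xi>^2 + c) * X" using b x(2) X by linarith+
    then have "mat_norm ?x \<le> (1 + \<bar>\<xi>\<bar> + \<xi>^2 + c) * X"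
      unfolding mat_norm_eq by (simp add: of_int_max)
    moreover have "\<bar>\<xi>\<bar> * e \<ge> 0" using r(1)[OF c] unfolding e_def by simp
    then have "err \<xi> ?x \<le> r ((1 + \<bar>\<xi>\<bar>) * c) X"
      using second_error(2)[OF x(3), of x2] x(3,4) 
      unfolding err_eq r(2) e_def[symmetric] mat2_nth max.bounded_iff mult.commute[of \<xi> "real_of_int x0"] by linarith
    ultimately show "\<exists>x. approximates \<xi> ((1 + \<bar>\<xi>\<bar> + \<xi>^2 + c) * X) (r ((1 + \<bar>\<xi>\<bar>) * c) X) x"
      using x(1) unfolding approximates_def by (intro exI[of _ ?x]) (auto simp: symmetric_iff mat_eq_iff2)
  qed (rule pos[OF c])
  have step: "S (r ((1 + \<bar>\<xi>\<bar>) * c) X) X" if c: "c > 0" and x: "approximates \<xi> X (r c X) x" for c X x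
  proof -
    have x: "x \<noteq> 0" "mat_norm x \<le> X" "x$2$1 = x$1$2" "err \<xi> x \<le> r c X"
      using x symmetric_nth[of x] unfolding approximates_def by auto
    have e: "\<bar>x$1$1 * \<xi> - x$1$2\<bar> \<le> r c X" "\<bar>\<xi> * x$1$2 - x$2$2\<bar> \<le> r c X"
      using x(4) unfolding err_eq x(3) by (auto simp: mult.commute)
    have "\<bar>\<xi>\<bar> * r c X \<ge> 0" using r(1)[OF c] by simp
    then have "\<bar>x$1$1 * \<xi> - x$1$2\<bar> \<le> r ((1 + \<bar>\<xi>\<bar>) * c) X" "\<bar>x$1$1 * \<xi>^2 - x$2$2\<bar> \<le> r ((1 + \<bar>\<xi>\<bar>) * c) X"
      using e second_error(1)[OF e(1), of "x$2$2"] unfolding r(2) by linarith+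
    moreover have "(x$1$1, x$1$2, x$2$2) \<noteq> (0,0,0)" using x(1,3) unfolding mat_eq_iff2 by auto
    moreover have "\<bar>real_of_int (x$1$1)\<bar> \<le> X" using abs_nth_le_mat_norm[of x 1 1] x(2) by linarith
    ultimately show ?thesis unfolding S_def by blast
  qed
  have "\<exists>c>0. \<forall>X\<ge>1. S (r c X) X" if ap: "approximable \<xi>"
  proof -
    obtain c where c: "c > 0" "\<And>X. X \<ge> 1 \<Longrightarrow> \<exists>x. approximates \<xi> X (r c X) x"
      using ap unfolding approximable_def r_def by blast
    have "\<forall>X\<ge>1. S (r ((1 + \<bar>\<xi>\<bar>) * c) X) X" using c(2) step[OF c(1)] by blast
    then show ?thesis using pos[OF c(1)] by blast
  qed
  then show ?thesis unfolding def using ap by blast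
qed

lemma linear_irrational_nonzero:
  fixes p q :: int and x :: real
  assumes "x \<notin> \<rat>" "real_of_int p * x + real_of_int q = 0"
  shows "p = 0 \<and> q = 0"
proof -
  have "p = 0"
  proof (rule ccontr)
    assume "p \<noteq> 0"
    then have "x = real_of_int (- q) / real_of_int p" using assms(2) by (simp add: field_simps)
    then show False using assms(1) by (metis Rats_divide Rats_of_int)
  qed
  then show ?thesis using assms(2) by simp
qed

lemma no_quadratic_relation:
  fixes a b c :: int and \<xi> :: real
  assumes "\<xi> \<notin> \<rat>" "\<not> quadratic_number \<xi>" "a + b * \<xi> + c * \<xi>^2 = 0"
  shows "a = 0 \<and> b = 0 \<and> c = 0"
proof -
  have c: "c = 0"
  proof (rule ccontr)
    assume "c \<noteq> 0"
    then have "real_of_int c \<noteq> 0 \<and> real_of_int c * \<xi>^2 + real_of_int b * \<xi> + real_of_int a = 0"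
      using assms(3) by simp
    then show False using assms(1,2) unfolding quadratic_number_def by (meson Rats_of_int)
  qed
  then show ?thesis using linear_irrational_nonzero[OF assms(1), of b a] assms(3) by simp
qed

definition minimal_point :: "real \<Rightarrow> int^2^2 \<Rightarrow> bool" where
  "minimal_point \<xi> y \<longleftrightarrow> symmetric y \<and> y \<noteq> 0 \<and>
     (\<forall>z. symmetric z \<and> z \<noteq> 0 \<and> mat_norm z \<le> mat_norm y \<longrightarrow> err \<xi> y \<le> err \<xi> z)"

lemma finite_has_minimum:
  fixes f :: "'a \<Rightarrow> real"
  assumes "finite S" "S \<noteq> {}"
  shows "\<exists>y\<in>S. \<forall>z\<in>S. f y \<le> f z"
  using arg_min_if_finite(1)[OF assms, of f] arg_min_least[OF assms, of _ f] by blast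

text \<open>The norm is minimised first, the error only among the points of that norm; finitely many
  integer matrices lie below a given norm, so both minima exist.\<close>

lemma minimal_point_below:
  assumes "approximable \<xi>" "e > 0"
  obtains y where "minimal_point \<xi> y" "err \<xi> y < e"
    "\<And>z. symmetric z \<Longrightarrow> z \<noteq> 0 \<Longrightarrow> err \<xi> z < e \<Longrightarrow> mat_norm y \<le> mat_norm z"
proof -
  obtain c where c: "c > 0" and *: "\<And>X. X \<ge> 1 \<Longrightarrow> \<exists>x. approximates \<xi> X (c * X powr (- 1 / golden)) x" using assms(1) unfolding approximable_def by blast
  have g: "- 1 / golden < 0" using golden by simp
  have "((\<lambda>X. c * X powr (- 1 / golden)) \<longlongrightarrow> c * 0) at_top"
    by (intro tendsto_mult tendsto_const tendsto_neg_powr[OF g] filterlim_ident)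
  then have "\<forall>\<^sub>F X in at_top. c * X powr (- 1 / golden) < e"
    using assms(2) by (auto dest!: order_tendstoD(2))
  then have "\<forall>\<^sub>F X in at_top. X \<ge> 1 \<and> c * X powr (- 1 / golden) < e"
    using eventually_ge_at_top eventually_conj by blast
  then obtain X where X: "X \<ge> 1" "c * X powr (- 1 / golden) < e"
    using eventually_happens'[OF trivial_limit_at_top_linorder] by blast
  obtain z0 where z0: "symmetric z0" "z0 \<noteq> 0" "err \<xi> z0 < e"
    using *[OF X(1)] X(2) order_le_less_trans unfolding approximates_def by blast
  define S where "S = {z. symmetric z \<and> z \<noteq> 0 \<and> err \<xi> z < e \<and> mat_norm z \<le> mat_norm z0}"
  have S: "finite S" "z0 \<in> S"
    unfolding S_def using z0 by (auto intro: finite_subset[OF _ finite_mat_norm_le[of "mat_norm z0"]])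
  obtain y0 where y0: "y0 \<in> S" "\<And>z. z \<in> S \<Longrightarrow> mat_norm y0 \<le> mat_norm z"
    using finite_has_minimum[of S mat_norm] S by blast
  define S' where "S' = {z \<in> S. mat_norm z = mat_norm y0}"
  have S': "finite S'" "y0 \<in> S'" using S y0 by (auto simp: S'_def)
  obtain y where y: "y \<in> S'" "\<And>z. z \<in> S' \<Longrightarrow> err \<xi> y \<le> err \<xi> z"
    using finite_has_minimum[of S' "err \<xi>"] S' by blast
  have yS: "symmetric y" "y \<noteq> 0" "err \<xi> y < e" "mat_norm y \<le> mat_norm z0"
    "mat_norm y = mat_norm y0" using y(1) by (auto simp: S'_def S_def)
  have least: "mat_norm y \<le> mat_norm z" if "symmetric z" "z \<noteq> 0" "err \<xi> z < e" for z
  proof (rule ccontr)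
    assume n: "\<not> mat_norm y \<le> mat_norm z"
    then have "z \<in> S" using that yS by (simp add: S_def)
    then show False using y0(2) yS(5) n by simp
  qed
  have "err \<xi> y \<le> err \<xi> z"
    if z: "symmetric z" "z \<noteq> 0" "mat_norm z \<le> mat_norm y" for z
  proof (rule ccontr)
    assume n: "\<not> err \<xi> y \<le> err \<xi> z"
    then have "err \<xi> z < e" using yS by simp
    then have "z \<in> S'" using least z yS n by (force simp: S'_def S_def)
    then show False using y(2) n by blast
  qed
  then show ?thesis using that[of y] yS least by (auto simp: minimal_point_def)
qed

text \<open>Dividing by the content would lower norm and error at the same time.\<close>

lemma minimal_point_content:
  assumes "\<xi> \<notin> \<rat>" "minimal_point \<xi> y" shows "content y = 1"
proof -
  define c where "c = content y"
  have y: "symmetric y" "y \<noteq> 0" using assms(2) by (auto simp: minimal_point_def)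
  have "c \<noteq> 0" using content_dvd[of y] y(2) unfolding c_def by (auto simp: vec_eq_iff)
  then have c: "c > 0" using content_nonneg[of y] by (simp add: c_def)
  define z where "z = map_matrix (\<lambda>t. t div c) y"
  have yz: "y = smul c z" using content_dvd[of y] by (simp add: z_def c_def vec_eq_iff map_matrix_def)
  have e: "y$i$j = c * z$i$j" for i j using arg_cong[OF yz, of "\<lambda>y. y$i$j"] by simp
  have z: "symmetric z" unfolding symmetric_iff using symmetric_nth[OF y(1)] c unfolding e by simp
  have z': "z \<noteq> 0"
  proof
    assume "z = 0"
    then have "y = 0" unfolding vec_eq_iff[of y] e vec_eq_iff by (simp add: e)
    then show False using y(2) by simp
  qed
  have "mat_norm z \<le> mat_norm y"
  proof -
    have "1 * mat_norm z \<le> \<bar>real_of_int c\<bar> * mat_norm z"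
      by (rule mult_right_mono) (use c mat_norm_nonneg in auto)
    then show ?thesis unfolding arg_cong[OF yz, of mat_norm] mat_norm_smul by simp
  qed
  then have "err \<xi> y \<le> err \<xi> z" using assms(2) z z' by (auto simp: minimal_point_def)
  then have "real_of_int c * err \<xi> z \<le> 1 * err \<xi> z"
    unfolding arg_cong[OF yz, of "err \<xi>"] err_smul using c by simp
  then have "real_of_int c \<le> 1" using err_pos[OF assms(1) z'] by (simp del: mult_1_left)
  then show ?thesis using c by (simp add: c_def)
qed

lemma minimal_sequence:
  assumes "\<xi> \<notin> \<rat>" "approximable \<xi>"
  obtains m where "\<And>i. minimal_point \<xi> (m i)" "\<And>i. err \<xi> (m i) < 1"
    "\<And>i. err \<xi> (m (Suc i)) < err \<xi> (m i)"
    "\<And>i. mat_norm (m i) < mat_norm (m (Suc i))"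
    "\<And>i z. symmetric z \<Longrightarrow> z \<noteq> 0 \<Longrightarrow> mat_norm z < mat_norm (m (Suc i)) \<Longrightarrow> err \<xi> (m i) \<le> err \<xi> z"
proof -
  define P where "P y \<longleftrightarrow> minimal_point \<xi> y \<and> err \<xi> y < 1" for y
  \<comment> \<open>The successor is a point of least norm whose error beats that of
    \<open>x\<close>, so that nothing of smaller norm does.\<close>
  define Q where "Q x y \<longleftrightarrow> err \<xi> y < err \<xi> x \<and>
     (\<forall>z. symmetric z \<and> z \<noteq> 0 \<and> err \<xi> z < err \<xi> x \<longrightarrow> mat_norm y \<le> mat_norm z)" for x y
  have "\<exists>m. \<forall>i. P (m i) \<and> Q (m i) (m (Suc i))"
  proof (rule dependent_nat_choice)
    show "\<exists>x. P x" unfolding P_def by (rule minimal_point_below[OF assms(2), of 1]) auto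
    fix x assume x: "P x"
    have "x \<noteq> 0" using x by (simp add: P_def minimal_point_def)
    then have "err \<xi> x > 0" using err_pos assms(1) by blast
    then obtain y where y: "minimal_point \<xi> y" "err \<xi> y < err \<xi> x"
      "\<And>z. symmetric z \<Longrightarrow> z \<noteq> 0 \<Longrightarrow> err \<xi> z < err \<xi> x \<Longrightarrow> mat_norm y \<le> mat_norm z"
      using minimal_point_below[OF assms(2)] by blast
    then have "P y \<and> Q x y" using x unfolding P_def Q_def by auto
    then show "\<exists>y. P y \<and> Q x y" by blast
  qed
  then obtain m where m: "\<And>i. P (m i)" "\<And>i. Q (m i) (m (Suc i))" by blast
  show ?thesis
  proof (rule that[of m])
    show "minimal_point \<xi> (m i)" "err \<xi> (m i) < 1" for i using m(1) P_def by blast+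
    show d: "err \<xi> (m (Suc i)) < err \<xi> (m i)" for i using m(2) Q_def by blast
    show "mat_norm (m i) < mat_norm (m (Suc i))" for i
    proof (rule ccontr)
      assume "\<not> mat_norm (m i) < mat_norm (m (Suc i))"
      then have "err \<xi> (m i) \<le> err \<xi> (m (Suc i))"
        using m(1)[of i] m(1)[of "Suc i"] unfolding P_def minimal_point_def not_less by blast
      then show False using d[of i] by simp
    qed
    show "err \<xi> (m i) \<le> err \<xi> z"
      if "symmetric z" "z \<noteq> 0" "mat_norm z < mat_norm (m (Suc i))" for i z
      using m(2)[of i] that unfolding Q_def not_less[symmetric] by blast
  qed
qed

text \<open>Interface between the analysis of minimal points and the algebra of the recurrence; the
  asymptotics with exponents \<gamma> and -1 are stated for logarithms, with one constant
  \<open>C\<close> for both.\<close>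

locale principal_sequence =
  fixes \<xi> :: real and y :: "nat \<Rightarrow> int^2^2" and C :: real
  assumes irrational: "\<xi> \<notin> \<rat>"
    and sym: "symmetric (y k)"
    and prim: "y k \<in> prim_matrices"
    and independent: "det3 (y k) (y (Suc k)) (y (Suc (Suc k))) \<noteq> 0"
    and growth: "\<bar>lnorm (y (Suc k)) - golden * lnorm (y k)\<bar> \<le> C"
    and error: "\<bar>lnorm (y k) + ln (err \<xi> (y k))\<bar> \<le> C"
    and unbounded: "filterlim (\<lambda>k. lnorm (y k)) at_top sequentially"

text \<open>\<open>err_bound\<close> is the extremal condition used just below the norm of the next
  point, where no error smaller than that of \<open>m i\<close> is available; its exponent is
  1/\<gamma> = \<gamma> - 1.\<close>

locale minimal_points =
  fixes \<xi> :: real and m :: "nat \<Rightarrow> int^2^2" and c K :: real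
  assumes irr: "\<xi> \<notin> \<rat>"
    and nonquadratic: "\<And>p q r. real_of_int p + real_of_int q * \<xi> + real_of_int r * \<xi>^2 = 0 \<Longrightarrow> p = 0 \<and> q = 0 \<and> r = 0"
    and msym: "symmetric (m i)" and mnz: "m i \<noteq> 0" and mcontent: "content (m i) = 1"
    and norm_incr: "mat_norm (m i) < mat_norm (m (Suc i))"
    and err_decr: "err \<xi> (m (Suc i)) < err \<xi> (m i)"
    and err_lt1: "err \<xi> (m i) < 1"
    and err_bound: "ln (err \<xi> (m i)) \<le> c - (golden - 1) * lnorm (m (Suc i))"
    and K: "K = 1 + \<bar>\<xi>\<bar>"
begin

definition "N i = mat_norm (m i)"
definition "D i = err \<xi> (m i)"
definition "n i = ln (N i)"
definition "d i = ln (D i)"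

lemma N_ge1: "N i \<ge> 1" unfolding N_def by (rule mat_norm_ge1[OF mnz])

lemma D_pos: "D i > 0" unfolding D_def by (rule err_pos[OF irr mnz])

lemma N_pos: "N i > 0" using N_ge1[of i] by linarith

lemma N_less: "i < j \<Longrightarrow> N i < N j"
  unfolding N_def by (rule lift_Suc_mono_less[of "\<lambda>i. mat_norm (m i)", OF norm_incr])

lemma D_less: "i < j \<Longrightarrow> D j < D i"
  using lift_Suc_mono_less[of "\<lambda>i. - err \<xi> (m i)" i j] err_decr unfolding D_def by simp

lemma n_nonneg: "n i \<ge> 0" unfolding n_def using N_ge1 by simp

lemma n_less: "i < j \<Longrightarrow> n i < n j"
  unfolding n_def using N_less N_pos by simp

lemma n_mono: "i \<le> j \<Longrightarrow> n i \<le> n j"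
  using n_less[of i j] by (cases "i = j") auto

lemma d_le: "d i \<le> c - (golden - 1) * n (Suc i)"
  using err_bound unfolding d_def n_def D_def N_def .

lemma N_ge: "N i \<ge> real i + 1"
proof (induction i)
  case 0
  show ?case using N_ge1[of 0] by simp
next
  case (Suc i)
  obtain p q :: int where pq: "N i = real_of_int p" "N (Suc i) = real_of_int q"
    unfolding N_def mat_norm_eq by blast
  then have "p < q" using N_less[of i "Suc i"] by simp
  then have "N i + 1 \<le> N (Suc i)" unfolding pq by linarith
  then show ?case using Suc by simp
qed

lemma n_at_top: "filterlim n at_top sequentially"
proof -
  have "filterlim N at_top sequentially"
    by (rule filterlim_at_top_mono[OF filterlim_real_sequentially])
       (use N_ge in \<open>auto intro!: always_eventually order_trans[OF _ N_ge]\<close>)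
  then show ?thesis unfolding n_def by (rule filterlim_compose[OF ln_at_top])
qed

text \<open>Along a line norm and error scale by the same factor, whereas here the one grows and the
  other shrinks.\<close>

lemma not_proportional:
  assumes "i < j" shows "\<not> m i \<simeq> m j"
proof
  assume "m i \<simeq> m j"
  then obtain s t where st: "s \<noteq> 0" "t \<noteq> 0" "smul s (m i) = smul t (m j)"
    unfolding proportional_def by blast
  have 1: "\<bar>real_of_int s\<bar> * N i = \<bar>real_of_int t\<bar> * N j"
    unfolding N_def using arg_cong[OF st(3), of mat_norm] by (simp add: mat_norm_smul)
  have 2: "\<bar>real_of_int s\<bar> * D i = \<bar>real_of_int t\<bar> * D j"
    unfolding D_def using arg_cong[OF st(3), of "err \<xi>"] by (simp add: err_smul)
  have t: "\<bar>real_of_int t\<bar> > 0" using st by simp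
  have "\<bar>real_of_int t\<bar> * N i < \<bar>real_of_int t\<bar> * N j" using N_less[OF assms] t by simp
  then have "\<bar>real_of_int t\<bar> < \<bar>real_of_int s\<bar>" using 1 N_pos[of i] by (metis mult_less_cancel_right_pos)
  then have "\<bar>real_of_int t\<bar> * D i < \<bar>real_of_int s\<bar> * D i" using D_pos by simp
  moreover have "\<bar>real_of_int t\<bar> * D j < \<bar>real_of_int t\<bar> * D i" using D_less[OF assms] t by simp
  ultimately show False using 2 by linarith
qed

lemma not_proportional': "i \<noteq> j \<Longrightarrow> \<not> m i \<simeq> m j"
  using not_proportional prop_sym by (metis linorder_neqE_nat)

lemma mixed_le: "i < j \<Longrightarrow> mixed \<xi> (m j) (m i) \<le> 2 * N j * D i"
proof -
  assume ij: "i < j"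
  have "N i * D j \<le> N j * D i"
    using N_less[OF ij] D_less[OF ij] N_pos[of i] D_pos[of j] by (intro mult_mono) auto
  then show ?thesis unfolding mixed_def[OF K] N_def D_def by simp
qed

text \<open>If x has determinant zero, then p^2 is x11 times an integer for each of the two minors p below,
  which is impossible for 0 < |p| with p small compared with the square root of |x11|.\<close>

lemma degenerate_imp_large_error:
  assumes x: "symmetric x" "x \<noteq> 0" and z: "symmetric z" "z \<noteq> 0"
    and det: "det x = 0" and corner: "x$1$1 \<noteq> 0" and "\<not> x \<simeq> z"
  shows "\<bar>real_of_int (x$1$1)\<bar> \<le> (mixed \<xi> x z)^2"
proof -
  have d: "x$1$1 * x$2$2 = x$1$2 * x$1$2" using det symmetric_nth[OF x(1)] by (simp add: det_2)
  define p where "p = x$1$1 * z$1$2 - x$1$2 * z$1$1"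
  define q where "q = x$1$1 * z$2$2 - x$1$2 * z$1$2"
  define u where "u = x$2$2 * z$1$1^2 - 2 * x$1$2 * z$1$1 * z$1$2 + x$1$1 * z$1$2^2"
  define v where "v = x$2$2 * z$1$2^2 - 2 * x$1$2 * z$1$2 * z$2$2 + x$1$1 * z$2$2^2"
  have sq: "p^2 = x$1$1 * u" "q^2 = x$1$1 * v"
    unfolding p_def q_def u_def v_def using d by algebra+
  have b: "\<bar>real_of_int p\<bar> \<le> mixed \<xi> x z" "\<bar>real_of_int q\<bar> \<le> mixed \<xi> x z"
    unfolding p_def q_def using abs_minor_le(1,3)[OF K x(1) z(1)] by auto
  have key: "\<bar>real_of_int (x$1$1)\<bar> \<le> (mixed \<xi> x z)^2"
    if "r^2 = x$1$1 * w" "r \<noteq> 0" "\<bar>real_of_int r\<bar> \<le> mixed \<xi> x z" for r w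
  proof -
    have "w \<noteq> 0" using that(1,2) by auto
    then have "\<bar>x$1$1\<bar> * 1 \<le> \<bar>x$1$1\<bar> * \<bar>w\<bar>" by (intro mult_left_mono) auto
    also have "\<dots> = r^2" using that(1) by (metis abs_mult abs_power2)
    finally have "\<bar>real_of_int (x$1$1)\<bar> \<le> (real_of_int r)^2"
      by (metis mult_1_right of_int_abs of_int_le_iff of_int_power)
    also have "\<dots> \<le> (mixed \<xi> x z)^2" using power_mono[OF that(3), of 2] by simp
    finally show ?thesis .
  qed
  show ?thesis
  proof (cases "p = 0 \<and> q = 0")
    case True
    have e: "x$1$1 * z$1$2 = x$1$2 * z$1$1" "x$1$1 * z$2$2 = x$1$2 * z$1$2" using True by (auto simp: p_def q_def)
    have "x$1$1 * (x$2$2 * z$1$1) = x$1$1 * (x$1$1 * z$2$2)" "x$1$1 * (x$1$2 * z$2$2) = x$1$1 * (x$2$2 * z$1$2)"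
      using e d by algebra+
    then have "cross x z = 0" using e corner by (simp add: cross_def mat_eq_iff2)
    then show ?thesis using cross_eq_0_imp[OF x(1) z(1) x(2) z(2)] assms(7) by blast
  next
    case False
    then show ?thesis using key[OF sq(1) _ b(1)] key[OF sq(2) _ b(2)] by blast
  qed
qed

lemma K_ge1: "K \<ge> 1" using K by simp

lemma corner: "m i $ 1 $ 1 \<noteq> 0" "N i \<le> 2 * K^2 * \<bar>m i $ 1 $ 1\<bar>"
  using mat_norm_le_corner[OF K msym err_lt1 mnz] unfolding N_def by auto

lemma eventually_n_ge: "\<exists>i0. \<forall>i\<ge>i0. n i \<ge> B"
  using n_at_top unfolding filterlim_at_top eventually_sequentially by blast

lemma ln_le_of_prod:
  assumes "1 \<le> a * N i * D j" "a > 0" shows "0 \<le> ln a + n i + d j"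
proof -
  have "0 \<le> ln (a * N i * D j)" using assms by simp
  also have "\<dots> = ln a + n i + d j" unfolding n_def d_def using assms(2) N_pos[of i] D_pos[of j]
    by (simp add: ln_mult)
  finally show ?thesis .
qed

text \<open>A zero determinant would bound N(i) by a constant times (N(i) D(i-1))^2, hence by a
  constant times N(i) to the power 2 (2 - \<gamma>) < 1, which fails for large norm.\<close>

lemma det_nonzero: "\<exists>i0. \<forall>i\<ge>i0. det (m i) \<noteq> 0"
proof -
  define B where "B = ln (8 * K^2) + 2 * c"
  \<comment> \<open>The factor 10 answers the inequality (2 \<gamma> - 3) n \<le> B reached below,
    where 2 \<gamma> - 3 exceeds 1/5.\<close>
  obtain i0 where i0: "\<And>i. i \<ge> i0 \<Longrightarrow> n i \<ge> 10 * \<bar>B\<bar> + 1" using eventually_n_ge[of "10 * \<bar>B\<bar> + 1"] by blast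
  have "det (m i) \<noteq> 0" if i: "i \<ge> Suc i0" for i
  proof
    assume det: "det (m i) = 0"
    obtain j where j: "i = Suc j" using i by (cases i) auto
    have "\<bar>real_of_int (m i $ 1 $ 1)\<bar> \<le> (mixed \<xi> (m i) (m j))^2"
      by (rule degenerate_imp_large_error[OF msym mnz msym mnz det corner(1)])
         (use not_proportional' j in auto)
    also have "\<dots> \<le> (2 * N i * D j)^2"
      using mixed_le[of j i] j abs_minor_le(1)[OF K msym msym, of i j] by (intro power_mono) auto
    finally have 1: "\<bar>real_of_int (m i $ 1 $ 1)\<bar> \<le> (2 * N i * D j)^2" .
    have "N i \<le> 2 * K^2 * \<bar>m i $ 1 $ 1\<bar>" by (rule corner)
    also have "\<dots> \<le> 2 * K^2 * (2 * N i * D j)^2" using 1 by (intro mult_left_mono) auto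
    also have "\<dots> = N i * (8 * K^2 * N i * D j * D j)" by (simp add: power2_eq_square)
    finally have "1 \<le> 8 * K^2 * N i * D j * D j" using N_pos[of i] by simp
    then have "0 \<le> ln (8 * K^2 * N i * D j * D j)" by simp
    also have "\<dots> = ln (8 * K^2) + n i + 2 * d j"
      unfolding n_def d_def using K_ge1 N_pos[of i] D_pos[of j] by (simp add: ln_mult)
    finally have "0 \<le> B + n i - 2 * ((golden - 1) * n i)" using d_le[of j] unfolding B_def j by linarith
    then have "(2 * golden - 3) * n i \<le> B" by (simp add: algebra_simps)
    moreover have "(2 * golden - 3) * n i \<ge> 0.2 * n i"
      using golden n_nonneg by (intro mult_right_mono) auto
    moreover have "n i \<ge> 10 * \<bar>B\<bar> + 1" using i0 i by simp
    ultimately show False by linarith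
  qed
  then show ?thesis by blast
qed

lemma cross_nonzero: "i \<noteq> j \<Longrightarrow> cross (m i) (m j) \<noteq> 0"
  using cross_eq_0_imp[OF msym msym mnz mnz] not_proportional' by blast

lemma orthogonal_iff:
  assumes "i \<noteq> j" "symmetric u" "u \<noteq> 0" "dot3 u (m i) = 0" "dot3 u (m j) = 0"
  shows "dot3 u z = 0 \<longleftrightarrow> det3 (m i) (m j) z = 0"
  using orthogonal_iff_det3[OF msym msym mnz mnz not_proportional'] assms by blast

text \<open>Each point beyond the first two lies in the plane of its two predecessors, so it stays
  in the plane of the initial pair.\<close>

lemma plane:
  assumes "\<And>r. a \<le> r \<Longrightarrow> Suc (Suc r) \<le> b \<Longrightarrow> det3 (m r) (m (Suc r)) (m (Suc (Suc r))) = 0"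
    and "a \<le> r" "r \<le> b"
  shows "dot3 (cross (m a) (m (Suc a))) (m r) = 0"
  using assms(2,3)
proof (induction r rule: less_induct)
  case (less r)
  let ?u = "cross (m a) (m (Suc a))"
  consider "r = a" | "r = Suc a" | s where "r = Suc (Suc s)" "a \<le> s"
    using less.prems(1) by (metis Suc_leI le_Suc_ex add_eq_if le_neq_implies_less nat_le_iff_add not_less_eq_eq le_antisym Suc_le_D)
  then show ?case
  proof cases
    case 3
    have "dot3 ?u (m s) = 0" "dot3 ?u (m (Suc s)) = 0" using less 3 by auto
    then show ?thesis
      using orthogonal_iff[of s "Suc s" ?u "m r"] assms(1)[of s] 3 less.prems cross_nonzero[of a "Suc a"] by simp
  qed simp_all
qed

text \<open>Otherwise all later points lie in one rational plane with normal u. As they approach the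
  line of (1, \<xi>, \<xi>^2) with bounded offsets and unbounded norm, the value \<open>Q\<close> at
  \<xi> of the quadratic polynomial with coefficients u must be zero.\<close>

lemma infinitely_many_independent:
  "\<exists>i\<ge>i0. det3 (m i) (m (Suc i)) (m (Suc (Suc i))) \<noteq> 0"
proof (rule ccontr)
  assume "\<not> ?thesis"
  then have 0: "det3 (m r) (m (Suc r)) (m (Suc (Suc r))) = 0" if "i0 \<le> r" for r using that by blast
  define u where "u = cross (m i0) (m (Suc i0))"
  have u: "dot3 u (m r) = 0" if "i0 \<le> r" for r
    unfolding u_def by (rule plane[of i0 r]) (use 0 that in auto)
  define Q where "Q = u$1$1 + u$1$2 * \<xi> + u$2$2 * \<xi>^2"
  define B where "B = 2 * K^2 * (\<bar>u$1$2 + u$2$2 * \<xi>\<bar> + \<bar>real_of_int (u$2$2)\<bar>)"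
  have QB: "\<bar>Q\<bar> * N r \<le> B" if r: "i0 \<le> r" for r
  proof -
    obtain e1 e2 where e: "real_of_int (m r$1$2) = \<xi> * m r$1$1 - e1" "real_of_int (m r$2$2) = \<xi> * m r$1$2 - e2"
      "\<bar>e1\<bar> \<le> err \<xi> (m r)" "\<bar>e2\<bar> \<le> err \<xi> (m r)"
      using offsets[OF K, of "m r"] msym by blast
    have "real_of_int (dot3 u (m r)) = m r$1$1 * Q - (u$1$2 + u$2$2 * \<xi>) * e1 - u$2$2 * e2"
      by (simp add: dot3_def e(1,2) Q_def algebra_simps power2_eq_square)
    then have eq: "m r$1$1 * Q = (u$1$2 + u$2$2 * \<xi>) * e1 + u$2$2 * e2" using u[OF r] by simp
    have ab: "\<bar>(u$1$2 + u$2$2 * \<xi>) * e1\<bar> \<le> \<bar>u$1$2 + u$2$2 * \<xi>\<bar> * 1" "\<bar>u$2$2 * e2\<bar> \<le> \<bar>real_of_int (u$2$2)\<bar> * 1"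
      using e(3,4) err_lt1[of r] by (intro abs_mult_le[OF K]; simp)+
    have "\<bar>real_of_int (m r$1$1)\<bar> * \<bar>Q\<bar> \<le> \<bar>u$1$2 + u$2$2 * \<xi>\<bar> + \<bar>real_of_int (u$2$2)\<bar>"
      unfolding abs_mult[symmetric] eq using order_trans[OF abs_triangle_ineq add_mono[OF ab]] by simp
    then have 2: "(2 * K^2) * (\<bar>real_of_int (m r$1$1)\<bar> * \<bar>Q\<bar>) \<le> B"
      unfolding B_def by (intro mult_left_mono) auto
    have "N r * \<bar>Q\<bar> \<le> (2 * K^2 * \<bar>m r$1$1\<bar>) * \<bar>Q\<bar>" using corner(2)[of r] by (intro mult_right_mono) auto
    then have "N r * \<bar>Q\<bar> \<le> B" using 2 by (simp add: mult.assoc)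
    then show ?thesis by (simp add: mult.commute)
  qed
  have "Q = 0"
  proof (rule ccontr)
    assume Q: "Q \<noteq> 0"
    obtain r0 where "B / \<bar>Q\<bar> < real r0" using reals_Archimedean2 by blast
    then have "B / \<bar>Q\<bar> < N (r0 + i0)" using N_ge[of "r0 + i0"] by simp
    then have "B < \<bar>Q\<bar> * N (r0 + i0)" using Q by (simp add: field_simps)
    then show False using QB[of "r0 + i0"] by simp
  qed
  then have "u = 0" using nonquadratic[of "u$1$1" "u$1$2" "u$2$2"] symmetric_nth[of u] unfolding Q_def u_def
    by (simp add: mat_eq_iff2)
  then show False using cross_nonzero[of i0 "Suc i0"] u_def by simp
qed

end

context minimal_points
begin

text \<open>A non-zero determinant gives N(i+1) D(i+1) \<ge> 1/2, and an independent triple gives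
  N(i+2) D(i) D(i+1) \<ge> 1/6. Inserting the upper bounds for D, the first bounds N(i+2) above and
  the second bounds it below by the order of N(i+1)^\<gamma>.\<close>

lemma consecutive_bounds:
  assumes "det (m (Suc i)) \<noteq> 0" "det3 (m i) (m (Suc i)) (m (Suc (Suc i))) \<noteq> 0"
  shows "n (Suc (Suc i)) \<le> golden * n (Suc i) + golden * (ln 2 + c)"
    "golden * n (Suc i) - 3 * (ln 6 + 2 * \<bar>c\<bar>) \<le> n (Suc (Suc i))"
    "0 \<le> ln 2 + n (Suc i) + d (Suc i)"
    "n (Suc i) + d (Suc i) \<le> c + 3 * (ln 6 + 2 * \<bar>c\<bar>)"
proof -
  note g = golden
  have "1 \<le> \<bar>real_of_int (det (m (Suc i)))\<bar>" using assms(1) by linarith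
  also have "\<dots> \<le> 2 * N (Suc i) * D (Suc i)"
    using abs_det_le[OF K msym, of "Suc i"] unfolding N_def D_def .
  finally show 1: "0 \<le> ln 2 + n (Suc i) + d (Suc i)" by (intro ln_le_of_prod) auto
  have N: "N i \<le> N (Suc (Suc i))" "N (Suc i) \<le> N (Suc (Suc i))" using N_less by (simp_all add: less_imp_le)
  have D: "D (Suc (Suc i)) \<le> D i" "D (Suc (Suc i)) \<le> D (Suc i)" using D_less by (simp_all add: less_imp_le)
  have p: "N i * D (Suc i) * D (Suc (Suc i)) \<le> N (Suc (Suc i)) * D (Suc i) * D i"
    "N (Suc i) * D i * D (Suc (Suc i)) \<le> N (Suc (Suc i)) * D i * D (Suc i)"
    using N D D_pos[of i] D_pos[of "Suc i"] D_pos[of "Suc (Suc i)"] N_pos[of i] N_pos[of "Suc i"] N_pos[of "Suc (Suc i)"]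
    by (intro mult_mono; simp)+
  have "1 \<le> \<bar>real_of_int (det3 (m i) (m (Suc i)) (m (Suc (Suc i))))\<bar>" using assms(2) by linarith
  also have "\<dots> \<le> 2 * (N i * D (Suc i) * D (Suc (Suc i)) + N (Suc i) * D i * D (Suc (Suc i)) + N (Suc (Suc i)) * D i * D (Suc i))"
    using abs_det3_le[OF K msym msym msym, of i "Suc i" "Suc (Suc i)"] unfolding N_def D_def .
  also have "\<dots> \<le> 6 * (N (Suc (Suc i)) * D i * D (Suc i))" using p by (simp add: ac_simps)
  finally have "0 \<le> ln (6 * (N (Suc (Suc i)) * D i * D (Suc i)))" by simp
  also have "\<dots> = ln 6 + n (Suc (Suc i)) + d i + d (Suc i)"
    unfolding n_def d_def using N_pos[of "Suc (Suc i)"] D_pos[of i] D_pos[of "Suc i"] by (simp add: ln_mult)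
  finally have 2: "0 \<le> ln 6 + n (Suc (Suc i)) + d i + d (Suc i)" .
  define A where "A = n (Suc i)" define B where "B = n (Suc (Suc i))"
  have 3: "d i \<le> c - (golden - 1) * A" "d (Suc i) \<le> c - (golden - 1) * B"
    using d_le unfolding A_def B_def by blast+
  have "(golden - 1) * B \<le> ln 2 + c + A" using 1 3 unfolding A_def by linarith
  \<comment> \<open>\<gamma> is the inverse of \<gamma> - 1.\<close>
  then have "golden * ((golden - 1) * B) \<le> golden * (ln 2 + c + A)"
    using g by (intro mult_left_mono) auto
  moreover have "golden * ((golden - 1) * B) = B" using g(1) by algebra
  ultimately show "n (Suc (Suc i)) \<le> golden * n (Suc i) + golden * (ln 2 + c)"
    unfolding A_def B_def by (simp add: algebra_simps)
  have "(golden - 1) * A \<le> (ln 6 + 2 * \<bar>c\<bar>) + (2 - golden) * B"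
    using 2 3 unfolding B_def by (simp add: algebra_simps)
  \<comment> \<open>\<gamma> + 1 is the inverse of 2 - \<gamma>, and (\<gamma> + 1)(\<gamma> - 1) =
    \<gamma>.\<close>
  then have "(golden + 1) * ((golden - 1) * A) \<le> (golden + 1) * ((ln 6 + 2 * \<bar>c\<bar>) + (2 - golden) * B)"
    using g by (intro mult_left_mono) auto
  moreover have "(golden + 1) * ((golden - 1) * A) = golden * A" using g(1) by algebra
  moreover have "(golden + 1) * ((ln 6 + 2 * \<bar>c\<bar>) + (2 - golden) * B) = (golden + 1) * (ln 6 + 2 * \<bar>c\<bar>) + B"
    using g(1) by algebra
  moreover have "(golden + 1) * (ln 6 + 2 * \<bar>c\<bar>) \<le> 3 * (ln 6 + 2 * \<bar>c\<bar>)"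
    using g by (intro mult_right_mono) auto
  ultimately have 4: "golden * A - 3 * (ln 6 + 2 * \<bar>c\<bar>) \<le> B" by linarith
  then show "golden * n (Suc i) - 3 * (ln 6 + 2 * \<bar>c\<bar>) \<le> n (Suc (Suc i))" unfolding A_def B_def .
  have "(golden - 1) * (golden * A - 3 * (ln 6 + 2 * \<bar>c\<bar>)) \<le> (golden - 1) * B"
    using 4 g by (intro mult_left_mono) auto
  moreover have "(golden - 1) * (golden * A - 3 * (ln 6 + 2 * \<bar>c\<bar>)) = A - (golden - 1) * (3 * (ln 6 + 2 * \<bar>c\<bar>))"
    using g(1) by algebra
  moreover have "(golden - 1) * (3 * (ln 6 + 2 * \<bar>c\<bar>)) \<le> 1 * (3 * (ln 6 + 2 * \<bar>c\<bar>))"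
    using g by (intro mult_right_mono) auto
  ultimately show "n (Suc i) + d (Suc i) \<le> c + 3 * (ln 6 + 2 * \<bar>c\<bar>)" using 3 unfolding A_def by linarith
qed

lemma cross_bound:
  "mat_norm (cross (m i) (m (Suc i))) \<le> 4 * N (Suc i) * D i"
proof -
  have "mixed \<xi> (m i) (m (Suc i)) = mixed \<xi> (m (Suc i)) (m i)" by (simp add: mixed_def[OF K])
  then show ?thesis
    using mat_norm_cross_le[OF K msym msym, of i "Suc i"] mixed_le[of i "Suc i"] by simp
qed

text \<open>The planes spanned by (m a, m (a+1)) and by (m b, m (b+1)) have small normal vectors and meet
  along m b, whence the cross product of these normals is a nonzero integer multiple of m b.\<close>

lemma plane_intersection_bound:
  assumes "a < b" and "\<And>r. a \<le> r \<Longrightarrow> Suc (Suc r) \<le> b \<Longrightarrow> det3 (m r) (m (Suc r)) (m (Suc (Suc r))) = 0"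
    and b: "b = Suc b'" and "det3 (m b') (m b) (m (Suc b)) \<noteq> 0"
  shows "dot3 (cross (m a) (m (Suc a))) (m (Suc b)) \<noteq> 0"
    "n b \<le> ln 32 + n (Suc a) + d a + n (Suc b) + d b"
proof -
  let ?u = "cross (m a) (m (Suc a))"
  let ?v = "cross (m b) (m (Suc b))"
  have 1: "dot3 ?u (m b) = 0" by (rule plane[of a b]) (use assms in auto)
  have 2: "dot3 ?u (m b') = 0" by (rule plane[of a b]) (use assms in auto)
  show 3: "dot3 ?u (m (Suc b)) \<noteq> 0"
    using orthogonal_iff[of b' b ?u "m (Suc b)"] 1 2 assms b cross_nonzero[of a "Suc a"] by simp
  have "1 * N b \<le> \<bar>real_of_int (dot3 ?u (m (Suc b)))\<bar> * N b"
    using 3 N_pos[of b] by (intro mult_right_mono) linarith+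
  also have "\<dots> = mat_norm (cross ?u ?v)"
    unfolding cross_cross[OF 1 msym] mat_norm_smul N_def ..
  also have "\<dots> \<le> 2 * mat_norm ?u * mat_norm ?v" by (rule mat_norm_cross_le'[OF K])
  also have "\<dots> \<le> 2 * (4 * N (Suc a) * D a) * (4 * N (Suc b) * D b)"
    using cross_bound[of a] cross_bound[of b] N_pos D_pos mat_norm_nonneg
    by (intro mult_mono) (auto simp: less_imp_le)
  finally have 4: "N b \<le> 32 * N (Suc a) * D a * N (Suc b) * D b" by (simp add: ac_simps)
  have "n b \<le> ln (32 * N (Suc a) * D a * N (Suc b) * D b)"
    unfolding n_def using 4 N_pos[of b] by (metis ln_mono)
  also have "\<dots> = ln 32 + n (Suc a) + d a + n (Suc b) + d b"
    unfolding n_def d_def using N_pos[of "Suc a"] N_pos[of "Suc b"] D_pos[of a] D_pos[of b] by (simp add: ln_mult)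
  finally show "n b \<le> ln 32 + n (Suc a) + d a + n (Suc b) + d b" .
qed

text \<open>The members of \<open>y\<close> are middle points of independent consecutive triples,
  where \<open>consecutive_bounds\<close> controls the error and the norm of the next minimal point.
  Between two of them the minimal points stay in one plane, and successive planes meet in the line
  of a member of \<open>y\<close>.\<close>

lemma principal_sequence_exists: "\<exists>y C. principal_sequence \<xi> y C"
proof -
  obtain i0 where i0: "\<And>i. i \<ge> i0 \<Longrightarrow> det (m i) \<noteq> 0" using det_nonzero by blast
  define I where "I = {i. i \<ge> i0 \<and> det3 (m i) (m (Suc i)) (m (Suc (Suc i))) \<noteq> 0}"
  have inf: "infinite I"
    unfolding infinite_nat_iff_unbounded_le I_def
  proof
    fix j
    obtain i where "i \<ge> max i0 j" "det3 (m i) (m (Suc i)) (m (Suc (Suc i))) \<noteq> 0"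
      using infinitely_many_independent by blast
    then show "\<exists>i\<ge>j. i \<in> {i. i0 \<le> i \<and> det3 (m i) (m (Suc i)) (m (Suc (Suc i))) \<noteq> 0}" by auto
  qed
  define e where "e = enumerate I"
  \<comment> \<open>Shift by one: \<open>e k\<close> begins an independent triple and
    \<open>f k\<close> is its middle.\<close>
  define f where "f k = Suc (e k)" for k
  have eI: "e k \<in> I" for k unfolding e_def by (rule enumerate_in_set[OF inf])
  have e_less: "e k < e (Suc k)" for k unfolding e_def by (rule enumerate_step[OF inf])
  have between: "det3 (m r) (m (Suc r)) (m (Suc (Suc r))) = 0" if "e k < r" "r < e (Suc k)" for k r
  proof (rule ccontr)
    assume "\<not> ?thesis"
    moreover have "i0 \<le> r" using eI[of k] that(1) by (simp add: I_def)
    ultimately have "r \<in> I" by (simp add: I_def)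
    moreover have "e (Suc k) = (LEAST s. s \<in> I \<and> e k < s)" unfolding e_def by (rule enumerate_Suc''[OF inf])
    ultimately have "e (Suc k) \<le> r" using that(1) by (simp add: Least_le)
    then show False using that(2) by simp
  qed
  have det: "det (m (Suc (e k))) \<noteq> 0" for k using eI[of k] i0[of "Suc (e k)"] by (simp add: I_def)
  have ind: "det3 (m (e k)) (m (Suc (e k))) (m (Suc (Suc (e k)))) \<noteq> 0" for k using eI[of k] by (simp add: I_def)
  note cb = consecutive_bounds[OF det ind]
  define y where "y k = m (f k)" for k
  \<comment> \<open>\<open>C1\<close> dominates every constant of \<open>consecutive_bounds\<close>;
    \<open>C\<close> adds those of the plane intersection.\<close>
  define C1 where "C1 = golden * (ln 2 + \<bar>c\<bar>) + 3 * (ln 6 + 2 * \<bar>c\<bar>) + ln 2 + \<bar>c\<bar>"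
  define C where "C = C1 + 3 * (ln 32 + 2 * \<bar>c\<bar> + 2 * C1)"
  have g: "golden > 1.6" "golden < 1.7" using golden by auto
  have lnp: "(0::real) \<le> ln 2" "(0::real) \<le> ln 6" "(0::real) \<le> ln 32" by simp_all
  have gpos: "golden * (ln 2 + \<bar>c\<bar>) \<ge> 0" using g lnp by (intro mult_nonneg_nonneg) auto
  have gc: "golden * (ln 2 + c) \<le> golden * (ln 2 + \<bar>c\<bar>)" using g by (intro mult_left_mono) auto
  have C1: "C1 \<ge> 0" unfolding C1_def using gpos lnp by (intro add_nonneg_nonneg) auto
  then have "0 \<le> ln 32 + 2 * \<bar>c\<bar> + 2 * C1" by (intro add_nonneg_nonneg) auto
  then have C1C: "C1 \<le> C" unfolding C_def by simp
  have b1: "n (Suc (f k)) \<le> golden * n (f k) + C1" "golden * n (f k) - C1 \<le> n (Suc (f k))"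
    "\<bar>n (f k) + d (f k)\<bar> \<le> C1" for k
    using cb[of k] gpos gc lnp unfolding C1_def f_def by linarith+
  have f_less: "f k < f (Suc k)" for k using e_less[of k] by (simp add: f_def)
  have pl: "det3 (m r) (m (Suc r)) (m (Suc (Suc r))) = 0" if "f k \<le> r" "Suc (Suc r) \<le> f (Suc k)" for k r
    using between[of k r] that unfolding f_def by simp
  have inter: "dot3 (cross (m (f k)) (m (Suc (f k)))) (m (Suc (f (Suc k)))) \<noteq> 0"
    "n (f (Suc k)) \<le> ln 32 + n (Suc (f k)) + d (f k) + n (Suc (f (Suc k))) + d (f (Suc k))" for k
  proof -
    have b: "f (Suc k) = Suc (e (Suc k))" by (simp add: f_def)
    have "det3 (m (e (Suc k))) (m (f (Suc k))) (m (Suc (f (Suc k)))) \<noteq> 0"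
      using ind[of "Suc k"] by (simp add: f_def)
    from plane_intersection_bound[OF f_less[of k] pl[of k] b this]
    show "dot3 (cross (m (f k)) (m (Suc (f k)))) (m (Suc (f (Suc k)))) \<noteq> 0"
      "n (f (Suc k)) \<le> ln 32 + n (Suc (f k)) + d (f k) + n (Suc (f (Suc k))) + d (f (Suc k))" by blast+
  qed
  have growth: "\<bar>n (f (Suc k)) - golden * n (f k)\<bar> \<le> C" for k
  proof -
    define A where "A = n (f k)" define B where "B = n (f (Suc k))"
    \<comment> \<open>Logarithmic height of the normal of the plane through \<open>m (f l)\<close>
      and its successor; uses (2 - \<gamma>) \<gamma> = \<gamma> - 1.\<close>
    have wedge: "n (Suc (f l)) + d (f l) \<le> \<bar>c\<bar> + C1 + (golden - 1) * n (f l)" for l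
    proof -
      have "n (Suc (f l)) + d (f l) \<le> \<bar>c\<bar> + (2 - golden) * n (Suc (f l))"
        using d_le[of "f l"] by (simp add: algebra_simps)
      also have "(2 - golden) * n (Suc (f l)) \<le> (2 - golden) * (golden * n (f l) + C1)"
        using b1(1) g by (intro mult_left_mono) auto
      also have "(2 - golden) * (golden * n (f l) + C1) = (golden - 1) * n (f l) + (2 - golden) * C1"
        using golden(1) by algebra
      also have "(2 - golden) * C1 \<le> 1 * C1" using g C1 by (intro mult_right_mono) auto
      finally show ?thesis by simp
    qed
    \<comment> \<open>Two such normals bound \<open>B\<close>, which then occurs on both sides and
      is isolated by the factor \<gamma> + 1, the inverse of 2 - \<gamma>.\<close>
    have "B \<le> ln 32 + 2 * \<bar>c\<bar> + 2 * C1 + (golden - 1) * A + (golden - 1) * B"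
      using inter(2)[of k] wedge[of k] wedge[of "Suc k"] unfolding A_def B_def by linarith
    then have "(2 - golden) * B \<le> (ln 32 + 2 * \<bar>c\<bar> + 2 * C1) + (golden - 1) * A" by (simp add: algebra_simps)
    then have "(golden + 1) * ((2 - golden) * B) \<le> (golden + 1) * ((ln 32 + 2 * \<bar>c\<bar> + 2 * C1) + (golden - 1) * A)"
      using g by (intro mult_left_mono) auto
    moreover have "(golden + 1) * ((2 - golden) * B) = B" using golden(1) by algebra
    moreover have "(golden + 1) * ((ln 32 + 2 * \<bar>c\<bar> + 2 * C1) + (golden - 1) * A)
        = (golden + 1) * (ln 32 + 2 * \<bar>c\<bar> + 2 * C1) + golden * A" using golden(1) by algebra
    moreover have "(golden + 1) * (ln 32 + 2 * \<bar>c\<bar> + 2 * C1) \<le> 3 * (ln 32 + 2 * \<bar>c\<bar> + 2 * C1)"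
      using g C1 by (intro mult_right_mono) auto
    ultimately have u: "B - golden * A \<le> C" unfolding C_def using C1 by linarith
    \<comment> \<open>The lower bound comes from the successor of \<open>m (f k)\<close>, which does
      not come after \<open>m (f (Suc k))\<close>.\<close>
    have "n (Suc (f k)) \<le> B" unfolding B_def using f_less[of k] by (intro n_mono) simp
    then have "golden * A - B \<le> C" using b1(2)[of k] C1C unfolding A_def by linarith
    then show ?thesis using u unfolding A_def B_def by linarith
  qed
  have f_mono: "strict_mono f" using f_less by (simp add: strict_mono_Suc_iff)
  \<comment> \<open>If three consecutive members were dependent, the planes on both sides of the
    middle one would coincide, although \<open>m (Suc (f (Suc k)))\<close> lies outside the
    first.\<close>
  have "det3 (m (f k)) (m (f (Suc k))) (m (f (Suc (Suc k)))) \<noteq> 0" for k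
  proof
    assume 0: "det3 (m (f k)) (m (f (Suc k))) (m (f (Suc (Suc k)))) = 0"
    let ?h = "f k" and ?i = "f (Suc k)" and ?j = "f (Suc (Suc k))"
    let ?u = "cross (m ?h) (m (Suc ?h))" and ?v = "cross (m ?i) (m (Suc ?i))"
    have u: "dot3 ?u (m ?h) = 0" "dot3 ?u (m ?i) = 0"
      by (rule plane[of ?h ?i], use pl f_less[of k] in \<open>auto simp: less_imp_le\<close>)+
    have v: "dot3 ?v (m ?i) = 0" "dot3 ?v (m ?j) = 0"
      by (rule plane[of ?i ?j], use pl f_less[of "Suc k"] in \<open>auto simp: less_imp_le\<close>)+
    have ne: "?h \<noteq> ?i" "?i \<noteq> ?j" using f_less[of k] f_less[of "Suc k"] by auto
    have uj: "dot3 ?u (m ?j) = 0"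
      using orthogonal_iff[OF ne(1) symmetric_cross cross_nonzero u] 0 by simp
    have "det3 (m ?i) (m ?j) (m (Suc ?i)) = 0"
      using orthogonal_iff[OF ne(2) symmetric_cross cross_nonzero v, of "m (Suc ?i)"] by simp
    then have "dot3 ?u (m (Suc ?i)) = 0"
      using orthogonal_iff[OF ne(2) symmetric_cross cross_nonzero u(2) uj, of "m (Suc ?i)"] by simp
    then show False using inter(1)[of k] by simp
  qed
  moreover have "filterlim (\<lambda>k. n (f k)) at_top sequentially"
    using filterlim_compose[OF n_at_top filterlim_subseq[OF f_mono]] by simp
  moreover have "y k \<in> prim_matrices" for k
    using det[of k] mcontent[of "f k"] by (simp add: prim_matrices_def y_def f_def)
  ultimately have "principal_sequence \<xi> y C"
    unfolding principal_sequence_def y_def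
    using irr msym growth b1(3) C1C unfolding n_def d_def N_def D_def
    by (intro conjI allI) (simp_all, meson order_trans)
  then show ?thesis by blast
qed

end

lemma extremal_imp_principal_sequence:
  assumes "extremal \<xi>"
  shows "\<exists>y C. principal_sequence \<xi> y C"
proof -
  have irr: "\<xi> \<notin> \<rat>" and nq: "\<not> quadratic_number \<xi>" and ap: "approximable \<xi>"
    using assms extremal_iff by auto
  obtain c where c: "c > 0" and *: "\<And>X. X \<ge> 1 \<Longrightarrow> \<exists>x. approximates \<xi> X (c * X powr (- 1 / golden)) x" using ap unfolding approximable_def by blast
  obtain m where m: "\<And>i. minimal_point \<xi> (m i)" "\<And>i. err \<xi> (m i) < 1"
    "\<And>i. err \<xi> (m (Suc i)) < err \<xi> (m i)"
    "\<And>i. mat_norm (m i) < mat_norm (m (Suc i))"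
    "\<And>i z. symmetric z \<Longrightarrow> z \<noteq> 0 \<Longrightarrow> mat_norm z < mat_norm (m (Suc i)) \<Longrightarrow> err \<xi> (m i) \<le> err \<xi> z"
    using minimal_sequence[OF irr ap] by blast
  have mm: "symmetric (m i)" "m i \<noteq> 0" for i using m(1)[of i] by (auto simp: minimal_point_def)
  have "minimal_points \<xi> m (ln c + ln 2) (1 + \<bar>\<xi>\<bar>)"
  proof (rule minimal_points.intro)
    show "\<xi> \<notin> \<rat>" by (rule irr)
    show "p = 0 \<and> q = 0 \<and> r = 0" if "p + q * \<xi> + r * \<xi>^2 = 0" for p q r :: int
      using no_quadratic_relation[OF irr nq that] .
    show "content (m i) = 1" for i using minimal_point_content[OF irr m(1)] .
    show "ln (err \<xi> (m i)) \<le> (ln c + ln 2) - (golden - 1) * lnorm (m (Suc i))" for i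
    proof -
      have pos: "err \<xi> (m i) > 0" using err_pos[OF irr mm(2)] .
      have N1: "mat_norm (m (Suc i)) > 1" using m(4)[of i] mat_norm_ge1[OF mm(2), of i] by simp
      obtain p where p: "mat_norm (m (Suc i)) = real_of_int p" unfolding mat_norm_eq by blast
      then have p2: "p \<ge> 2" using N1 by simp
      \<comment> \<open>Norms are integers, so p - 1 is the largest integral bound strictly below
        the next norm; p \<ge> 2 gives X \<ge> p / 2, which costs the summand ln 2.\<close>
      define X where "X = real_of_int p - 1"
      have X: "X \<ge> 1" "X \<ge> real_of_int p / 2" using p2 by (simp_all add: X_def)
      obtain x where x: "symmetric x" "x \<noteq> 0" "mat_norm x \<le> X" "err \<xi> x \<le> c * X powr (- 1 / golden)"
        using *[OF X(1)] unfolding approximates_def by blast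
      have "err \<xi> (m i) \<le> err \<xi> x"
        using x(3) p by (intro m(5)[OF x(1,2)]) (simp add: X_def)
      then have "err \<xi> (m i) \<le> c * X powr (- 1 / golden)" using x(4) by simp
      then have "ln (err \<xi> (m i)) \<le> ln (c * X powr (- 1 / golden))" using pos by simp
      also have "\<dots> = ln c + - 1 / golden * ln X" using c X by (simp add: ln_mult ln_powr)
      also have "- 1 / golden = - (golden - 1)" using golden(4) by simp
      finally have 1: "ln (err \<xi> (m i)) \<le> ln c - (golden - 1) * ln X" by (simp add: algebra_simps)
      have "ln (real_of_int p / 2) \<le> ln X" using X p2 by simp
      then have "ln (real_of_int p) - ln 2 \<le> ln X" using p2 by (simp add: ln_div)
      then have "(golden - 1) * (ln (real_of_int p) - ln 2) \<le> (golden - 1) * ln X"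
        using golden by (intro mult_left_mono) auto
      moreover have "(golden - 1) * ln 2 \<le> 1 * ln 2" using golden by (intro mult_right_mono) auto
      ultimately show ?thesis using 1 unfolding p by (simp only: right_diff_distrib)
    qed
  qed (use m mm in auto)
  then show ?thesis by (rule minimal_points.principal_sequence_exists)
qed

section \<open>The recurrence\<close>

lemma adj_mult_rev: "adj (A ** B) = adj B ** adj A"
  by (simp add: mat_eq_iff2 mult_nth2 algebra_simps)

lemma adj_adj [simp]: "adj (adj A) = A"
  by (simp add: mat_eq_iff2)

lemma adj_smul: "adj (smul s A) = smul s (adj A)"
  by (simp add: mat_eq_iff2)

lemma prop_adj: "A \<simeq> B \<Longrightarrow> adj A \<simeq> adj B"
  unfolding proportional_def by (metis adj_smul)

lemma prop_left: "A \<simeq> B \<Longrightarrow> C ** A \<simeq> C ** B"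
  by (simp add: prop_mult)

lemma prop_right: "A \<simeq> B \<Longrightarrow> A ** C \<simeq> B ** C"
  by (simp add: prop_mult)

lemma det_nonzero_imp_nonzero: "det A \<noteq> 0 \<Longrightarrow> (A :: int^2^2) \<noteq> 0"
  by (auto simp: det_2)

text \<open>Each of the three terms is at most exp(-7), hence at most 1/8, and 2 * 3/8 < 1 leaves
  only the integer 0.\<close>

lemma det3_eq_0_of_small:
  assumes "\<xi> \<notin> \<rat>" "symmetric a" "symmetric b" "symmetric c" "a \<noteq> 0" "b \<noteq> 0" "c \<noteq> 0"
    and "lnorm a + ln (err \<xi> b) + ln (err \<xi> c) \<le> - 7"
    and "lnorm b + ln (err \<xi> a) + ln (err \<xi> c) \<le> - 7"
    and "lnorm c + ln (err \<xi> a) + ln (err \<xi> b) \<le> - 7"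
  shows "det3 a b c = 0"
proof -
  have small: "p * q * r \<le> 1 / 8" if "p > 0" "q > 0" "r > 0" "ln p + ln q + ln r \<le> - 7" for p q r :: real
  proof -
    have "ln (p * q * r) = ln p + ln q + ln r" using that by (simp add: ln_mult)
    then have "p * q * r \<le> exp (- 7)" using that by (metis exp_le_cancel_iff exp_ln mult_pos_pos)
    also have "exp (- 7) \<le> 1 / (8 :: real)"
      using exp_ge_add_one_self[of "7::real"] by (simp add: exp_minus field_simps)
    finally show ?thesis .
  qed
  have pos: "mat_norm a > 0" "mat_norm b > 0" "mat_norm c > 0"
    "err \<xi> a > 0" "err \<xi> b > 0" "err \<xi> c > 0"
    using mat_norm_ge1 err_pos assms by (force intro: less_le_trans[of 0 1])+
  have "\<bar>real_of_int (det3 a b c)\<bar> \<le> 2 * (1 / 8 + 1 / 8 + 1 / 8)"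
    using abs_det3_le[OF refl assms(2,3,4), of \<xi>] small[OF pos(1,5,6) assms(8)]
      small[OF pos(2,4,6) assms(9)] small[OF pos(3,4,5) assms(10)]
    unfolding distrib_left by linarith
  then have "\<bar>real_of_int (det3 a b c)\<bar> < 1" by simp
  then show ?thesis by linarith
qed

text \<open>\<open>w\<close> lies in the plane through \<open>a\<close>, \<open>b\<close> and in
  that through \<open>b\<close>, \<open>c\<close>; as \<open>a\<close>, \<open>b\<close>,
  \<open>c\<close> are independent, these planes are distinct and meet in the line of
  \<open>b\<close>.\<close>

lemma prop_of_det3:
  assumes "symmetric a" "symmetric b" "symmetric c" "symmetric w" "b \<noteq> 0" "w \<noteq> 0"
    and "det3 a b c \<noteq> 0" "det3 a b w = 0" "det3 b c w = 0"
  shows "w \<simeq> b"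
proof (rule ccontr)
  assume "\<not> w \<simeq> b"
  then have nb: "\<not> b \<simeq> w" using prop_sym by blast
  have nz: "cross a b \<noteq> 0" "cross b c \<noteq> 0"
    using assms(7) det3_rotate[of a b c] by (auto simp: det3_def dot3_def)
  note o = orthogonal_iff_det3[OF assms(2,4,5,6) nb symmetric_cross]
  have "dot3 (cross b c) c = 0 \<longleftrightarrow> det3 b w c = 0"
    by (rule o[OF nz(2)]) (use assms(9) in \<open>simp_all add: det3_def\<close>)
  moreover have "dot3 (cross a b) c = 0 \<longleftrightarrow> det3 b w c = 0"
    by (rule o[OF nz(1)]) (use assms(8) in \<open>simp_all add: det3_def\<close>)
  ultimately show False using assms(7) by (simp add: det3_def)
qed

text \<open>Makes independence of three consecutive members the same as asymmetry of the matrix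
  linking them.\<close>

lemma det3_eq_asymmetry:
  assumes "symmetric a" "symmetric b" "symmetric c"
  shows "det3 a b c = (adj b ** c ** adj a) $ 2 $ 1 - (adj b ** c ** adj a) $ 1 $ 2"
  using symmetric_nth[OF assms(1)] symmetric_nth[OF assms(2)] symmetric_nth[OF assms(3)]
  by (simp add: mult_nth2 det3_def dot3_def cross_def algebra_simps)

section \<open>Capture of good approximations, and the linking matrices\<close>

context principal_sequence
begin

definition "n k = lnorm (y k)"
definition "d k = ln (err \<xi> (y k))"

lemma y_det: "det (y k) \<noteq> 0" using prim prim_det by blast
lemma y_nonzero: "y k \<noteq> 0" using y_det det_nonzero_imp_nonzero by blast
lemma N_ge1: "mat_norm (y k) \<ge> 1" using mat_norm_ge1[OF y_nonzero] .
lemma N_pos: "mat_norm (y k) > 0" using N_ge1[of k] by linarith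
lemma D_pos: "err \<xi> (y k) > 0" using err_pos[OF irrational y_nonzero] .
lemma n_nonneg: "n k \<ge> 0" unfolding n_def using N_ge1 by simp
lemma C_nonneg: "C \<ge> 0" using error[of 0] by linarith

lemma growth_n: "golden * n k - C \<le> n (Suc k)" "n (Suc k) \<le> golden * n k + C"
  using growth[of k] unfolding n_def by linarith+

lemma d_bounds: "- n k - C \<le> d k" "d k \<le> - n k + C"
  using error[of k] unfolding n_def d_def by linarith+

text \<open>\<gamma>^2 = \<gamma> + 1 turns geometric growth into a Fibonacci recurrence with
  bounded additive error.\<close>

lemma growth_add: "n (Suc k) + n k - 2 * C \<le> n (Suc (Suc k))" "n (Suc (Suc k)) \<le> n (Suc k) + n k + 2 * C"
proof -
  have g: "golden * golden = golden + 1" "golden - 1 \<ge> 0" "golden - 1 \<le> 1" using golden by auto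
  have "n k - (golden - 1) * C = (golden - 1) * (golden * n k - C)" using g(1) by algebra
  also have "\<dots> \<le> (golden - 1) * n (Suc k)" using growth_n[of k] g by (intro mult_left_mono) auto
  finally have 1: "n k - (golden - 1) * C \<le> (golden - 1) * n (Suc k)" .
  have "(golden - 1) * n (Suc k) \<le> (golden - 1) * (golden * n k + C)"
    using growth_n[of k] g by (intro mult_left_mono) auto
  also have "\<dots> = n k + (golden - 1) * C" using g(1) by algebra
  finally have 2: "(golden - 1) * n (Suc k) \<le> n k + (golden - 1) * C" .
  have "(golden - 1) * C \<le> 1 * C" using g C_nonneg by (intro mult_right_mono) auto
  moreover have "(golden - 1) * n (Suc k) = golden * n (Suc k) - n (Suc k)" by (simp add: algebra_simps)
  ultimately show "n (Suc k) + n k - 2 * C \<le> n (Suc (Suc k))" "n (Suc (Suc k)) \<le> n (Suc k) + n k + 2 * C"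
    using growth_n[of "Suc k"] 1 2 by linarith+
qed

lemma n_Suc_ge: "n k + n k / 2 - C \<le> n (Suc k)"
proof -
  have "(3 / 2) * n k \<le> golden * n k" using golden n_nonneg by (intro mult_right_mono) auto
  then show ?thesis using growth_n(1)[of k] by linarith
qed

lemma n_Suc_le: "n (Suc k) \<le> 2 * n k + C"
proof -
  have "golden * n k \<le> 2 * n k" using golden n_nonneg by (intro mult_right_mono) auto
  then show ?thesis using growth_n(2)[of k] by linarith
qed

lemma n_large: "\<exists>k0. \<forall>k\<ge>k0. n k \<ge> B"
  using unbounded unfolding filterlim_at_top eventually_sequentially n_def by blast

lemma n_gap: "\<exists>k0. \<forall>k\<ge>k0. n k + G \<le> n (Suc k)"
proof -
  obtain k0 where k0: "\<And>k. k \<ge> k0 \<Longrightarrow> n k \<ge> 2 * \<bar>G\<bar> + 2 * C" using n_large by blast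
  have "n k + G \<le> n (Suc k)" if "k \<ge> k0" for k using k0[OF that] n_Suc_ge[of k] by linarith
  then show ?thesis by blast
qed

text \<open>All terms of the determinants of \<open>w\<close> with y(k), y(k+1) and with y(k+1),
  y(k+2) become at most exp(-7): 7 is the margin of \<open>det3_eq_0_of_small\<close>, and 4 C
  absorbs the deviations in growth and in the product of norm and error.\<close>

lemma capture:
  assumes w: "symmetric w" "w \<noteq> 0"
    and 1: "lnorm w \<le> n (Suc k) + n k - (4 * C + 7)"
    and 2: "ln (err \<xi> w) \<le> - n k - (4 * C + 7)"
  shows "w \<simeq> y (Suc k)"
proof (rule prop_of_det3[OF sym sym sym w(1) y_nonzero w(2) independent])
  note b = n_nonneg[of k] n_nonneg[of "Suc k"] C_nonneg d_bounds[of k] d_bounds[of "Suc k"] d_bounds[of "Suc (Suc k)"]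
    n_Suc_le[of k] growth_add[of k] 1 2
  show "det3 (y k) (y (Suc k)) w = 0"
    by (rule det3_eq_0_of_small[OF irrational sym sym w(1) y_nonzero y_nonzero w(2)];
        fold n_def d_def; use b in linarith)
  show "det3 (y (Suc k)) (y (Suc (Suc k))) w = 0"
    by (rule det3_eq_0_of_small[OF irrational sym sym w(1) y_nonzero y_nonzero w(2)];
        fold n_def d_def; use b in linarith)
qed

lemma capture_near:
  "\<exists>k0. \<forall>k\<ge>k0. \<forall>w. symmetric w \<longrightarrow> w \<noteq> 0 \<longrightarrow> lnorm w \<le> n k + E \<longrightarrow>
     ln (err \<xi> w) \<le> - n k + E \<longrightarrow> w \<simeq> y k"
proof -
  obtain k1 where k1: "\<And>k. k \<ge> k1 \<Longrightarrow> n k \<ge> 4 * C + 7 + E" using n_large by blast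
  obtain k2 where k2: "\<And>k. k \<ge> k2 \<Longrightarrow> n k + (4 * C + 7 + E) \<le> n (Suc k)" using n_gap by blast
  show ?thesis
  proof (intro exI[of _ "Suc (max k1 k2)"] allI impI)
    fix k w assume k: "k \<ge> Suc (max k1 k2)" and w: "symmetric w" "w \<noteq> 0"
      "lnorm w \<le> n k + E" "ln (err \<xi> w) \<le> - n k + E"
    obtain j where j: "k = Suc j" "j \<ge> k1" "j \<ge> k2" using k by (cases k) auto
    show "w \<simeq> y k" unfolding j(1)
      by (rule capture[OF w(1,2)]) (use w(3,4) k1[OF j(2)] k2[OF j(3)] in \<open>unfold j(1), linarith\<close>)+
  qed
qed

text \<open>\<open>w\<close> is matched with the first k at which the norm condition of
  \<open>capture\<close> holds; its failure at k - 1 bounds the norm from below, and the bounded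
  product of norm and error then supplies the error condition.\<close>

lemma capture_any:
  "\<exists>T. \<forall>w. symmetric w \<longrightarrow> w \<noteq> 0 \<longrightarrow> T \<le> lnorm w \<longrightarrow>
     lnorm w + ln (err \<xi> w) \<le> E \<longrightarrow> (\<exists>k\<ge>k1. w \<simeq> y k)"
proof -
  define B where "B = 4 * C + 7"
  obtain k2 where k2: "\<And>k. k \<ge> k2 \<Longrightarrow> n k \<ge> 2 * B + \<bar>E\<bar>" using n_large by blast
  define k3 where "k3 = max k1 k2"
  define P where "P w k \<longleftrightarrow> k \<ge> k3 \<and> lnorm w \<le> n (Suc k) + n k - B" for w k
  show ?thesis
  proof (intro exI[of _ "n (Suc k3) + n k3 - B + 1"] allI impI)
    fix w assume w: "symmetric w" "w \<noteq> 0" "n (Suc k3) + n k3 - B + 1 \<le> lnorm w"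
      "lnorm w + ln (err \<xi> w) \<le> E"
    obtain k0 where k0: "\<And>k. k \<ge> k0 \<Longrightarrow> n k \<ge> lnorm w + B" using n_large by blast
    have "P w (max k0 k3)"
      unfolding P_def using k0[of "max k0 k3"] n_nonneg[of "Suc (max k0 k3)"] by auto
    then have least: "P w (LEAST k. P w k)" by (rule LeastI)
    define k where "k = (LEAST k. P w k)"
    have k: "P w k" using least unfolding k_def .
    have "k \<noteq> k3" using k w(3) unfolding P_def by auto
    then obtain j where j: "k = Suc j" "j \<ge> k3" using k unfolding P_def by (cases k) auto
    have "\<not> P w j" using not_less_Least[of j "P w"] j(1) unfolding k_def[symmetric] by simp
    then have "lnorm w > n k + n j - B" using j unfolding P_def by auto
    moreover have "n j \<ge> 2 * B + \<bar>E\<bar>" using k2[of j] j(2) by (simp add: k3_def)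
    moreover have "B \<ge> 0" unfolding B_def using C_nonneg by simp
    ultimately have "ln (err \<xi> w) \<le> - n k - B" using w(4) by linarith
    then have "w \<simeq> y (Suc k)"
      using k by (intro capture[OF w(1,2)]) (auto simp: P_def B_def)
    moreover have "Suc k \<ge> k1" using k by (auto simp: P_def k3_def)
    ultimately show "\<exists>k\<ge>k1. w \<simeq> y k" by blast
  qed
qed

text \<open>In logarithms N(k+2)^2 D(k+3) is about 2 n(k+2) - n(k+3), which two Fibonacci steps
  reduce to n(k), and D(k+2)^2 N(k+3) is about the negative of this. The hypothesis
  \<open>large\<close> makes the error less than 1, as \<open>mat_norm_le_corner\<close>
  requires.\<close>

lemma sandwich_sequence_bounds:
  fixes k
  defines "w \<equiv> y (Suc (Suc k)) ** adj (y (Suc (Suc (Suc k)))) ** y (Suc (Suc k))"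
  assumes large: "ln 4 + 6 * C < n k"
  shows "lnorm w \<le> n k + (ln (12 * (1 + \<bar>\<xi>\<bar>)^3) + 6 * C)"
    "ln (err \<xi> w) \<le> - n k + (ln 4 + 6 * C)" "symmetric w" "w \<noteq> 0"
proof -
  let ?a = "Suc (Suc k)" let ?b = "Suc (Suc (Suc k))"
  define N where "N = mat_norm (y ?a)" define D where "D = err \<xi> (y ?a)"
  define N' where "N' = mat_norm (y ?b)" define D' where "D' = err \<xi> (y ?b)"
  have pos: "N > 0" "D > 0" "N' > 0" "D' > 0" unfolding N_def D_def N'_def D'_def by (rule N_pos D_pos)+
  have ln: "ln N = n ?a" "ln D = d ?a" "ln N' = n ?b" "ln D' = d ?b"
    unfolding N_def D_def N'_def D'_def n_def d_def by auto
  have s: "symmetric (adj (y j))" for j using sym[of j] by (simp flip: adj_transpose)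
  show ws: "symmetric w" unfolding w_def by (simp add: matrix_transpose_mul sym s matrix_mul_assoc)
  have "det w \<noteq> 0" unfolding w_def using y_det by (simp add: det_mul)
  then show wn: "w \<noteq> 0" by (rule det_nonzero_imp_nonzero)
  note b = C_nonneg n_nonneg[of k] n_nonneg[of "Suc k"] d_bounds[of ?a] d_bounds[of ?b]
    growth_add[of k] growth_add[of "Suc k"] n_Suc_le[of ?a] n_Suc_ge[of k] n_Suc_ge[of "Suc k"] n_Suc_ge[of ?a] n_nonneg[of ?a]
  have le_exp: "t \<le> exp v" if "t > 0" "ln t \<le> v" for t v :: real using that by (metis exp_le_cancel_iff exp_ln)
  have 1: "N^2 * D' \<le> exp (n k + 6 * C)"
  proof (rule le_exp)
    have "ln (N^2 * D') = 2 * n ?a + d ?b" using pos ln by (simp add: ln_mult ln_realpow)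
    then show "ln (N^2 * D') \<le> n k + 6 * C" using b by linarith
  qed (use pos in simp)
  have 2: "D^2 * N' \<le> exp (n k + 6 * C)"
  proof (rule le_exp)
    have "ln (D^2 * N') = 2 * d ?a + n ?b" using pos ln by (simp add: ln_mult ln_realpow)
    then show "ln (D^2 * N') \<le> n k + 6 * C" using b by linarith
  qed (use pos in simp)
  have 3: "D * N * D' \<le> exp (- n k + 6 * C)"
  proof (rule le_exp)
    have "ln (D * N * D') = d ?a + n ?a + d ?b" using pos ln by (simp add: ln_mult)
    then show "ln (D * N * D') \<le> - n k + 6 * C" using b by linarith
  qed (use pos in simp)
  have 4: "D^2 * N' \<le> exp (- n k + 6 * C)"
  proof (rule le_exp)
    have "ln (D^2 * N') = 2 * d ?a + n ?b" using pos ln by (simp add: ln_mult ln_realpow)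
    then show "ln (D^2 * N') \<le> - n k + 6 * C" using b by linarith
  qed (use pos in simp)
  define K where "K = 1 + \<bar>\<xi>\<bar>"
  have K: "K > 0" by (simp add: K_def)
  note sb = sandwich_bounds[OF K_def sym sym, of ?a ?b, folded w_def N_def D_def N'_def D'_def]
  have "err \<xi> w \<le> 2 * D * (N * D' + N' * D)" using sb(1) unfolding mixed_def[OF K_def] N_def D_def N'_def D'_def .
  also have "\<dots> = 2 * (D * N * D') + 2 * (D^2 * N')" by (simp add: algebra_simps power2_eq_square)
  also have "\<dots> \<le> 4 * exp (- n k + 6 * C)" using 3 4 by simp
  finally have "err \<xi> w \<le> 4 * exp (- n k + 6 * C)" .
  moreover have ep: "err \<xi> w > 0" using err_pos[OF irrational wn] .
  ultimately have "ln (err \<xi> w) \<le> ln (4 * exp (- n k + 6 * C))" by (metis ln_mono)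
  also have "\<dots> = ln 4 + (- n k + 6 * C)" by (simp add: ln_mult)
  finally show le: "ln (err \<xi> w) \<le> - n k + (ln 4 + 6 * C)" by simp
  have "ln (err \<xi> w) < 0" using le large by linarith
  then have "err \<xi> w < 1" using ep by simp
  then have "mat_norm w \<le> 2 * K^2 * \<bar>real_of_int (w$1$1)\<bar>"
    using mat_norm_le_corner(2)[OF K_def ws _ wn] by simp
  also have "\<dots> \<le> 2 * K^2 * (3 * K * (2 * exp (n k + 6 * C)))"
    using order_trans[OF sb(2), of "3 * K * (2 * exp (n k + 6 * C))"] 1 2 K by (intro mult_left_mono) auto
  finally have "mat_norm w \<le> 12 * K^3 * exp (n k + 6 * C)" by (simp add: power2_eq_square power3_eq_cube)
  moreover have "mat_norm w > 0" using mat_norm_ge1[OF wn] by simp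
  ultimately have "lnorm w \<le> ln (12 * K^3 * exp (n k + 6 * C))" by (metis ln_mono)
  also have "\<dots> = ln (12 * K^3) + (n k + 6 * C)" using K by (simp add: ln_mult)
  finally show "lnorm w \<le> n k + (ln (12 * (1 + \<bar>\<xi>\<bar>)^3) + 6 * C)" unfolding K_def by simp
qed

lemma recurrence:
  "\<exists>k0. \<forall>k\<ge>k0. y (k + 3) \<simeq> y (k + 2) ** adj (y k) ** y (k + 2)"
proof -
  define E where "E = \<bar>ln (12 * (1 + \<bar>\<xi>\<bar>)^3)\<bar> + \<bar>ln 4\<bar> + 6 * C"
  have E: "ln (12 * (1 + \<bar>\<xi>\<bar>)^3) + 6 * C \<le> E" "ln 4 + 6 * C \<le> E" unfolding E_def by linarith+
  obtain k0 where k0: "\<And>k w. k \<ge> k0 \<Longrightarrow> symmetric w \<Longrightarrow> w \<noteq> 0 \<Longrightarrow> lnorm w \<le> n k + E \<Longrightarrow>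
     ln (err \<xi> w) \<le> - n k + E \<Longrightarrow> w \<simeq> y k" using capture_near[of E] by blast
  obtain k1 where k1: "\<And>k. k \<ge> k1 \<Longrightarrow> n k \<ge> ln 4 + 6 * C + 1" using n_large by blast
  have "y (k + 3) \<simeq> y (k + 2) ** adj (y k) ** y (k + 2)" if "k \<ge> k0" "k \<ge> k1" for k
  proof -
    have "ln 4 + 6 * C < n k" using k1[OF that(2)] by linarith
    let ?x = "y (k + 2)" and ?z = "y (k + 3)"
    have e: "Suc (Suc k) = k + 2" "Suc (k + 2) = k + 3" by auto
    note sb = sandwich_sequence_bounds[OF \<open>ln 4 + 6 * C < n k\<close>, unfolded e]
    have "?x ** adj ?z ** ?x \<simeq> y k"
      by (rule k0[OF that(1) sb(3,4)]) (use sb(1,2) E in linarith)+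
    then have "adj ?x ** (?x ** (adj ?z ** ?x)) ** adj ?x \<simeq> adj ?x ** y k ** adj ?x"
      by (intro prop_mult) (simp_all add: matrix_mul_assoc)
    moreover have "adj ?x ** (?x ** (adj ?z ** ?x)) ** adj ?x \<simeq> (adj ?z ** ?x) ** adj ?x"
      by (intro prop_right prop_adj_cancel y_det)
    moreover have "(adj ?z ** ?x) ** adj ?x \<simeq> adj ?z" by (intro prop_adj_cancel y_det)
    ultimately have "adj ?z \<simeq> adj ?x ** y k ** adj ?x"
      using prop_sym prop_trans by blast
    then have "?z \<simeq> adj (adj ?x ** y k ** adj ?x)" using prop_adj by fastforce
    then show ?thesis by (simp add: adj_mult_rev matrix_mul_assoc)
  qed
  then show ?thesis by (meson max.bounded_iff)
qed

definition "link k = adj (y (k + 1)) ** y (k + 2) ** adj (y k)"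

lemma link_det: "det (link k) \<noteq> 0"
  unfolding link_def using y_det by (simp add: det_mul)

lemma link_recurrence: "y (k + 2) \<simeq> y (k + 1) ** link k ** y k"
proof -
  let ?P = "y (k + 1) ** (adj (y (k + 1)) ** y (k + 2))"
  have "y (k + 1) ** link k ** y k = (?P ** adj (y k)) ** y k" by (simp add: link_def matrix_mul_assoc)
  also have "\<dots> \<simeq> ?P" by (intro prop_adj_cancel y_det)
  also have "?P \<simeq> y (k + 2)" by (intro prop_adj_cancel y_det)
  finally show ?thesis by (rule prop_sym)
qed

lemma link_unique:
  assumes "y (k + 2) \<simeq> y (k + 1) ** M ** y k" shows "M \<simeq> link k"
proof -
  have "(y (k + 1) ** M ** y k) ** adj (y k) \<simeq> y (k + 1) ** M" by (intro prop_adj_cancel y_det)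
  then have "adj (y (k + 1)) ** ((y (k + 1) ** M ** y k) ** adj (y k)) \<simeq> adj (y (k + 1)) ** (y (k + 1) ** M)"
    by (rule prop_left)
  also have "\<dots> \<simeq> M" by (intro prop_adj_cancel y_det)
  finally have 1: "adj (y (k + 1)) ** ((y (k + 1) ** M ** y k) ** adj (y k)) \<simeq> M" .
  have "link k \<simeq> adj (y (k + 1)) ** ((y (k + 1) ** M ** y k) ** adj (y k))"
    unfolding link_def matrix_mul_assoc[of "adj (y (k + 1))" "y (k + 2)", symmetric]
    by (intro prop_left prop_right assms)
  then show ?thesis using 1 prop_sym prop_trans by blast
qed

lemma symmetric_adj: "transpose (adj (y k)) = adj (y k)"
  using sym[of k] by (simp flip: adj_transpose)

text \<open>Inserting the recurrence for y(k+3) cancels y(k+2) on the left and leaves y(k)^(-1)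
  y(k+2) y(k+1)^(-1): the factors of \<open>link k\<close> in reverse order, each of them
  symmetric.\<close>

lemma link_transpose: "\<exists>k0. \<forall>k\<ge>k0. link (Suc k) \<simeq> transpose (link k)"
proof -
  obtain k0 where k0: "\<And>k. k \<ge> k0 \<Longrightarrow> y (k + 3) \<simeq> y (k + 2) ** adj (y k) ** y (k + 2)"
    using recurrence by blast
  have "link (Suc k) \<simeq> transpose (link k)" if k: "k \<ge> k0" for k
  proof -
    have "link (Suc k) = adj (y (k + 2)) ** y (k + 3) ** adj (y (k + 1))"
      by (simp add: link_def numeral_eq_Suc)
    also have "\<dots> \<simeq> adj (y (k + 2)) ** (y (k + 2) ** (adj (y k) ** y (k + 2))) ** adj (y (k + 1))"
      using k0[OF k] by (intro prop_right prop_left) (simp add: matrix_mul_assoc)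
    also have "\<dots> \<simeq> (adj (y k) ** y (k + 2)) ** adj (y (k + 1))"
      by (intro prop_right prop_adj_cancel y_det)
    also have "\<dots> = transpose (link k)"
      by (simp add: link_def matrix_transpose_mul sym symmetric_adj matrix_mul_assoc)
    finally show ?thesis .
  qed
  then show ?thesis by blast
qed

lemma link_not_symmetric: "transpose (link k) \<noteq> link k"
proof
  assume "transpose (link k) = link k"
  then have e: "link k $ 2 $ 1 = link k $ 1 $ 2" by (simp add: symmetric_iff)
  have "det3 (y k) (y (k + 1)) (y (k + 2)) = link k $ 2 $ 1 - link k $ 1 $ 2"
    unfolding link_def by (rule det3_eq_asymmetry[OF sym sym sym])
  then have "det3 (y k) (y (k + 1)) (y (k + 2)) = 0" using e by simp
  then show False using independent[of k] by simp
qed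

text \<open>The trace of a symmetric times a skew matrix is zero. So a skew \<open>M\<close> would
  make Z = y(k+2) y(k)^(-1), proportional to \<open>y (k + 1) ** M\<close>, traceless, and Z^2
  scalar; then y(k+3), proportional to Z^2 y(k), would be proportional to y(k), against the growth
  of the norms.\<close>

lemma link_not_skew: "\<exists>k0. \<forall>k\<ge>k0. \<forall>M. M \<simeq> link k \<longrightarrow> transpose M \<noteq> - M"
proof -
  obtain k0 where k0: "\<And>k. k \<ge> k0 \<Longrightarrow> y (k + 3) \<simeq> y (k + 2) ** adj (y k) ** y (k + 2)"
    using recurrence by blast
  obtain k1 where k1: "\<And>k. k \<ge> k1 \<Longrightarrow> n k + 1 \<le> n (Suc k)" using n_gap by blast
  have "transpose M \<noteq> - M" if k: "k \<ge> max k0 k1" and M: "M \<simeq> link k" for k M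
  proof
    assume sk: "transpose M = - M"
    have e: "M$j$i = - M$i$j" for i j using arg_cong[OF sk, of "\<lambda>A. A$i$j"] by simp
    have "M$1$1 = 0" "M$2$2 = 0" "M$2$1 = - M$1$2" using e[of 1 1] e[of 2 2] e[of 1 2] by simp_all
    then have tr: "(y (k + 1) ** M)$1$1 + (y (k + 1) ** M)$2$2 = 0"
      using sym[of "k + 1"] by (simp add: mult_nth2 symmetric_iff)
    let ?c = "y (k + 2)" and ?a = "y k"
    have "?c \<simeq> y (k + 1) ** M ** ?a"
      by (rule prop_trans[OF link_recurrence])
         (intro prop_left prop_right prop_sym[OF M])
    then have "?c ** adj ?a \<simeq> (y (k + 1) ** M ** ?a) ** adj ?a" by (rule prop_right)
    also have "\<dots> \<simeq> y (k + 1) ** M" by (intro prop_adj_cancel y_det)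
    finally obtain s t where st: "s \<noteq> 0" "t \<noteq> 0" "smul s (?c ** adj ?a) = smul t (y (k + 1) ** M)"
      unfolding proportional_def by blast
    define Z where "Z = ?c ** adj ?a"
    have "s * (Z$1$1 + Z$2$2) = t * ((y (k + 1) ** M)$1$1 + (y (k + 1) ** M)$2$2)"
      using arg_cong[OF st(3), of "\<lambda>A. A$1$1 + A$2$2"] unfolding Z_def by (simp add: algebra_simps)
    then have "Z$1$1 + Z$2$2 = 0" using tr st(1) by simp
    then have z: "Z$2$2 = - Z$1$1" by simp
    have ZZ: "Z ** Z = smul (- det Z) (mat 1)" by (simp add: mat_eq_iff2 mult_nth2 det_2 z)
    have dZ: "det Z \<noteq> 0" unfolding Z_def using y_det by (simp add: det_mul)
    have "y (k + 3) \<simeq> ?c ** adj ?a ** ?c" using k0 k by simp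
    also have "?c ** adj ?a ** ?c \<simeq> (?c ** adj ?a ** ?c) ** adj ?a ** ?a"
      by (intro prop_sym[OF prop_adj_cancel(4)] y_det)
    also have "\<dots> = (Z ** Z) ** ?a" by (simp add: Z_def matrix_mul_assoc)
    also have "\<dots> = smul (- det Z) ?a" by (simp add: ZZ smul_mult)
    also have "\<dots> \<simeq> ?a" using dZ by (intro prop_smul) simp
    finally have "y (k + 3) = y k \<or> y (k + 3) = - y k"
      using prim prim_content by (intro prop_prim) auto
    then have "n (k + 3) = n k" unfolding n_def by (auto simp: mat_norm_uminus)
    moreover have "n (k + 3) \<ge> n k + 3" using k1[of k] k1[of "k + 1"] k1[of "k + 2"] k by (simp add: numeral_eq_Suc)
    ultimately show False by simp
  qed
  then show ?thesis by blast
qed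

end

section \<open>Approximating sequences in logarithmic form; existence and uniqueness of the
  associated matrix\<close>

lemma comparableI:
  assumes "c1 > 0" "c2 > 0" "\<And>i. i \<ge> 1 \<Longrightarrow> c1 * g i \<le> f i" "\<And>i. i \<ge> 1 \<Longrightarrow> f i \<le> c2 * g i"
  shows "comparable f g"
  unfolding comparable_def using assms by blast

lemma comparable_iff_ln:
  assumes "\<And>i. i \<ge> 1 \<Longrightarrow> f i > 0" "\<And>i. i \<ge> 1 \<Longrightarrow> g i > 0"
  shows "comparable f g \<longleftrightarrow> (\<exists>B. \<forall>i\<ge>1. \<bar>ln (f i) - ln (g i)\<bar> \<le> B)"
proof
  assume "comparable f g"
  then obtain c1 c2 where c: "c1 > 0" "c2 > 0" "\<And>i. i \<ge> 1 \<Longrightarrow> c1 * g i \<le> f i \<and> f i \<le> c2 * g i"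
    unfolding comparable_def by blast
  have "\<bar>ln (f i) - ln (g i)\<bar> \<le> \<bar>ln c1\<bar> + \<bar>ln c2\<bar>" if i: "i \<ge> 1" for i
  proof -
    have "ln (c1 * g i) \<le> ln (f i)" "ln (f i) \<le> ln (c2 * g i)"
      using c assms[OF i] i by (auto intro!: ln_mono mult_pos_pos)
    then have "ln c1 + ln (g i) \<le> ln (f i)" "ln (f i) \<le> ln c2 + ln (g i)"
      using c(1,2) assms(2)[OF i] by (simp_all add: ln_mult)
    then show ?thesis by linarith
  qed
  then show "\<exists>B. \<forall>i\<ge>1. \<bar>ln (f i) - ln (g i)\<bar> \<le> B" by blast
next
  assume "\<exists>B. \<forall>i\<ge>1. \<bar>ln (f i) - ln (g i)\<bar> \<le> B"
  then obtain B where B: "\<And>i. i \<ge> 1 \<Longrightarrow> \<bar>ln (f i) - ln (g i)\<bar> \<le> B" by blast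
  show "comparable f g"
  proof (rule comparableI[of "exp (- B)" "exp B"])
    fix i :: nat assume i: "i \<ge> 1"
    have "exp (- B + ln (g i)) \<le> exp (ln (f i))" "exp (ln (f i)) \<le> exp (B + ln (g i))"
      unfolding exp_le_cancel_iff using B[OF i] by linarith+
    then show "exp (- B) * g i \<le> f i" "f i \<le> exp B * g i" using assms[OF i] unfolding exp_add by simp_all
  qed simp_all
qed

lemma prim_nonzero: "A \<in> prim_matrices \<Longrightarrow> A \<noteq> 0"
  using prim_det det_nonzero_imp_nonzero by blast

lemma prim_proportional_eq: "A \<in> prim_matrices \<Longrightarrow> B \<in> prim_matrices \<Longrightarrow> A \<simeq> B \<Longrightarrow> A = B \<or> A = - B"
  using prop_prim prim_content by blast

text \<open>The condition on the determinants follows from the others: they are nonzero integers and at most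
  twice the product of norm and error.\<close>

lemma approx_seq_iff:
  assumes "\<xi> \<notin> \<rat>"
  shows "approximating_sequence \<xi> x \<longleftrightarrow>
     (\<forall>i\<ge>1. x i \<in> prim_matrices \<and> symmetric (x i)) \<and> (\<forall>T. \<exists>i\<ge>1. lnorm (x i) > T) \<and>
     (\<exists>B. \<forall>i\<ge>1. \<bar>lnorm (x (Suc i)) - golden * lnorm (x i)\<bar> \<le> B) \<and>
     (\<exists>B. \<forall>i\<ge>1. \<bar>lnorm (x i) + ln (err \<xi> (x i))\<bar> \<le> B)"
proof (cases "\<forall>i\<ge>1. x i \<in> prim_matrices \<and> symmetric (x i)")
  case True
  then have x: "x i \<in> prim_matrices" "symmetric (x i)" if "i \<ge> 1" for i using that by auto
  have N: "mat_norm (x i) > 0" and D: "err \<xi> (x i) > 0" if "i \<ge> 1" for i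
    using mat_norm_ge1[OF prim_nonzero[OF x(1)[OF that]]] err_pos[OF assms prim_nonzero[OF x(1)[OF that]]] by simp_all
  have 1: "(\<forall>B. \<exists>i\<ge>1. mat_norm (x i) > B) \<longleftrightarrow> (\<forall>T. \<exists>i\<ge>1. lnorm (x i) > T)"
  proof (intro iffI allI)
    fix T assume "\<forall>B. \<exists>i\<ge>1. mat_norm (x i) > B"
    then obtain i where i: "i \<ge> 1" "mat_norm (x i) > exp T" by blast
    then have "ln (exp T) < lnorm (x i)" using N[OF i(1)] by (subst ln_less_cancel_iff) auto
    then have "T < lnorm (x i)" by simp
    then show "\<exists>i\<ge>1. lnorm (x i) > T" using i by blast
  next
    fix B assume "\<forall>T. \<exists>i\<ge>1. lnorm (x i) > T"
    then obtain i where i: "i \<ge> 1" "lnorm (x i) > ln (\<bar>B\<bar> + 1)" by blast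
    then have "\<bar>B\<bar> + 1 < mat_norm (x i)" using N[OF i(1)] by (simp add: ln_less_cancel_iff)
    then show "\<exists>i\<ge>1. mat_norm (x i) > B" using i by (intro exI[of _ i]) simp
  qed
  have N0: "mat_norm (x i) \<noteq> 0" if "i \<ge> 1" for i using N[OF that] by simp
  have 2: "comparable (\<lambda>i. mat_norm (x (Suc i))) (\<lambda>i. mat_norm (x i) powr golden) \<longleftrightarrow>
      (\<exists>B. \<forall>i\<ge>1. \<bar>lnorm (x (Suc i)) - golden * lnorm (x i)\<bar> \<le> B)"
    using N by (subst comparable_iff_ln) (auto simp: ln_powr N0)
  have 3: "comparable (\<lambda>i. err \<xi> (x i)) (\<lambda>i. 1 / mat_norm (x i)) \<longleftrightarrow>
      (\<exists>B. \<forall>i\<ge>1. \<bar>lnorm (x i) + ln (err \<xi> (x i))\<bar> \<le> B)"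
  proof (subst comparable_iff_ln)
    have "ln (err \<xi> (x i)) - ln (1 / mat_norm (x i)) = lnorm (x i) + ln (err \<xi> (x i))"
      if "i \<ge> 1" for i using N[OF that] by (simp add: ln_div)
    then show "(\<exists>B. \<forall>i\<ge>1. \<bar>ln (err \<xi> (x i)) - ln (1 / mat_norm (x i))\<bar> \<le> B) \<longleftrightarrow>
      (\<exists>B. \<forall>i\<ge>1. \<bar>lnorm (x i) + ln (err \<xi> (x i))\<bar> \<le> B)"
      by (simp only: cong: imp_cong)
  qed (use N D in simp_all)
  have 4: "comparable (\<lambda>i. \<bar>real_of_int (det (x i))\<bar>) (\<lambda>i. 1)"
    if c: "comparable (\<lambda>i. err \<xi> (x i)) (\<lambda>i. 1 / mat_norm (x i))"
  proof -
    obtain c2 where c2: "c2 > 0" "\<And>i. i \<ge> 1 \<Longrightarrow> err \<xi> (x i) \<le> c2 * (1 / mat_norm (x i))"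
      using c unfolding comparable_def by blast
    show ?thesis
    proof (rule comparableI[of 1 "2 * c2"])
      fix i :: nat assume i: "i \<ge> 1"
      show "1 * 1 \<le> \<bar>real_of_int (det (x i))\<bar>" using prim_det[OF x(1)[OF i]] by simp
      have "mat_norm (x i) * err \<xi> (x i) \<le> c2" using c2(2)[OF i] N[OF i] by (simp add: field_simps)
      then show "\<bar>real_of_int (det (x i))\<bar> \<le> 2 * c2 * 1" using abs_det_le[OF refl x(2)[OF i], of \<xi>] by simp
    qed (use c2 in simp_all)
  qed
  show ?thesis
    unfolding approximating_sequence_def err_def[symmetric] 1 2[symmetric] 3[symmetric] using 4 True by blast
qed (auto simp: approximating_sequence_def)

lemma associated_matrix_iff:
  assumes "\<xi> \<notin> \<rat>"
  shows "associated_matrix \<xi> M \<longleftrightarrow> M \<in> prim_matrices \<and> transpose M \<noteq> M \<and> transpose M \<noteq> - M \<and>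
     (\<exists>x. approximating_sequence \<xi> x \<and> (\<exists>i0\<ge>1. \<forall>i\<ge>i0. x (i + 2) \<simeq> x (i + 1) ** (if odd i then M else transpose M) ** x i))"
proof -
  have "(\<forall>\<^sub>F i in sequentially. let y = x (i + 1) \<star> (if odd i then M else transpose M) \<star> x i
           in x (i + 2) = y \<or> x (i + 2) = - y) \<longleftrightarrow>
      (\<exists>i0\<ge>1. \<forall>i\<ge>i0. x (i + 2) \<simeq> x (i + 1) ** (if odd i then M else transpose M) ** x i)" (is "?l \<longleftrightarrow> ?r")
    if M: "M \<in> prim_matrices" and x: "approximating_sequence \<xi> x" for x
  proof -
    have p: "x i \<in> prim_matrices" if "i \<ge> 1" for i
      using x that unfolding approx_seq_iff[OF assms] by blast
    have e: "(let y = x (i + 1) \<star> (if odd i then M else transpose M) \<star> x i in x (i + 2) = y \<or> x (i + 2) = - y) \<longleftrightarrow>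
      x (i + 2) \<simeq> x (i + 1) ** (if odd i then M else transpose M) ** x i" if "i \<ge> 1" for i
      unfolding Let_def using that M prim_transpose[OF M] by (intro prim_mult3_iff p) auto
    have "?l \<longleftrightarrow> (\<forall>\<^sub>F i in sequentially. i \<ge> 1 \<longrightarrow> x (i + 2) \<simeq> x (i + 1) ** (if odd i then M else transpose M) ** x i)"
      by (rule eventually_cong[OF eventually_ge_at_top[of 1]]) (use e in blast)
    also have "\<dots> \<longleftrightarrow> ?r"
    proof
      assume "\<forall>\<^sub>F i in sequentially. i \<ge> 1 \<longrightarrow> x (i + 2) \<simeq> x (i + 1) ** (if odd i then M else transpose M) ** x i"
      then obtain i0 where "\<forall>i\<ge>i0. i \<ge> 1 \<longrightarrow> x (i + 2) \<simeq> x (i + 1) ** (if odd i then M else transpose M) ** x i"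
        unfolding eventually_sequentially by blast
      then show ?r by (intro exI[of _ "max 1 i0"]) auto
    next
      assume ?r
      then show "\<forall>\<^sub>F i in sequentially. i \<ge> 1 \<longrightarrow> x (i + 2) \<simeq> x (i + 1) ** (if odd i then M else transpose M) ** x i"
        unfolding eventually_sequentially by blast
    qed
    finally show ?thesis .
  qed
  then show ?thesis unfolding associated_matrix_def by blast
qed

text \<open>A term t \<ge> 2 B is followed by one of at least (3/2) t - B \<ge> t, so a single large
  term keeps all later ones large.\<close>

lemma approx_seq_at_top:
  assumes "\<xi> \<notin> \<rat>" "approximating_sequence \<xi> x"
  shows "\<exists>i0. \<forall>i\<ge>i0. lnorm (x i) \<ge> T"
proof -
  have x: "x i \<in> prim_matrices" if "i \<ge> 1" for i
    using assms(2) that unfolding approx_seq_iff[OF assms(1)] by blast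
  obtain B where B: "\<And>i. i \<ge> 1 \<Longrightarrow> \<bar>lnorm (x (Suc i)) - golden * lnorm (x i)\<bar> \<le> B"
    using assms(2) unfolding approx_seq_iff[OF assms(1)] by blast
  define U where "U = max T (2 * B)"
  obtain i0 where i0: "i0 \<ge> 1" "lnorm (x i0) > U"
    using assms(2) unfolding approx_seq_iff[OF assms(1)] by blast
  have "lnorm (x i) \<ge> U" if "i \<ge> i0" for i
    using that
  proof (induction i rule: dec_induct)
    case base
    show ?case using i0(2) by simp
  next
    case (step i)
    define t where "t = lnorm (x i)"
    have i1: "i \<ge> 1" using step i0 by simp
    have "t \<ge> 0" unfolding t_def using mat_norm_ge1[OF prim_nonzero[OF x[OF i1]]] by simp
    then have "(3/2) * t \<le> golden * t" using golden by (intro mult_right_mono) auto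
    moreover have "golden * t - B \<le> lnorm (x (Suc i))" using B[OF i1] unfolding t_def by linarith
    moreover have "t \<ge> U" using step.IH unfolding t_def .
    moreover have "U \<ge> 2 * B" by (simp add: U_def)
    ultimately show ?case by linarith
  qed
  then show ?thesis unfolding U_def by (intro exI[of _ i0]) auto
qed

context principal_sequence
begin

lemma link_transpose_parity:
  assumes "\<And>k. k \<ge> k0 \<Longrightarrow> link (Suc k) \<simeq> transpose (link k)" "k \<ge> k0"
  shows "link (k + j) \<simeq> (if even j then link k else transpose (link k))"
proof (induction j)
  case (Suc j)
  have "link (k + Suc j) \<simeq> transpose (link (k + j))" using assms(1)[of "k + j"] assms(2) by simp
  also have "\<dots> \<simeq> transpose (if even j then link k else transpose (link k))"
    by (rule prop_transpose[OF Suc])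
  also have "\<dots> = (if even (Suc j) then link k else transpose (link k))" by simp
  finally show ?case .
qed simp

lemma approximating_sequence_tail: "approximating_sequence \<xi> (\<lambda>i. y (k + i))"
  unfolding approx_seq_iff[OF irrational]
proof (intro conjI allI)
  fix T
  obtain k0 where k0: "\<And>k. k \<ge> k0 \<Longrightarrow> n k \<ge> T + 1" using n_large by blast
  have "n (k + Suc k0) \<ge> T + 1" by (rule k0) simp
  then show "\<exists>i\<ge>1. T < lnorm (y (k + i))"
    unfolding n_def by (intro exI[of _ "Suc k0"]) auto
qed (use prim sym growth[of "k + _"] error[of "k + _"] in \<open>auto intro!: exI[of _ C]\<close>)

lemma associated_matrix_exists: "\<exists>M. associated_matrix \<xi> M"
proof -
  obtain k1 where k1: "\<And>k. k \<ge> k1 \<Longrightarrow> link (Suc k) \<simeq> transpose (link k)" using link_transpose by blast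
  obtain k2 where k2: "\<And>k M. k \<ge> k2 \<Longrightarrow> M \<simeq> link k \<Longrightarrow> transpose M \<noteq> - M" using link_not_skew by blast
  define k where "k = max k1 k2"
  \<comment> \<open>The sequence will be x(i) = y(k+i), whose first odd index is 1; starting from
    \<open>link (k + 1)\<close> puts odd i at an even distance.\<close>
  obtain M where M: "M \<in> prim_matrices" "M \<simeq> link (k + 1)" using prim_part_exists[OF link_det] by blast
  have "transpose M \<noteq> M"
  proof
    assume "transpose M = M"
    then have e: "M$2$1 = M$1$2" by (simp add: symmetric_iff)
    obtain s t where st: "t \<noteq> 0" "smul s M = smul t (link (k + 1))" using M(2) unfolding proportional_def by blast
    have "t * link (k + 1) $ i $ j = s * M $ i $ j" for i j using arg_cong[OF st(2), of "\<lambda>A. A$i$j"] by simp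
    from this[of 1 2] this[of 2 1] have "link (k + 1) $ 2 $ 1 = link (k + 1) $ 1 $ 2"
      using st(1) e by (metis mult_left_cancel)
    then show False using link_not_symmetric[of "k + 1"] by (simp add: symmetric_iff)
  qed
  moreover have "transpose M \<noteq> - M" by (rule k2[OF _ M(2)]) (simp add: k_def)
  moreover have "y (k + (i + 2)) \<simeq> y (k + (i + 1)) ** (if odd i then M else transpose M) ** y (k + i)"
    if i1: "i \<ge> 1" for i
  proof -
    obtain j where j: "i = Suc j" using i1 by (cases i) auto
    have "link (k + 1 + j) \<simeq> (if even j then link (k + 1) else transpose (link (k + 1)))"
      by (rule link_transpose_parity[of k1, OF k1]) (auto simp: k_def)
    also have "\<dots> \<simeq> (if odd i then M else transpose M)"
      using prop_sym[OF M(2)] prop_transpose by (auto simp: j)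
    finally have 1: "link (k + i) \<simeq> (if odd i then M else transpose M)" by (simp add: j)
    have "y (k + i + 2) \<simeq> y (k + i + 1) ** link (k + i) ** y (k + i)" by (rule link_recurrence)
    also have "\<dots> \<simeq> y (k + i + 1) ** (if odd i then M else transpose M) ** y (k + i)"
      by (intro prop_left prop_right 1)
    finally show ?thesis by (simp add: add.assoc)
  qed
  ultimately show ?thesis
    unfolding associated_matrix_iff[OF irrational] using M(1) approximating_sequence_tail[of k] by blast
qed

lemma n_proportional: "w \<in> prim_matrices \<Longrightarrow> w \<simeq> y k \<Longrightarrow> lnorm w = n k"
  unfolding n_def using prim_proportional_eq[OF _ prim, of w k] by (auto simp: mat_norm_uminus)

text \<open>Each late x(i) is captured as some y(k). The indices advance in step because logarithmic
  norms of distinct late y differ by more than B + C, while growth locates that of x(i+1) within B +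
  C.\<close>

lemma approximating_sequence_shift:
  assumes "approximating_sequence \<xi> x"
  shows "\<exists>i0. \<forall>i\<ge>i0. \<exists>k\<ge>K. x i \<simeq> y k \<and> x (i + 1) \<simeq> y (k + 1) \<and> x (i + 2) \<simeq> y (k + 2)"
proof -
  have x: "x i \<in> prim_matrices" "symmetric (x i)" if "i \<ge> 1" for i
    using assms that unfolding approx_seq_iff[OF irrational] by auto
  obtain B1 B2 where B1: "\<And>i. i \<ge> 1 \<Longrightarrow> \<bar>lnorm (x (Suc i)) - golden * lnorm (x i)\<bar> \<le> B1"
    and B2: "\<And>i. i \<ge> 1 \<Longrightarrow> \<bar>lnorm (x i) + ln (err \<xi> (x i))\<bar> \<le> B2"
    using assms unfolding approx_seq_iff[OF irrational] by blast
  define B where "B = max B1 B2"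
  have B: "\<bar>lnorm (x (Suc i)) - golden * lnorm (x i)\<bar> \<le> B"
    "lnorm (x i) + ln (err \<xi> (x i)) \<le> B" if "i \<ge> 1" for i
    using B1[OF that] B2[OF that] unfolding B_def by auto
  obtain K1 where K1: "\<And>k. k \<ge> K1 \<Longrightarrow> n k + (B + C + 1) \<le> n (Suc k)" using n_gap by blast
  define K2 where "K2 = max K K1"
  obtain T where T: "\<And>w. symmetric w \<Longrightarrow> w \<noteq> 0 \<Longrightarrow> T \<le> lnorm w \<Longrightarrow>
     lnorm w + ln (err \<xi> w) \<le> B \<Longrightarrow> \<exists>k\<ge>K2. w \<simeq> y k" using capture_any by blast
  obtain i0 where i0: "\<And>i. i \<ge> i0 \<Longrightarrow> lnorm (x i) \<ge> T"
    using approx_seq_at_top[OF irrational assms] by blast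
  have B0: "B \<ge> 0" using B(1)[of 1] by simp
  have ex: "\<exists>k\<ge>K2. x i \<simeq> y k" if "i \<ge> max i0 1" for i
    using T[of "x i"] x[of i] prim_nonzero B(2)[of i] i0[of i] that by auto
  have incr: "n j + (B + C + 1) \<le> n k" if "K2 \<le> j" "j < k" for j k
  proof -
    have "n (Suc j) \<le> n k" using that(2)[THEN Suc_leI]
    proof (induction k rule: dec_induct)
      case (step l)
      then show ?case using K1[of l] that(1) B0 C_nonneg by (simp add: K2_def)
    qed simp
    then show ?thesis using K1[of j] that(1) by (simp add: K2_def)
  qed
  have next_step: "x (Suc i) \<simeq> y (Suc k)" if i: "i \<ge> max i0 1" and k: "k \<ge> K2" "x i \<simeq> y k" for i k
  proof -
    obtain k' where k': "k' \<ge> K2" "x (Suc i) \<simeq> y k'" using ex[of "Suc i"] i by auto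
    have e: "lnorm (x i) = n k" "lnorm (x (Suc i)) = n k'"
      using n_proportional x(1) i k k' by auto
    have close: "\<bar>n k' - n (Suc k)\<bar> \<le> B + C"
      using B(1)[of i] i growth_n[of k] unfolding e by auto
    have "k' = Suc k"
    proof (rule ccontr)
      assume "k' \<noteq> Suc k"
      then consider "k' < Suc k" | "Suc k < k'" by linarith
      then show False using incr[of k' "Suc k"] incr[of "Suc k" k'] k(1) k'(1) close by cases auto
    qed
    then show ?thesis using k' by simp
  qed
  have "\<exists>k\<ge>K. x i \<simeq> y k \<and> x (i + 1) \<simeq> y (k + 1) \<and> x (i + 2) \<simeq> y (k + 2)" if i: "i \<ge> max i0 1" for i
  proof -
    obtain k where k: "k \<ge> K2" "x i \<simeq> y k" using ex[OF i] by blast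
    have 1: "x (Suc i) \<simeq> y (Suc k)" by (rule next_step[OF i k])
    have "x (Suc (Suc i)) \<simeq> y (Suc (Suc k))" by (rule next_step[OF _ _ 1]) (use i k in auto)
    then show ?thesis using 1 k by (intro exI[of _ k]) (simp add: K2_def)
  qed
  then show ?thesis by blast
qed

lemma associated_matrix_link:
  assumes "associated_matrix \<xi> M"
  shows "\<exists>k\<ge>K. M \<simeq> link k"
proof -
  obtain x i1 where x: "approximating_sequence \<xi> x" and
    i1: "\<And>i. i \<ge> i1 \<Longrightarrow> x (i + 2) \<simeq> x (i + 1) ** (if odd i then M else transpose M) ** x i"
    using assms unfolding associated_matrix_iff[OF irrational] by blast
  obtain i0 where i0: "\<And>i. i \<ge> i0 \<Longrightarrow> \<exists>k\<ge>K. x i \<simeq> y k \<and> x (i + 1) \<simeq> y (k + 1) \<and> x (i + 2) \<simeq> y (k + 2)"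
    using approximating_sequence_shift[OF x] by blast
  \<comment> \<open>Large and odd, so that the recurrence involves \<open>M\<close> rather than its
    transpose.\<close>
  define i where "i = 2 * (i0 + i1) + 1"
  have i: "odd i" "i \<ge> i0" "i \<ge> i1" by (auto simp: i_def)
  obtain k where k: "k \<ge> K" "x i \<simeq> y k" "x (i + 1) \<simeq> y (k + 1)" "x (i + 2) \<simeq> y (k + 2)"
    using i0[OF i(2)] by blast
  have "x (i + 2) \<simeq> x (i + 1) ** M ** x i" using i1[OF i(3)] i(1) by simp
  also have "\<dots> \<simeq> y (k + 1) ** M ** y k" using k by (intro prop_mult) auto
  finally have "y (k + 2) \<simeq> y (k + 1) ** M ** y k" using k(4) prop_sym prop_trans by blast
  then show ?thesis using link_unique k(1) by blast
qed

text \<open>Both matrices are links of the same sequence, and late links at distance j differ by j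
  transpositions.\<close>

lemma associated_matrix_unique:
  assumes "associated_matrix \<xi> M" "associated_matrix \<xi> M'"
  shows "M' \<simeq> M \<or> M' \<simeq> transpose M"
proof -
  obtain k0 where k0: "\<And>k. k \<ge> k0 \<Longrightarrow> link (Suc k) \<simeq> transpose (link k)" using link_transpose by blast
  obtain k where k: "k \<ge> k0" "M \<simeq> link k" using associated_matrix_link[OF assms(1)] by blast
  obtain k' where k': "k' \<ge> k" "M' \<simeq> link k'" using associated_matrix_link[OF assms(2)] by blast
  have "link k' \<simeq> (if even (k' - k) then link k else transpose (link k))"
    using link_transpose_parity[OF k0 k(1), of "k' - k"] k'(1) by simp
  from prop_trans[OF k'(2) this]
  show ?thesis
    using prop_trans[OF _ prop_sym[OF k(2)], of M']
      prop_trans[OF _ prop_sym[OF prop_transpose[OF k(2)]], of M']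
    by (auto split: if_splits)
qed

end

lemma extremal_matrix_associated:
  assumes "extremal \<xi>" shows "associated_matrix \<xi> (extremal_matrix \<xi>)"
proof -
  obtain y C where "principal_sequence \<xi> y C" using extremal_imp_principal_sequence[OF assms] by blast
  then show ?thesis
    unfolding extremal_matrix_def by (intro someI_ex[of "associated_matrix \<xi>"] principal_sequence.associated_matrix_exists)
qed

lemma associated_matrix_proportional:
  assumes "extremal \<xi>" "associated_matrix \<xi> M"
  shows "extremal_matrix \<xi> \<simeq> M \<or> extremal_matrix \<xi> \<simeq> transpose M"
proof -
  obtain y C where "principal_sequence \<xi> y C" using extremal_imp_principal_sequence[OF assms(1)] by blast
  then show ?thesis
    using principal_sequence.associated_matrix_unique[OF _ assms(2) extremal_matrix_associated[OF assms(1)]] by blast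
qed

section \<open>The action of the modular group\<close>

lemma invertible_int_iff: "invertible (A :: int^2^2) \<longleftrightarrow> \<bar>det A\<bar> = 1"
proof
  assume "invertible A"
  then obtain B where "A ** B = mat 1" unfolding invertible_def by blast
  then have "det A * det B = 1" by (metis det_I det_mul)
  then show "\<bar>det A\<bar> = 1" by (metis abs_mult abs_one zmult_eq_1_iff abs_ge_zero abs_zmult_eq_1)
next
  assume "\<bar>det A\<bar> = 1"
  then have "det A * det A = 1" by (metis abs_mult_self_eq mult_1)
  then have "A ** smul (det A) (adj A) = mat 1" "smul (det A) (adj A) ** A = mat 1"
    by (simp_all add: smul_mult adj_mult smul_smul)
  then show "invertible A" unfolding invertible_def by blast
qed

lemma invertible_inverse_int:
  assumes "invertible (A :: int^2^2)"
  obtains B where "invertible B" "A ** B = mat 1" "B ** A = mat 1" "B = adj A \<or> B = - adj A"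
proof -
  have d: "det A = 1 \<or> det A = -1" using assms invertible_int_iff by auto
  define B where "B = smul (det A) (adj A)"
  have "A ** B = mat 1" "B ** A = mat 1" using d unfolding B_def by (auto simp: smul_mult adj_mult smul_smul)
  moreover have "invertible B" using calculation unfolding invertible_def by blast
  moreover have "B = adj A \<or> B = - adj A" using d unfolding B_def by (auto simp: mat_eq_iff2)
  ultimately show ?thesis using that by blast
qed

lemma moebius_denominator:
  fixes x :: real and A :: "int^2^2"
  assumes "x \<notin> \<rat>" "det A \<noteq> 0"
  shows "A$2$1 * x + A$2$2 \<noteq> 0"
  using linear_irrational_nonzero[OF assms(1), of "A$2$1" "A$2$2"] assms(2) by (auto simp: det_2)

lemma moebius_irrational:
  fixes x :: real
  assumes "x \<notin> \<rat>" "det A \<noteq> 0"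
  shows "moebius A x \<notin> \<rat>"
proof
  assume "moebius A x \<in> \<rat>"
  then obtain p q where "q > 0" and e: "moebius A x = real_of_int p / real_of_int q"
    by (rule Rats_cases')
  then have pq: "q \<noteq> 0" by simp
  have "real_of_int (q * A$1$1 - p * A$2$1) * x + real_of_int (q * A$1$2 - p * A$2$2) = 0"
    using pq e moebius_denominator[OF assms] unfolding moebius_def by (simp add: field_simps)
  then have "q * A$1$1 = p * A$2$1" "q * A$1$2 = p * A$2$2"
    using linear_irrational_nonzero[OF assms(1)] by fastforce+
  then have "q * det A = 0" unfolding det_2 by algebra
  then show False using pq assms(2) by simp
qed

lemma moebius_mult:
  fixes x :: real
  assumes "x \<notin> \<rat>" "det A \<noteq> 0" "det B \<noteq> 0"
  shows "moebius (A ** B) x = moebius A (moebius B x)"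
proof -
  define p where "p = B$1$1 * x + B$1$2"
  define q where "q = B$2$1 * x + B$2$2"
  have q: "q \<noteq> 0" unfolding q_def by (rule moebius_denominator[OF assms(1,3)])
  have "moebius (A ** B) x = (A$1$1 * p + A$1$2 * q) / (A$2$1 * p + A$2$2 * q)"
    unfolding moebius_def p_def q_def by (simp add: mult_nth2 algebra_simps)
  also have "\<dots> = (A$1$1 * (p / q) + A$1$2) / (A$2$1 * (p / q) + A$2$2)"
  proof -
    have "A$1$1 * p + A$1$2 * q = q * (A$1$1 * (p / q) + A$1$2)" "A$2$1 * p + A$2$2 * q = q * (A$2$1 * (p / q) + A$2$2)"
      using q by (simp_all add: algebra_simps)
    then show ?thesis using q by simp
  qed
  finally show ?thesis unfolding moebius_def p_def q_def .
qed

lemma moebius_one: "moebius (mat 1) x = x"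
  by (simp add: moebius_def)

lemma det_ne0: "invertible (A :: int^2^2) \<Longrightarrow> det A \<noteq> 0"
  using invertible_int_iff[of A] by auto

text \<open>If x approximates the matrix with entries 1, \<xi>, \<xi>^2 projectively, then the symmetric matrix
  below does the same for the image of \<xi> under A; the swap of the two coordinates comes from (\<xi>, 1)
  being the vector on which A acts, as opposed to (1, \<xi>).\<close>

definition coord_swap :: "int^2^2 \<Rightarrow> int^2^2" where
  "coord_swap A = mat2 (A$2$2) (A$2$1) (A$1$2) (A$1$1)"

definition congruence :: "int^2^2 \<Rightarrow> int^2^2 \<Rightarrow> int^2^2" where
  "congruence A x = coord_swap A ** x ** transpose (coord_swap A)"

lemma coord_swap_mult: "coord_swap (A ** B) = coord_swap A ** coord_swap B"
  by (simp add: coord_swap_def mat_eq_iff2 mult_nth2 algebra_simps)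

lemma coord_swap_one: "coord_swap (mat 1) = mat 1"
  by (simp add: coord_swap_def mat_eq_iff2)

lemma congruence_mult: "congruence (A ** B) x = congruence A (congruence B x)"
  by (simp add: congruence_def coord_swap_mult matrix_transpose_mul matrix_mul_assoc)

lemma congruence_one: "congruence (mat 1) x = x"
  by (simp add: congruence_def coord_swap_one transpose_mat)

lemma congruence_symmetric: "symmetric x \<Longrightarrow> symmetric (congruence A x)"
  by (simp add: congruence_def matrix_transpose_mul matrix_mul_assoc)

lemma det_coord_swap: "det (coord_swap A) = det A"
  by (simp add: coord_swap_def det_2)

lemma det_congruence: "invertible A \<Longrightarrow> det (congruence A x) = det x"
  using invertible_int_iff[of A]
  by (auto simp: congruence_def det_mul det_coord_swap abs_if split: if_splits)

lemma content_dvd_mult: "content x dvd content (P ** x ** Q)"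
proof (rule content_greatest)
  fix i j
  have "content x dvd (P ** x) $ i $ l" for l
    unfolding mult_nth2 by (intro dvd_add dvd_mult content_dvd)
  then show "content x dvd (P ** x ** Q) $ i $ j" unfolding mult_nth2[of "P ** x"] by (intro dvd_add dvd_mult2)
qed

lemma congruence_inverse:
  assumes "A ** B = mat 1"
  shows "congruence A (congruence B x) = x"
  using congruence_mult[of A B x] by (simp add: assms congruence_one)

lemma congruence_prim:
  assumes "invertible A" "x \<in> prim_matrices" shows "congruence A x \<in> prim_matrices"
proof -
  obtain B where B: "B ** A = mat 1" using invertible_inverse_int[OF assms(1)] by blast
  have "content (congruence A x) dvd content (congruence B (congruence A x))"
    unfolding congruence_def[of B] by (rule content_dvd_mult)
  then have "content (congruence A x) dvd 1"
    using congruence_inverse[OF B, of x] prim_content[OF assms(2)] by simp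
  then have "content (congruence A x) = 1" using content_nonneg[of "congruence A x"] by simp
  then show ?thesis using assms det_congruence[OF assms(1), of x] by (simp add: prim_matrices_def)
qed

text \<open>Since (z, -1) times \<open>coord_swap A\<close> is r times (x, -1), the error row of the
  image is the old one multiplied by a fixed matrix.\<close>

lemma congruence_error:
  fixes x z r :: real
  assumes "x \<notin> \<rat>" "det A \<noteq> 0" "symmetric w"
  defines "z \<equiv> moebius A x" and "r \<equiv> det A / (A$2$1 * x + A$2$2)"
  shows "z * congruence A w $ 1 $ j - congruence A w $ 2 $ j =
    r * (\<Sum>l\<in>UNIV. (x * w$1$l - w$2$l) * coord_swap A $ j $ l)"
proof -
  let ?T = "coord_swap A"
  have q: "A$2$1 * x + A$2$2 \<noteq> 0" by (rule moebius_denominator[OF assms(1,2)])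
  have 1: "z * ?T$1$1 - ?T$2$1 = r * x" "z * ?T$1$2 - ?T$2$2 = - r"
    using q unfolding z_def r_def moebius_def coord_swap_def by (simp_all add: det_2 field_simps)
  have "z * congruence A w $ 1 $ j - congruence A w $ 2 $ j =
     (\<Sum>l\<in>UNIV. ((z * ?T$1$1 - ?T$2$1) * w$1$l + (z * ?T$1$2 - ?T$2$2) * w$2$l) * ?T$j$l)"
    by (simp add: congruence_def mult_nth2 sum_2 algebra_simps)
  also have "\<dots> = r * (\<Sum>l\<in>UNIV. (x * w$1$l - w$2$l) * ?T$j$l)"
    unfolding 1 by (simp add: sum_2 algebra_simps)
  finally show ?thesis .
qed

lemma congruence_bounds:
  fixes x :: real
  assumes "x \<notin> \<rat>" "invertible A"
  obtains k where "k > 0" "\<And>w. mat_norm (congruence A w) \<le> k * mat_norm w"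
    "\<And>w. symmetric w \<Longrightarrow> err (moebius A x) (congruence A w) \<le> k * err x w"
proof -
  let ?T = "coord_swap A"
  define t where "t = mat_norm ?T"
  define r where "r = \<bar>det A / (A$2$1 * x + A$2$2)\<bar>"
  have dA: "det A \<noteq> 0" by (rule det_ne0[OF assms(2)])
  have t: "t \<ge> 0" unfolding t_def by (rule mat_norm_nonneg)
  have T: "\<bar>real_of_int (?T$i$j)\<bar> \<le> t" for i j unfolding t_def by (rule abs_nth_le_mat_norm)
  define k where "k = 4 * t * t + r * (2 * t) + 1"
  have r0: "r \<ge> 0" by (simp add: r_def)
  have kpos: "4 * t * t \<ge> 0" "r * (2 * t) \<ge> 0" using t r0 by simp_all
  have prod: "\<bar>a * b\<bar> \<le> p * q" if "\<bar>a\<bar> \<le> p" "\<bar>b\<bar> \<le> q" for a b p q :: real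
    unfolding abs_mult using that by (intro mult_mono) auto
  have N: "mat_norm (congruence A w) \<le> k * mat_norm w" for w
  proof -
    define N where "N = mat_norm w"
    have N0: "N \<ge> 0" unfolding N_def by (rule mat_norm_nonneg)
    have w: "\<bar>real_of_int (w$i$j)\<bar> \<le> N" for i j unfolding N_def by (rule abs_nth_le_mat_norm)
    have 1: "\<bar>real_of_int ((?T ** w)$i$j)\<bar> \<le> 2 * (t * N)" for i j
      using prod[OF T[of i 1] w[of 1 j]] prod[OF T[of i 2] w[of 2 j]] by (simp add: mult_nth2)
    have "mat_norm (congruence A w) \<le> 2 * (2 * (t * N) * t)"
    proof (rule mat_norm_le)
      fix i j
      show "\<bar>real_of_int (congruence A w $ i $ j)\<bar> \<le> 2 * (2 * (t * N) * t)"
        unfolding congruence_def mult_nth2[of "?T ** w"] transpose_nth2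
        using prod[OF 1[of i 1] T[of j 1]] prod[OF 1[of i 2] T[of j 2]] by simp
    qed
    also have "\<dots> = (4 * t * t) * N" by simp
    also have "\<dots> \<le> k * N" unfolding k_def using N0 kpos by (intro mult_right_mono) auto
    finally show ?thesis unfolding N_def .
  qed
  have D: "err (moebius A x) (congruence A w) \<le> k * err x w" if s: "symmetric w" for w
  proof -
    define e where "e = err x w"
    have e: "\<bar>x * w$1$1 - w$2$1\<bar> \<le> e" "\<bar>x * w$1$2 - w$2$2\<bar> \<le> e" unfolding e_def err_eq by simp_all
    have e0: "e \<ge> 0" using e(1) by linarith
    have "\<bar>moebius A x * congruence A w $ 1 $ j - congruence A w $ 2 $ j\<bar> \<le> r * (2 * (e * t))" for j
    proof -
      have "\<bar>\<Sum>l\<in>UNIV. (x * w$1$l - w$2$l) * ?T $ j $ l\<bar> \<le> 2 * (e * t)"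
        unfolding sum_2 using prod[OF e(1) T[of j 1]] prod[OF e(2) T[of j 2]] by linarith
      then show ?thesis
        unfolding congruence_error[OF assms(1) dA s] abs_mult r_def by (intro mult_left_mono) auto
    qed
    then have "err (moebius A x) (congruence A w) \<le> r * (2 * (e * t))"
      unfolding err_eq by simp
    also have "\<dots> = r * (2 * t) * e" by simp
    also have "\<dots> \<le> k * e" unfolding k_def using e0 kpos by (intro mult_right_mono) auto
    finally show ?thesis unfolding e_def .
  qed
  have "k > 0" using kpos unfolding k_def by linarith
  then show ?thesis using that N D by blast
qed

lemma congruence_nonzero: "invertible A \<Longrightarrow> w \<noteq> 0 \<Longrightarrow> congruence A w \<noteq> 0"
proof
  assume A: "invertible A" "w \<noteq> 0" "congruence A w = 0"
  obtain B where B: "B ** A = mat 1" using invertible_inverse_int[OF A(1)] by blast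
  have "congruence B 0 = 0" by (simp add: congruence_def mat_eq_iff2 mult_nth2)
  then show False using congruence_inverse[OF B, of w] A by simp
qed

lemma moebius_not_quadratic:
  fixes x :: real
  assumes "x \<notin> \<rat>" "\<not> quadratic_number x" "det A \<noteq> 0"
  shows "\<not> quadratic_number (moebius A x)"
proof
  assume "quadratic_number (moebius A x)"
  then obtain p q r where pqr: "p \<in> \<rat>" "q \<in> \<rat>" "r \<in> \<rat>" "p \<noteq> 0"
    "p * (moebius A x)^2 + q * moebius A x + r = 0" unfolding quadratic_number_def by blast
  define a b c d where "a = real_of_int (A$1$1)" and "b = real_of_int (A$1$2)"
    and "c = real_of_int (A$2$1)" and "d = real_of_int (A$2$2)"
  have rat: "a \<in> \<rat>" "b \<in> \<rat>" "c \<in> \<rat>" "d \<in> \<rat>" unfolding a_def b_def c_def d_def by simp_all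
  have dn: "c * x + d \<noteq> 0" unfolding c_def d_def by (rule moebius_denominator[OF assms(1,3)])
  have z: "moebius A x * (c * x + d) = a * x + b" using dn unfolding moebius_def a_def b_def c_def d_def by simp
  define P Q R where "P = p * a^2 + q * a * c + r * c^2"
    and "Q = 2 * p * a * b + q * (a * d + b * c) + 2 * r * c * d"
    and "R = p * b^2 + q * b * d + r * d^2"
  have "p * (moebius A x * (c * x + d))^2 + q * (moebius A x * (c * x + d)) * (c * x + d) + r * (c * x + d)^2 = 0"
    using pqr(5) by algebra
  then have eq: "P * x^2 + Q * x + R = 0" unfolding z P_def Q_def R_def by algebra
  have rat': "P \<in> \<rat>" "Q \<in> \<rat>" "R \<in> \<rat>"
    unfolding P_def Q_def R_def using rat pqr(1-3) by (auto intro!: Rats_add Rats_mult Rats_power)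
  have P: "P = 0" using assms(1,2) eq rat' unfolding quadratic_number_def by blast
  have Q: "Q = 0"
  proof (rule ccontr)
    assume "Q \<noteq> 0"
    then have "x = - R / Q" using eq P by (simp add: field_simps)
    then show False using assms(1) rat' by simp
  qed
  have R: "R = 0" using eq P Q by simp
  \<comment> \<open>The transformed quadratic form, evaluated at (d, -c), returns p times the
    squared determinant.\<close>
  have "p * (a * d - b * c)^2 = P * d^2 - Q * c * d + R * c^2"
    unfolding P_def Q_def R_def by algebra
  then have "a * d - b * c = 0" using P Q R pqr(4) by simp
  then have "real_of_int (det A) = 0" unfolding det_2 a_def b_def c_def d_def by simp
  then show False using assms(3) by simp
qed

lemma extremal_moebius:
  assumes "extremal x" "invertible A"
  shows "extremal (moebius A x)"
proof -
  have x: "x \<notin> \<rat>" "\<not> quadratic_number x" "approximable x" using assms(1) extremal_iff by auto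
  have dA: "det A \<noteq> 0" by (rule det_ne0[OF assms(2)])
  obtain c where c: "c > 0" and *: "\<And>X. X \<ge> 1 \<Longrightarrow> \<exists>w. approximates x X (c * X powr (- 1 / golden)) w"
    using x(3) unfolding approximable_def by blast
  obtain k where k: "k > 0" "\<And>w. mat_norm (congruence A w) \<le> k * mat_norm w"
    "\<And>w. symmetric w \<Longrightarrow> err (moebius A x) (congruence A w) \<le> k * err x w"
    using congruence_bounds[OF x(1) assms(2)] by blast
  have image: "approximates (moebius A x) (k * b) (k * e) (congruence A w)" if "approximates x b e w" for b e w
  proof -
    have w: "symmetric w" "w \<noteq> 0" "mat_norm w \<le> b" "err x w \<le> e" using that unfolding approximates_def by auto
    have "k * mat_norm w \<le> k * b" "k * err x w \<le> k * e" using w k(1) by simp_all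
    then show ?thesis
      using k(2)[of w] k(3)[OF w(1)] congruence_symmetric[OF w(1)] congruence_nonzero[OF assms(2) w(2)]
      unfolding approximates_def by (intro conjI) (assumption | linarith)+
  qed
  have "approximable (moebius A x)"
  proof (rule approximableI[of "k * c" _ k])
    fix X :: real assume "X \<ge> 1"
    then obtain w where "approximates x X (c * X powr (- 1 / golden)) w" using * by blast
    from image[OF this] show "\<exists>w. approximates (moebius A x) (k * X) (k * c * X powr (- 1 / golden)) w"
      unfolding mult.assoc by blast
  qed (use k c in simp)
  then show ?thesis
    unfolding extremal_iff using moebius_irrational[OF x(1) dA] moebius_not_quadratic[OF x(1,2) dA] by blast
qed

lemma ln_diff_le:
  assumes "u > 0" "v > 0" "k > 0" "l > 0" "u \<le> k * v" "v \<le> l * (u::real)"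
  shows "\<bar>ln u - ln v\<bar> \<le> \<bar>ln k\<bar> + \<bar>ln l\<bar>"
proof -
  have "ln u \<le> ln (k * v)" "ln v \<le> ln (l * u)" using assms by (auto intro!: ln_mono)
  then have "ln u \<le> ln k + ln v" "ln v \<le> ln l + ln u" using assms by (simp_all add: ln_mult)
  then show ?thesis by linarith
qed

text \<open>\<open>congruence_bounds\<close> for \<open>A\<close> and for its inverse shows that the
  logarithms of norm and error change by at most a constant, which the logarithmic form of the
  definition tolerates.\<close>

lemma approximating_sequence_congruence:
  fixes x :: real
  assumes "x \<notin> \<rat>" "invertible A" "approximating_sequence x s"
  shows "approximating_sequence (moebius A x) (\<lambda>i. congruence A (s i))"
proof -
  have dA: "det A \<noteq> 0" by (rule det_ne0[OF assms(2)])
  obtain B where B: "invertible B" "A ** B = mat 1" "B ** A = mat 1" using invertible_inverse_int[OF assms(2)] by blast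
  have dB: "det B \<noteq> 0" by (rule det_ne0[OF B(1)])
  define z where "z = moebius A x"
  have z: "z \<notin> \<rat>" unfolding z_def by (rule moebius_irrational[OF assms(1) dA])
  have Bz: "moebius B z = x" unfolding z_def by (simp add: moebius_mult[OF assms(1) dB dA, symmetric] B moebius_one)
  define t where "t i = congruence A (s i)" for i
  have st: "congruence B (t i) = s i" for i unfolding t_def by (rule congruence_inverse[OF B(3)])
  note iff = approx_seq_iff[OF assms(1)] approx_seq_iff[OF z]
  have s: "s i \<in> prim_matrices" "symmetric (s i)" if "i \<ge> 1" for i
    using assms(3) that unfolding iff by auto
  have t: "t i \<in> prim_matrices" "symmetric (t i)" if "i \<ge> 1" for i
    unfolding t_def using s[OF that] congruence_prim[OF assms(2)] congruence_symmetric by auto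
  obtain k where k: "k > 0" "\<And>w. mat_norm (congruence A w) \<le> k * mat_norm w"
    "\<And>w. symmetric w \<Longrightarrow> err z (congruence A w) \<le> k * err x w"
    using congruence_bounds[OF assms(1,2)] unfolding z_def by blast
  obtain l where l: "l > 0" "\<And>w. mat_norm (congruence B w) \<le> l * mat_norm w"
    "\<And>w. symmetric w \<Longrightarrow> err x (congruence B w) \<le> l * err z w"
    using congruence_bounds[OF z B(1)] unfolding Bz by blast
  define c where "c = \<bar>ln k\<bar> + \<bar>ln l\<bar>"
  define N N' D D' where "N i = lnorm (s i)" and "N' i = lnorm (t i)"
    and "D i = ln (err x (s i))" and "D' i = ln (err z (t i))" for i
  have N: "\<bar>N' i - N i\<bar> \<le> c" and D: "\<bar>D' i - D i\<bar> \<le> c" if "i \<ge> 1" for i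
  proof -
    note nz = prim_nonzero[OF s(1)[OF that]] prim_nonzero[OF t(1)[OF that]]
    show "\<bar>N' i - N i\<bar> \<le> c" unfolding c_def N_def N'_def
      by (rule ln_diff_le)
         (use mat_norm_ge1[OF nz(1)] mat_norm_ge1[OF nz(2)] k(1) k(2)[of "s i", folded t_def] l(1) l(2)[of "t i", unfolded st] in auto)
    show "\<bar>D' i - D i\<bar> \<le> c" unfolding c_def D_def D'_def
      by (rule ln_diff_le[OF err_pos[OF z nz(2)] err_pos[OF assms(1) nz(1)] k(1) l(1)])
         (use k(3)[OF s(2)[OF that], folded t_def] l(3)[OF t(2)[OF that], unfolded st] in auto)
  qed
  obtain B1 B2 where B1: "\<And>i. i \<ge> 1 \<Longrightarrow> \<bar>N (Suc i) - golden * N i\<bar> \<le> B1" and B2: "\<And>i. i \<ge> 1 \<Longrightarrow> \<bar>N i + D i\<bar> \<le> B2"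
    and unb: "\<And>T. \<exists>i\<ge>1. N i > T"
    using assms(3) unfolding iff N_def D_def by blast
  have 1: "\<bar>N' (Suc i) - golden * N' i\<bar> \<le> B1 + 3 * c" if "i \<ge> 1" for i
  proof -
    have "\<bar>golden * (N' i - N i)\<bar> \<le> 2 * c"
      unfolding abs_mult using golden N[OF that] by (intro mult_mono) auto
    then have "\<bar>golden * N' i - golden * N i\<bar> \<le> 2 * c" by (simp add: right_diff_distrib)
    then show ?thesis using B1[OF that] N[of "Suc i"] by linarith
  qed
  have 2: "\<bar>N' i + D' i\<bar> \<le> B2 + 2 * c" if "i \<ge> 1" for i
    using B2[OF that] N[OF that] D[OF that] by linarith
  have 3: "\<exists>i\<ge>1. N' i > T" for T
  proof -
    obtain i where i: "i \<ge> 1" "N i > T + c" using unb by blast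
    then show ?thesis using N[OF i(1)] by (intro exI[of _ i]) linarith
  qed
  have "approximating_sequence z t" unfolding iff using t 1 2 3 unfolding N'_def D'_def by blast
  then show ?thesis unfolding z_def t_def .
qed

text \<open>With T = \<open>coord_swap A\<close>, the images T x T^T satisfy the recurrence with
  \<open>M\<close> replaced by its congruence under T^(-1), and \<open>U\<close> is T^(-1) up to
  sign.\<close>

lemma associated_matrix_congruence:
  fixes x :: real
  assumes "x \<notin> \<rat>" "invertible A" "associated_matrix x M"
  defines "U \<equiv> coord_swap (adj A)"
  shows "associated_matrix (moebius A x) (transpose U ** M ** U)"
proof -
  define T where "T = coord_swap A"
  obtain s i0 where M: "M \<in> prim_matrices" "transpose M \<noteq> M" "transpose M \<noteq> - M" and s: "approximating_sequence x s"
    and i0: "i0 \<ge> 1" "\<And>i. i \<ge> i0 \<Longrightarrow> s (i + 2) \<simeq> s (i + 1) ** (if odd i then M else transpose M) ** s i"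
    using assms(3) unfolding associated_matrix_iff[OF assms(1)] by blast
  have adjT: "U = adj T" unfolding U_def T_def by (simp add: coord_swap_def mat_eq_iff2)
  have dT: "det T \<noteq> 0" unfolding T_def det_coord_swap by (rule det_ne0[OF assms(2)])
  have dd: "det T * det T = 1" unfolding T_def det_coord_swap
    using assms(2) invertible_int_iff[of A] by (metis abs_mult_self_eq mult_1)
  define N where "N = transpose U ** M ** U"
  have pullback: "transpose T ** N ** T = M"
  proof -
    have "transpose T ** N ** T = (transpose T ** transpose U) ** M ** (U ** T)"
      by (simp add: N_def matrix_mul_assoc)
    also have "transpose T ** transpose U = smul (det T) (mat 1)"
      unfolding adjT by (simp add: matrix_transpose_mul[symmetric] adj_mult smul_transpose transpose_mat)
    also have "U ** T = smul (det T) (mat 1)" unfolding adjT by (rule adj_mult)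
    finally show ?thesis by (simp add: smul_mult smul_smul dd)
  qed
  have "content N dvd content M" unfolding pullback[symmetric] by (rule content_dvd_mult)
  then have cN: "content N = 1" using prim_content[OF M(1)] content_nonneg[of N] by simp
  have "det N \<noteq> 0" unfolding N_def adjT using dT prim_det[OF M(1)] by (simp add: det_mul)
  then have N: "N \<in> prim_matrices" using cN by (simp add: prim_matrices_def)
  have tr: "transpose M = transpose T ** transpose N ** T"
    unfolding pullback[symmetric] by (simp add: matrix_transpose_mul matrix_mul_assoc)
  have 1: "transpose N \<noteq> N" using tr pullback M(2) by metis
  have 2: "transpose N \<noteq> - N"
  proof
    assume "transpose N = - N"
    then have "transpose M = transpose T ** (- N) ** T" using tr by simp
    also have "\<dots> = - (transpose T ** N ** T)" by (simp add: mat_eq_iff2 mult_nth2 algebra_simps)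
    finally show False using M(3) pullback by simp
  qed
  define t where "t i = congruence A (s i)" for i
  have t: "approximating_sequence (moebius A x) t"
    unfolding t_def by (rule approximating_sequence_congruence[OF assms(1,2) s])
  have "t (i + 2) \<simeq> t (i + 1) ** (if odd i then N else transpose N) ** t i" if i: "i \<ge> i0" for i
  proof -
    define N' where "N' = (if odd i then N else transpose N)"
    have "(if odd i then M else transpose M) = transpose T ** N' ** T" unfolding N'_def using pullback tr by simp
    then have "T ** s (i + 2) ** transpose T \<simeq> T ** (s (i + 1) ** (transpose T ** N' ** T) ** s i) ** transpose T"
      using i0(2)[OF i] by (intro prop_mult) auto
    then show ?thesis unfolding t_def congruence_def T_def[symmetric] N'_def[symmetric] by (simp add: matrix_mul_assoc)
  qed
  then show ?thesis
    unfolding associated_matrix_iff[OF moebius_irrational[OF assms(1) det_ne0[OF assms(2)]]] N_def[symmetric]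
    using N 1 2 t i0(1) by blast
qed

text \<open>The number z with (1, z) M (1, x)^T = 0; \<open>M\<close> and its transpose give the two
  conjugates.\<close>

definition conj_by :: "int^2^2 \<Rightarrow> real \<Rightarrow> real" where
  "conj_by M x = - ((real_of_int (M$1$1) + real_of_int (M$1$2) * x) / (real_of_int (M$2$1) + real_of_int (M$2$2) * x))"

section \<open>Conjugates: equivariance and distinctness\<close>

lemma conjugate_eq:
  "conjugate1 x = conj_by (extremal_matrix x) x" "conjugate2 x = conj_by (transpose (extremal_matrix x)) x"
  by (simp_all add: conjugate1_def conjugate2_def conj_by_def Let_def)

lemma conj_by_eq_moebius: "conj_by M x = moebius (mat2 (- M$1$2) (- M$1$1) (M$2$2) (M$2$1)) x"
  by (simp add: conj_by_def moebius_def add.commute minus_divide_left)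

lemma conj_by_irrational: "x \<notin> \<rat> \<Longrightarrow> det M \<noteq> 0 \<Longrightarrow> conj_by M x \<notin> \<rat>"
  unfolding conj_by_eq_moebius by (rule moebius_irrational) (simp_all add: det_2 algebra_simps)

lemma conj_by_denominator:
  fixes x :: real and M :: "int^2^2"
  assumes "x \<notin> \<rat>" "det M \<noteq> 0"
  shows "M$2$1 + M$2$2 * x \<noteq> 0"
  using linear_irrational_nonzero[OF assms(1), of "M$2$2" "M$2$1"] assms(2) by (auto simp: det_2 add.commute)

lemma conj_by_proportional:
  assumes "M \<simeq> N" shows "conj_by M x = conj_by N x"
proof -
  have smul: "conj_by (smul s M) x = conj_by M x" if "s \<noteq> 0" for s M
  proof -
    have "conj_by (smul s M) x = - ((s * (M$1$1 + M$1$2 * x)) /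
        (s * (M$2$1 + M$2$2 * x)))"
      by (simp add: conj_by_def algebra_simps)
    then show ?thesis using that by (simp add: conj_by_def)
  qed
  then show ?thesis using assms unfolding proportional_def by metis
qed

text \<open>\<open>U\<close> undoes \<open>coord_swap A\<close> up to a scalar, so the transported
  bilinear form vanishes on the images of a pair on which that of \<open>M\<close> vanishes.\<close>

lemma conj_by_congruence:
  fixes x :: real
  assumes "x \<notin> \<rat>" "invertible A" "det M \<noteq> 0"
  defines "U \<equiv> coord_swap (adj A)"
  shows "conj_by (transpose U ** M ** U) (moebius A x) = moebius A (conj_by M x)"
proof -
  have dA: "det A \<noteq> 0" by (rule det_ne0[OF assms(2)])
  define a b c d where "a = real_of_int (A$1$1)" and "b = real_of_int (A$1$2)"
    and "c = real_of_int (A$2$1)" and "d = real_of_int (A$2$2)"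
  define \<delta> where "\<delta> = a * d - b * c"
  have "real_of_int (det A) \<noteq> 0" using dA by simp
  then have \<delta>: "\<delta> \<noteq> 0" unfolding \<delta>_def a_def b_def c_def d_def det_2 by simp
  define u v where "u = M$1$1 + M$1$2 * x"
    and "v = M$2$1 + M$2$2 * x"
  have v: "v \<noteq> 0" unfolding v_def by (rule conj_by_denominator[OF assms(1,3)])
  define q where "q = c * x + d"
  have q: "q \<noteq> 0" unfolding q_def c_def d_def by (rule moebius_denominator[OF assms(1) dA])
  define z where "z = moebius A x"
  have zq: "z * q = a * x + b" using q unfolding z_def q_def a_def b_def c_def d_def moebius_def by simp
  define N where "N = transpose U ** M ** U"
  \<comment> \<open>The factor q clears the denominator of z; numerator and denominator both acquire
    \<delta>, which cancels in the quotient.\<close>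
  have "q * (N$1$1 + N$1$2 * z) = real_of_int (N$1$1) * q + real_of_int (N$1$2) * (z * q)"
    by (simp add: algebra_simps)
  also have "\<dots> = \<delta> * (a * u - b * v)"
    unfolding zq unfolding N_def U_def \<delta>_def u_def v_def q_def a_def b_def c_def d_def
    by (simp add: mult_nth2 coord_swap_def algebra_simps)
  finally have 1: "q * (N$1$1 + N$1$2 * z) = \<delta> * (a * u - b * v)" .
  have "q * (N$2$1 + N$2$2 * z) = real_of_int (N$2$1) * q + real_of_int (N$2$2) * (z * q)"
    by (simp add: algebra_simps)
  also have "\<dots> = \<delta> * (d * v - c * u)"
    unfolding zq unfolding N_def U_def \<delta>_def u_def v_def q_def a_def b_def c_def d_def
    by (simp add: mult_nth2 coord_swap_def algebra_simps)
  finally have 2: "q * (N$2$1 + N$2$2 * z) = \<delta> * (d * v - c * u)" .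
  have "conj_by N z = - ((q * (N$1$1 + N$1$2 * z)) / (q * (N$2$1 + N$2$2 * z)))"
    using q by (simp add: conj_by_def)
  also have "\<dots> = - ((a * u - b * v) / (d * v - c * u))" unfolding 1 2 using \<delta> by simp
  also have "\<dots> = (v * (a * (- (u / v)) + b)) / (v * (c * (- (u / v)) + d))"
  proof -
    have "v * (a * (- (u / v)) + b) = - (a * u - b * v)" "v * (c * (- (u / v)) + d) = d * v - c * u"
      using v by (simp_all add: right_diff_distrib)
    then show ?thesis by (simp only: minus_divide_left)
  qed
  also have "\<dots> = moebius A (conj_by M x)"
    using v unfolding moebius_def conj_by_def u_def v_def a_def b_def c_def d_def by simp
  finally show ?thesis unfolding N_def z_def .
qed

text \<open>\<open>SOME\<close> may select the transpose of the transported matrix, whence the two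
  orders.\<close>

lemma conjugates_moebius:
  assumes "extremal x" "invertible A"
  defines "z \<equiv> moebius A x"
  shows "conjugate1 z = moebius A (conjugate1 x) \<and> conjugate2 z = moebius A (conjugate2 x) \<or>
    conjugate1 z = moebius A (conjugate2 x) \<and> conjugate2 z = moebius A (conjugate1 x)"
proof -
  have irr: "x \<notin> \<rat>" using assms(1) extremal_iff by auto
  define M where "M = extremal_matrix x"
  define U where "U = coord_swap (adj A)"
  have M: "associated_matrix x M" unfolding M_def by (rule extremal_matrix_associated[OF assms(1)])
  then have dM: "det M \<noteq> 0" "det (transpose M) \<noteq> 0" using prim_det by (auto simp: associated_matrix_def)
  define N where "N = transpose U ** M ** U"
  have N: "associated_matrix z N" unfolding N_def U_def z_def by (rule associated_matrix_congruence[OF irr assms(2) M])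
  have tN: "transpose N = transpose U ** transpose M ** U" unfolding N_def by (simp add: matrix_transpose_mul matrix_mul_assoc)
  have e: "extremal z" unfolding z_def by (rule extremal_moebius[OF assms(1,2)])
  have 1: "conj_by N z = moebius A (conjugate1 x)"
    unfolding N_def U_def z_def conjugate_eq M_def[symmetric] by (rule conj_by_congruence[OF irr assms(2) dM(1)])
  have 2: "conj_by (transpose N) z = moebius A (conjugate2 x)"
    unfolding tN U_def z_def conjugate_eq M_def[symmetric] by (rule conj_by_congruence[OF irr assms(2) dM(2)])
  consider "extremal_matrix z \<simeq> N" | "extremal_matrix z \<simeq> transpose N"
    using associated_matrix_proportional[OF e N] by blast
  then show ?thesis
  proof cases
    case 1
    then show ?thesis
      using \<open>conj_by N z = _\<close> 2 conj_by_proportional[OF 1] conj_by_proportional[OF prop_transpose[OF 1]]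
      unfolding conjugate_eq[of z] by simp
  next
    case h: 2
    have "transpose (extremal_matrix z) \<simeq> N" using prop_transpose[OF h] by simp
    then show ?thesis
      using 1 2 conj_by_proportional[OF h] conj_by_proportional[of "transpose (extremal_matrix z)" N]
      unfolding conjugate_eq[of z] by simp
  qed
qed

text \<open>Distinctness reduces to F = (1, x) M (1, x)^T being non-zero, which holds because M is
  not skew and x not quadratic. A conjugate equal to x means F = 0; equal conjugates mean (M12 -
  M21) F = 0.\<close>

lemma conjugates_distinct:
  assumes "extremal x"
  shows "conjugate1 x \<notin> \<rat>" "conjugate2 x \<notin> \<rat>" "conjugate1 x \<noteq> x" "conjugate2 x \<noteq> x" "conjugate1 x \<noteq> conjugate2 x"
proof -
  have irr: "x \<notin> \<rat>" and nq: "\<not> quadratic_number x" using assms(1) extremal_iff by auto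
  define M where "M = extremal_matrix x"
  have M: "M \<in> prim_matrices" "transpose M \<noteq> M" "transpose M \<noteq> - M"
    using extremal_matrix_associated[OF assms] unfolding M_def associated_matrix_def by auto
  have dM: "det M \<noteq> 0" "det (transpose M) \<noteq> 0" using prim_det[OF M(1)] by auto
  have c: "conjugate1 x = conj_by M x" "conjugate2 x = conj_by (transpose M) x" unfolding conjugate_eq M_def by auto
  show "conjugate1 x \<notin> \<rat>" "conjugate2 x \<notin> \<rat>" unfolding c by (intro conj_by_irrational irr dM)+
  define F where "F = real_of_int (M$1$1) + real_of_int (M$1$2 + M$2$1) * x + real_of_int (M$2$2) * x^2"
  have F: "F \<noteq> 0"
  proof
    assume "F = 0"
    then have "M$1$1 = 0 \<and> M$1$2 + M$2$1 = 0 \<and> M$2$2 = 0"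
      unfolding F_def by (rule no_quadratic_relation[OF irr nq])
    then have "transpose M = - M" by (auto simp: mat_eq_iff2)
    then show False using M(3) by simp
  qed
  have v: "M$2$1 + M$2$2 * x \<noteq> 0" "M$1$2 + M$2$2 * x \<noteq> 0"
    using conj_by_denominator[OF irr dM(1)] conj_by_denominator[OF irr dM(2)] by simp_all
  have ne: "M$1$2 \<noteq> M$2$1" using M(2) by (auto simp: symmetric_iff)
  have "conj_by P x \<noteq> x" if P: "P = M \<or> P = transpose M" for P
  proof
    have v: "real_of_int (P$2$1) + real_of_int (P$2$2) * x \<noteq> 0" using v P by auto
    assume "conj_by P x = x"
    then have "- (P$1$1 + P$1$2 * x) = x * (P$2$1 + P$2$2 * x)"
      unfolding conj_by_def using v by (simp add: field_simps)
    then show False using F P unfolding F_def by (auto simp: algebra_simps power2_eq_square)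
  qed
  then show "conjugate1 x \<noteq> x" "conjugate2 x \<noteq> x" unfolding c by blast+
  show "conjugate1 x \<noteq> conjugate2 x"
  proof
    assume "conjugate1 x = conjugate2 x"
    then have "(M$1$1 + M$1$2 * x) * (M$1$2 + M$2$2 * x)
      = (M$1$1 + M$2$1 * x) * (M$2$1 + M$2$2 * x)"
      unfolding c conj_by_def using v by (simp add: frac_eq_eq)
    then have "(real_of_int (M$1$2) - real_of_int (M$2$1)) * F = 0"
      unfolding F_def by (simp add: algebra_simps power2_eq_square)
    then show False using F ne by simp
  qed
qed

section \<open>Reduction\<close>

definition irr01 :: "real \<Rightarrow> bool" where
  "irr01 x \<longleftrightarrow> x \<notin> \<rat> \<and> 0 < x \<and> x < 1"

lemma irrational_ne_of_int: "x \<notin> \<rat> \<Longrightarrow> x \<noteq> real_of_int k"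
  by auto

lemma irrational_inverse: "x \<notin> \<rat> \<Longrightarrow> 1 / x \<notin> (\<rat> :: real set)"
  by (metis Rats_divide Rats_1 div_by_1 divide_divide_eq_right mult_1)

lemma irrational_diff_int: "x \<notin> \<rat> \<Longrightarrow> x - real_of_int k \<notin> \<rat>"
  by (metis Rats_add Rats_of_int diff_add_cancel)

abbreviation gauss :: "real \<Rightarrow> real" where
  "gauss x \<equiv> 1 / x - \<lfloor>1 / x\<rfloor>"

lemma gauss_unit:
  assumes "irr01 x"
  shows "irr01 (gauss x)" "\<lfloor>1 / x\<rfloor> \<ge> 1"
proof -
  have x: "x \<notin> \<rat>" "0 < x" "x < 1" using assms by (auto simp: irr01_def)
  have irr: "1 / x \<notin> \<rat>" by (rule irrational_inverse[OF x(1)])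
  have "1 / x \<noteq> \<lfloor>1 / x\<rfloor>" by (rule irrational_ne_of_int[OF irr])
  then have "0 < gauss x" "gauss x < 1" by linarith+
  then show "irr01 (gauss x)"
    unfolding irr01_def using irrational_diff_int[OF irr] by blast
  have "1 < 1 / x" using x by simp
  then show "\<lfloor>1 / x\<rfloor> \<ge> 1" by linarith
qed

text \<open>With k the integral part of 1/x the product is 1 - k x, and 1 < (k + 1) x \<le> 2 k
  x.\<close>

lemma gauss_map_product:
  assumes "irr01 x"
  shows "x * (gauss x) < 1 / 2"
proof -
  have x: "0 < x" using assms by (auto simp: irr01_def)
  define k where "k = real_of_int \<lfloor>1 / x\<rfloor>"
  have k: "k \<ge> 1" "1 / x < k + 1" unfolding k_def using gauss_unit(2)[OF assms] by linarith+
  then have "1 < (k + 1) * x" using x by (simp add: field_simps)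
  also have "\<dots> \<le> (2 * k) * x" using k x by (intro mult_right_mono) auto
  finally have "1 < 2 * (k * x)" by simp
  moreover have "x * (1 / x - k) = 1 - k * x" using x by (simp add: algebra_simps)
  ultimately show ?thesis unfolding k_def by linarith
qed

text \<open>Two points with the same first two partial quotients are separated by a factor at least 4 after
  two steps of the Gauss map, so they cannot have the same partial quotients forever.\<close>

lemma gauss_map_induct:
  assumes diff: "\<And>x z. irr01 x \<Longrightarrow> irr01 z \<Longrightarrow> \<lfloor>1 / x\<rfloor> \<noteq> \<lfloor>1 / z\<rfloor> \<Longrightarrow> G x z"
    and same: "\<And>x z. irr01 x \<Longrightarrow> irr01 z \<Longrightarrow> \<lfloor>1 / x\<rfloor> = \<lfloor>1 / z\<rfloor> \<Longrightarrow>
       G (gauss x) (gauss z) \<Longrightarrow> G x z"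
    and "irr01 x" "irr01 z" "x \<noteq> z"
  shows "G x z"
proof -
  \<comment> \<open>The exponent m counts double steps; for m = 0 the hypothesis would put two
    points of (0,1) at distance at least 1.\<close>
  have main: "G x z" if "irr01 x" "irr01 z" "1 \<le> \<bar>x - z\<bar> * 4 ^ m" for m x z
    using that
  proof (induction m arbitrary: x z)
    case 0
    then show ?case by (auto simp: irr01_def)
  next
    case (Suc m)
    define g where "g t = 1 / t - \<lfloor>1 / t\<rfloor>" for t :: real
    have pos: "irr01 t \<Longrightarrow> t > 0" for t by (simp add: irr01_def)
    have ug: "irr01 (g t)" if "irr01 t" for t
      unfolding g_def by (rule gauss_unit[OF that])
    note ugs = ug[OF Suc.prems(1)] ug[OF Suc.prems(2)]
    \<comment> \<open>Within one branch the Gauss map stretches distances by exactly 1 / (s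
      t).\<close>
    have step: "\<bar>g s - g t\<bar> * (s * t) = \<bar>s - t\<bar>"
      if "irr01 s" "irr01 t" "\<lfloor>1 / s\<rfloor> = \<lfloor>1 / t\<rfloor>" for s t
    proof -
      have "(g s - g t) * (s * t) = t - s"
        using pos[OF that(1)] pos[OF that(2)] that(3) unfolding g_def by (simp add: field_simps)
      then have "\<bar>g s - g t\<bar> * \<bar>s * t\<bar> = \<bar>t - s\<bar>" by (metis abs_mult)
      then show ?thesis using pos[OF that(1)] pos[OF that(2)] by (simp add: abs_minus_commute)
    qed
    show ?case
    proof (cases "\<lfloor>1 / x\<rfloor> = \<lfloor>1 / z\<rfloor> \<and> \<lfloor>1 / g x\<rfloor> = \<lfloor>1 / g z\<rfloor>")
      case True
      have p: "x * g x < 1 / 2" "z * g z < 1 / 2"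
        using gauss_map_product Suc.prems unfolding g_def by blast+
      have q: "0 < x" "0 < z" "0 < g x" "0 < g z" using Suc.prems ug pos by blast+
      have "\<bar>x - z\<bar> = \<bar>g (g x) - g (g z)\<bar> * (g x * g z) * (x * z)"
        using step[OF Suc.prems(1,2)] step[OF ugs] True by simp
      also have "\<dots> = \<bar>g (g x) - g (g z)\<bar> * ((x * g x) * (z * g z))" by (simp add: ac_simps)
      also have "\<dots> \<le> \<bar>g (g x) - g (g z)\<bar> * ((1 / 2) * (1 / 2))"
        using p q by (intro mult_left_mono mult_mono) auto
      finally have "\<bar>x - z\<bar> * 4 \<le> \<bar>g (g x) - g (g z)\<bar>" by simp
      then have "(\<bar>x - z\<bar> * 4) * 4 ^ m \<le> \<bar>g (g x) - g (g z)\<bar> * 4 ^ m" by (intro mult_right_mono) auto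
      moreover have "\<bar>x - z\<bar> * 4 ^ Suc m = (\<bar>x - z\<bar> * 4) * 4 ^ m" by simp
      ultimately have "1 \<le> \<bar>g (g x) - g (g z)\<bar> * 4 ^ m" using Suc.prems(3) by linarith
      then have "G (g (g x)) (g (g z))"
        by (intro Suc.IH ug Suc.prems(1,2))
      then have "G (g x) (g z)" using same[OF ugs] True unfolding g_def by blast
      then show ?thesis using same[OF Suc.prems(1,2)] True unfolding g_def by blast
    next
      case False
      then consider "\<lfloor>1 / x\<rfloor> \<noteq> \<lfloor>1 / z\<rfloor>" | "\<lfloor>1 / x\<rfloor> = \<lfloor>1 / z\<rfloor>" "\<lfloor>1 / g x\<rfloor> \<noteq> \<lfloor>1 / g z\<rfloor>" by blast
      then show ?thesis
      proof cases
        case 1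
        then show ?thesis using diff Suc.prems by blast
      next
        case 2
        have "G (g x) (g z)" using diff[OF ugs 2(2)] .
        then show ?thesis using same[OF Suc.prems(1,2) 2(1)] unfolding g_def by blast
      qed
    qed
  qed
  obtain m where "1 / \<bar>x - z\<bar> < (4::real) ^ m" using real_arch_pow[of 4 "1 / \<bar>x - z\<bar>"] by auto
  then have "1 \<le> \<bar>x - z\<bar> * 4 ^ m" using assms(5) by (simp add: field_simps)
  then show ?thesis using main assms(3,4) by blast
qed

section \<open>Separating a number from its conjugates, and balancing\<close>

lemma invertible_mat2: "\<bar>a * d - b * c\<bar> = 1 \<Longrightarrow> invertible (mat2 a b c d :: int^2^2)"
  unfolding invertible_int_iff by (simp add: det_2)

lemma invertible_mult_int:
  fixes A B :: "int^2^2"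
  shows "invertible A \<Longrightarrow> invertible B \<Longrightarrow> invertible (A ** B)"
  unfolding invertible_int_iff by (simp add: det_mul abs_mult)

lemma moebius_shift: "moebius (mat2 1 (- k) 0 1) x = x - real_of_int k"
  by (simp add: moebius_def)

lemma moebius_gauss: "x \<noteq> 0 \<Longrightarrow> moebius (mat2 (- k) 1 1 0) x = 1 / x - real_of_int k"
  by (simp add: moebius_def field_simps)

lemma moebius_inverse_gauss: "moebius (mat2 0 1 1 k) x = 1 / (x + real_of_int k)"
  by (simp add: moebius_def)

text \<open>The last clause lets the two conjugates be treated one after the other: separating the
  second does not bring the first back above -1.\<close>

definition separable :: "real \<Rightarrow> real \<Rightarrow> bool" where
  "separable x z \<longleftrightarrow> (\<exists>A. invertible A \<and> irr01 (moebius A x) \<and> moebius A z < -1 \<and>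
     (\<forall>t. t \<notin> \<rat> \<longrightarrow> t < -1 \<longrightarrow> moebius A t < -1))"

text \<open>One Gauss step on \<open>x\<close>, its partial quotient k being applied to
  \<open>z\<close> as well; because k \<ge> 1 this maps the half-line below -1 into itself.\<close>

lemma separable_step:
  assumes "irr01 x" "z \<notin> \<rat>" "separable (gauss x) (1 / z - \<lfloor>1 / x\<rfloor>)"
  shows "separable x z"
proof -
  define k where "k = \<lfloor>1 / x\<rfloor>"
  have k: "k \<ge> 1" unfolding k_def by (rule gauss_unit(2)[OF assms(1)])
  have x: "x \<notin> \<rat>" "x \<noteq> 0" "z \<noteq> 0" using assms(1,2) by (auto simp: irr01_def)
  obtain A where A: "invertible A" "irr01 (moebius A (1 / x - k))" "moebius A (1 / z - k) < -1"
    "\<And>t. t \<notin> \<rat> \<Longrightarrow> t < -1 \<Longrightarrow> moebius A t < -1" using assms(3) unfolding separable_def k_def by blast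
  let ?B = "mat2 (- k) 1 1 0"
  have B: "invertible ?B" by (rule invertible_mat2) simp
  note m = moebius_mult[OF _ det_ne0[OF A(1)] det_ne0[OF B]]
  show ?thesis unfolding separable_def
  proof (intro exI[of _ "A ** ?B"] conjI allI impI)
    show "invertible (A ** ?B)" by (rule invertible_mult_int[OF A(1) B])
    show "irr01 (moebius (A ** ?B) x)" using A(2) by (simp add: m x moebius_gauss)
    show "moebius (A ** ?B) z < -1" using A(3) assms(2) x by (simp add: m moebius_gauss)
    fix t :: real assume t: "t \<notin> \<rat>" "t < -1"
    have "1 / t < 0" using t by simp
    then have "1 / t - k < -1" using k by linarith
    then have "moebius A (1 / t - k) < -1" by (intro A(4) irrational_diff_int irrational_inverse t)
    moreover have "t \<noteq> 0" using t by simp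
    ultimately show "moebius (A ** ?B) t < -1" using t(1) by (simp add: m moebius_gauss)
  qed
qed

text \<open>One step sends points below 0 below -1, and points above 1 below 0. Inside (0,1) both
  numbers follow the Gauss map until their partial quotients differ; the next step takes
  \<open>z\<close> out of the interval.\<close>

lemma separable_all:
  assumes "irr01 x" "z \<notin> \<rat>" "x \<noteq> z"
  shows "separable x z"
proof -
  have 1: "separable x z" if "irr01 x" "z < -1" for x z
    unfolding separable_def using that by (intro exI[of _ "mat 1"]) (simp add: moebius_one invertible_int_iff)
  have 2: "separable x z" if "irr01 x" "z \<notin> \<rat>" "z < 0" for x z
  proof (rule separable_step[OF that(1,2)])
    have "1 / z < 0" using that by simp
    then have "1 / z - \<lfloor>1 / x\<rfloor> < -1" using gauss_unit(2)[OF that(1)] by linarith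
    then show "separable (gauss x) (1 / z - \<lfloor>1 / x\<rfloor>)"
      by (intro 1 gauss_unit(1)[OF that(1)])
  qed
  have 3: "separable x z" if "irr01 x" "z \<notin> \<rat>" "z > 1" for x z
  proof (rule separable_step[OF that(1,2)])
    have "1 / z < 1" using that by simp
    then have "1 / z - \<lfloor>1 / x\<rfloor> < 0" using gauss_unit(2)[OF that(1)] by linarith
    then show "separable (gauss x) (1 / z - \<lfloor>1 / x\<rfloor>)"
      by (intro 2 gauss_unit(1)[OF that(1)] irrational_diff_int irrational_inverse that)
  qed
  have 4: "separable x z" if "irr01 x" "irr01 z" "x \<noteq> z" for x z
    using _ _ that
  proof (rule gauss_map_induct[where G = separable])
    fix x z assume h: "irr01 x" "irr01 z" "\<lfloor>1 / x\<rfloor> \<noteq> \<lfloor>1 / z\<rfloor>"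
    have z: "z \<notin> \<rat>" using h(2) by (simp add: irr01_def)
    let ?z = "1 / z - \<lfloor>1 / x\<rfloor>"
    have irr: "?z \<notin> \<rat>" by (intro irrational_diff_int irrational_inverse z)
    have "\<not> (0 \<le> ?z \<and> ?z < 1)" using h(3) by linarith
    moreover have "?z \<noteq> 1" using irrational_ne_of_int[OF irr, of 1] by simp
    ultimately consider "?z < 0" | "?z > 1" by linarith
    then have "separable (gauss x) ?z"
      using 2[OF gauss_unit(1)[OF h(1)] irr] 3[OF gauss_unit(1)[OF h(1)] irr] by cases
    then show "separable x z" by (rule separable_step[OF h(1) z])
  next
    fix x z assume h: "irr01 x" "irr01 z" "\<lfloor>1 / x\<rfloor> = \<lfloor>1 / z\<rfloor>"
      "separable (gauss x) (gauss z)"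
    have z: "z \<notin> \<rat>" using h(2) by (simp add: irr01_def)
    show "separable x z" by (rule separable_step[OF h(1) z]) (use h in simp)
  qed
  have "z \<noteq> 0" "z \<noteq> 1" using assms(2) by auto
  then consider "z < 0" | "irr01 z" | "z > 1" using assms(2) unfolding irr01_def by linarith
  then show ?thesis using 2 3 4 assms by cases blast+
qed

definition balanceable :: "real \<Rightarrow> real \<Rightarrow> real \<Rightarrow> bool" where
  "balanceable x z1 z2 \<longleftrightarrow> (\<exists>A. invertible A \<and> irr01 (moebius A x) \<and> moebius A z1 < -1 \<and>
     moebius A z2 < -1 \<and> \<lfloor>moebius A z1\<rfloor> \<noteq> \<lfloor>moebius A z2\<rfloor>)"

lemma balanceable_moebius:
  assumes "invertible B" "x \<notin> \<rat>" "z1 \<notin> \<rat>" "z2 \<notin> \<rat>"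
    and "balanceable (moebius B x) (moebius B z1) (moebius B z2)"
  shows "balanceable x z1 z2"
proof -
  obtain A where A: "invertible A" "irr01 (moebius A (moebius B x))" "moebius A (moebius B z1) < -1"
     "moebius A (moebius B z2) < -1" "\<lfloor>moebius A (moebius B z1)\<rfloor> \<noteq> \<lfloor>moebius A (moebius B z2)\<rfloor>"
    using assms(5) unfolding balanceable_def by blast
  note m = moebius_mult[OF _ det_ne0[OF A(1)] det_ne0[OF assms(1)]]
  show ?thesis unfolding balanceable_def
    by (intro exI[of _ "A ** B"]) (use A(2-) in \<open>simp add: m assms(2-4) invertible_mult_int[OF A(1) assms(1)]\<close>)
qed

text \<open>With z = -1/u, the inverse Gauss step on x acts on u as the forward one with the same k,
  so common partial quotients of u and v can be removed. The integral part of z is -1 minus that of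
  1/u, so differing partial quotients give differing integral parts.\<close>

lemma balanceable_reduced:
  assumes "irr01 x" "z1 \<notin> \<rat>" "z2 \<notin> \<rat>" "z1 < -1" "z2 < -1" "z1 \<noteq> z2"
  shows "balanceable x z1 z2"
proof -
  \<comment> \<open>\<open>x\<close> is quantified inside \<open>G\<close> because the step changes
    it.\<close>
  define G where "G u v \<longleftrightarrow> (\<forall>x. irr01 x \<longrightarrow> balanceable x (- (1 / u)) (- (1 / v)))" for u v
  have neg: "- (1 / u) < -1" "\<lfloor>- (1 / u)\<rfloor> = - \<lfloor>1 / u\<rfloor> - 1" "- (1 / u) \<notin> \<rat>" if "irr01 u" for u
  proof -
    have u: "u \<notin> \<rat>" "0 < u" "u < 1" using that by (auto simp: irr01_def)
    then show "- (1 / u) < -1" by simp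
    have irr: "1 / u \<notin> \<rat>" by (rule irrational_inverse[OF u(1)])
    then show "- (1 / u) \<notin> \<rat>" by simp
    have "1 / u \<noteq> \<lfloor>1 / u\<rfloor>" by (rule irrational_ne_of_int[OF irr])
    then show "\<lfloor>- (1 / u)\<rfloor> = - \<lfloor>1 / u\<rfloor> - 1" by linarith
  qed
  have main: "G u v" if "irr01 u" "irr01 v" "u \<noteq> v" for u v
    using _ _ that
  proof (rule gauss_map_induct[where G = G])
    fix u v assume h: "irr01 u" "irr01 v" "\<lfloor>1 / u\<rfloor> \<noteq> \<lfloor>1 / v\<rfloor>"
    show "G u v" unfolding G_def balanceable_def
    proof (intro allI impI exI[of _ "mat 1"])
      fix x assume "irr01 x"
      then show "invertible (mat 1 :: int^2^2) \<and> irr01 (moebius (mat 1) x) \<and> moebius (mat 1) (- (1 / u)) < -1 \<and>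
        moebius (mat 1) (- (1 / v)) < -1 \<and> \<lfloor>moebius (mat 1) (- (1 / u))\<rfloor> \<noteq> \<lfloor>moebius (mat 1) (- (1 / v))\<rfloor>"
        unfolding moebius_one neg(2)[OF h(1)] neg(2)[OF h(2)]
        using h(3) neg(1)[OF h(1)] neg(1)[OF h(2)] by (simp add: invertible_int_iff)
    qed
  next
    fix u v assume h: "irr01 u" "irr01 v" "\<lfloor>1 / u\<rfloor> = \<lfloor>1 / v\<rfloor>"
      "G (gauss u) (gauss v)"
    define k where "k = \<lfloor>1 / u\<rfloor>"
    have k: "k \<ge> 1" unfolding k_def by (rule gauss_unit(2)[OF h(1)])
    let ?B = "mat2 0 1 1 k"
    have B: "invertible ?B" by (rule invertible_mat2) simp
    show "G u v" unfolding G_def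
    proof (intro allI impI)
      fix x assume x: "irr01 x"
      have xi: "x \<notin> \<rat>" "0 < x" using x by (auto simp: irr01_def)
      have e: "1 / (- (1 / w) + real_of_int k) = - (1 / (1 / w - k))" for w :: real
        by (metis minus_diff_eq minus_divide_right uminus_add_conv_diff)
      have "1 < x + k" using xi k by linarith
      then have "0 < 1 / (x + k)" "1 / (x + k) < 1" by simp_all
      moreover have "moebius ?B x \<notin> \<rat>" by (rule moebius_irrational[OF xi(1) det_ne0[OF B]])
      ultimately have "irr01 (moebius ?B x)" unfolding irr01_def moebius_inverse_gauss by blast
      then have "balanceable (moebius ?B x) (- (1 / (1 / u - k))) (- (1 / (1 / v - k)))"
        using h(3,4) unfolding G_def k_def by simp
      then have "balanceable (moebius ?B x) (moebius ?B (- (1 / u))) (moebius ?B (- (1 / v)))"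
        unfolding moebius_inverse_gauss e .
      then show "balanceable x (- (1 / u)) (- (1 / v))"
        by (rule balanceable_moebius[OF B xi(1) neg(3)[OF h(1)] neg(3)[OF h(2)]])
    qed
  qed
  have inv: "irr01 (- (1 / z)) \<and> - (1 / (- (1 / z))) = z" if "z \<notin> \<rat>" "z < -1" for z :: real
    unfolding irr01_def using irrational_inverse[OF that(1)] that(2) by (auto simp: field_simps)
  have "- (1 / z1) \<noteq> - (1 / z2)" using assms(6) inv[OF assms(2,4)] inv[OF assms(3,5)] by metis
  then have "G (- (1 / z1)) (- (1 / z2))" using main inv assms by blast
  then have "balanceable x (- (1 / (- (1 / z1)))) (- (1 / (- (1 / z2))))" unfolding G_def using assms(1) by blast
  then show ?thesis using inv[OF assms(2,4)] inv[OF assms(3,5)] by simp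
qed

lemma moebius_inj:
  assumes "x \<notin> \<rat>" "z \<notin> \<rat>" "invertible A" "moebius A x = moebius A z"
  shows "x = z"
proof -
  obtain B where B: "invertible B" "B ** A = mat 1" using invertible_inverse_int[OF assms(3)] by blast
  note m = moebius_mult[OF _ det_ne0[OF B(1)] det_ne0[OF assms(3)]]
  show ?thesis using m[OF assms(1)] m[OF assms(2)] assms(4) B(2) moebius_one by simp
qed

lemma balanceable_all:
  assumes "x \<notin> \<rat>" "z1 \<notin> \<rat>" "z2 \<notin> \<rat>" "x \<noteq> z1" "x \<noteq> z2" "z1 \<noteq> z2"
  shows "balanceable x z1 z2"
proof -
  define S where "S = mat2 1 (- \<lfloor>x\<rfloor>) 0 1"
  have S: "invertible S" unfolding S_def by (rule invertible_mat2) simp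
  note irr = moebius_irrational[OF _ det_ne0]
  have "x \<noteq> \<lfloor>x\<rfloor>" by (rule irrational_ne_of_int[OF assms(1)])
  then have "0 < x - \<lfloor>x\<rfloor>" "x - \<lfloor>x\<rfloor> < 1" by linarith+
  then have ux: "irr01 (moebius S x)"
    unfolding irr01_def using irr[OF assms(1) S] unfolding S_def moebius_shift by blast
  have "separable (moebius S x) (moebius S z1)"
    using moebius_inj[OF assms(1,2) S] assms(4) by (intro separable_all ux irr assms S) blast
  then obtain A where A: "invertible A" "irr01 (moebius A (moebius S x))" "moebius A (moebius S z1) < -1"
    unfolding separable_def by blast
  define P where "P = A ** S"
  have P: "invertible P" unfolding P_def by (rule invertible_mult_int[OF A(1) S])
  have mP: "moebius P t = moebius A (moebius S t)" if "t \<notin> \<rat>" for t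
    unfolding P_def by (rule moebius_mult[OF that det_ne0[OF A(1)] det_ne0[OF S]])
  have Px: "irr01 (moebius P x)" "moebius P z1 < -1" using A mP assms by simp_all
  have "separable (moebius P x) (moebius P z2)"
    using moebius_inj[OF assms(1,3) P] assms(5) by (intro separable_all Px irr assms P) blast
  \<comment> \<open>The last fact keeps z1 where the first separation has put it.\<close>
  then obtain B where B: "invertible B" "irr01 (moebius B (moebius P x))" "moebius B (moebius P z2) < -1"
    "\<And>t. t \<notin> \<rat> \<Longrightarrow> t < -1 \<Longrightarrow> moebius B t < -1" unfolding separable_def by blast
  have "moebius P z1 \<noteq> moebius P z2" using moebius_inj[OF assms(2,3) P] assms(6) by blast
  then have ne: "moebius B (moebius P z1) \<noteq> moebius B (moebius P z2)"
    using moebius_inj[OF irr[OF assms(2) P] irr[OF assms(3) P] B(1)] by blast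
  have "balanceable (moebius B (moebius P x)) (moebius B (moebius P z1)) (moebius B (moebius P z2))"
    by (rule balanceable_reduced[OF B(2) irr[OF irr[OF assms(2) P] B(1)] irr[OF irr[OF assms(3) P] B(1)]
          B(4)[OF irr[OF assms(2) P] Px(2)] B(3) ne])
  then have "balanceable (moebius P x) (moebius P z1) (moebius P z2)"
    by (rule balanceable_moebius[OF B(1) irr[OF assms(1) P] irr[OF assms(2) P] irr[OF assms(3) P]])
  then show ?thesis by (rule balanceable_moebius[OF P assms(1-3)])
qed

text \<open>The preimage of the half-line below -1 is an open interval between two Farey neighbours with
  denominators c and a + c; it contains no integer.\<close>

lemma floor_eq_of_image_below:
  fixes a b c d :: int and x1 x2 :: real
  assumes "c > 0" "a + c \<ge> 1" "\<bar>a * d - b * c\<bar> = 1"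
    and "c * x1 + d \<noteq> 0" "c * x2 + d \<noteq> 0"
    and "(a * x1 + b) / (c * x1 + d) < -1" "(a * x2 + b) / (c * x2 + d) < -1"
  shows "\<lfloor>x1\<rfloor> = \<lfloor>x2\<rfloor>"
proof -
  define \<delta> where "\<delta> = a * d - b * c"
  have \<delta>: "\<delta> = 1 \<or> \<delta> = -1" using assms(3) unfolding \<delta>_def by linarith
  define s where "s x = \<delta> * (c * x + d)" for x :: real
  have s: "0 < s x \<and> s x < 1" if "c * x + d \<noteq> 0" "(a * x + b) / (c * x + d) < -1" for x :: real
  proof -
    define q where "q = c * x + d"
    have q: "q \<noteq> 0" using that(1) unfolding q_def .
    have "c * (a * x + b) = a * q - \<delta>" unfolding q_def \<delta>_def by (simp add: algebra_simps)
    then have "c * ((a * x + b) / q) = a - \<delta> / q" using q by (simp add: field_simps)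
    moreover have "c * ((a * x + b) / q) < real_of_int c * (-1)"
      using that(2) assms(1) unfolding q_def by (intro mult_strict_left_mono) auto
    ultimately have "\<delta> / q > real_of_int (a + c)" by simp
    then have gt: "\<delta> / q > 1" using assms(2) by linarith
    have "\<delta> / q = 1 / s x" using \<delta> unfolding s_def q_def[symmetric] by auto
    then have "1 / s x > 1" using gt by simp
    then show ?thesis by (metis divide_less_eq_1_pos less_divide_eq_1 zero_less_divide_1_iff less_trans zero_less_one)
  qed
  have False if "\<lfloor>u\<rfloor> < \<lfloor>v\<rfloor>" "0 < s u \<and> s u < 1" "0 < s v \<and> s v < 1" for u v
  proof -
    define m where "m = \<lfloor>v\<rfloor>"
    have m: "u \<le> m" "m \<le> v" using that(1) unfolding m_def by linarith+
    have "min (s u) (s v) \<le> s m \<and> s m \<le> max (s u) (s v)"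
      using \<delta> m assms(1) unfolding s_def by (auto simp: min_def max_def mult_left_mono)
    then have "0 < s m" "s m < 1" using that(2,3) by (auto simp: min_def max_def split: if_splits)
    moreover have "s m = real_of_int (\<delta> * (c * m + d))" unfolding s_def by simp
    ultimately show False by (simp only: of_int_less_1_iff of_int_0_less_iff)
  qed
  then show ?thesis using s[OF assms(4,6)] s[OF assms(5,7)] by (metis linorder_neqE)
qed

text \<open>For lower left entry c > 0, the inequality a + c \<ge> 1 would equate the integral parts
  of z1 and z2, and its analogue for the inverse matrix those of their images. What remains, a \<le>
  -c and d \<ge> c, sends (0,1) to negative numbers. For c = 0 only integral translations and
  reflections are left.\<close>

lemma balanced_rigid:
  assumes A: "invertible A"
    and x: "irr01 x" "z1 \<notin> \<rat>" "z2 \<notin> \<rat>" "z1 < -1" "z2 < -1" "\<lfloor>z1\<rfloor> \<noteq> \<lfloor>z2\<rfloor>"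
    and y: "irr01 (moebius A x)" "moebius A z1 < -1" "moebius A z2 < -1" "\<lfloor>moebius A z1\<rfloor> \<noteq> \<lfloor>moebius A z2\<rfloor>"
  shows "moebius A x = x"
proof -
  \<comment> \<open>\<open>A\<close> and \<open>- A\<close> induce the same map, so the lower left
    entry may be taken nonnegative.\<close>
  obtain P where P: "invertible P" "P$2$1 \<ge> 0" and AP: "\<And>t. moebius A t = moebius P t"
  proof (cases "A$2$1 \<ge> 0")
    case False
    have "moebius (- A) t = moebius A t" for t
      using minus_divide_divide[of "A$1$1 * t + A$1$2" "A$2$1 * t + A$2$2"] by (simp add: moebius_def)
    moreover have "invertible (- A)" using A unfolding invertible_int_iff by (simp add: det_2)
    ultimately show ?thesis using that[of "- A"] False by simp
  qed (use A that in blast)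
  define a b c d where "a = P$1$1" and "b = P$1$2" and "c = P$2$1" and "d = P$2$2"
  have \<delta>: "\<bar>a * d - b * c\<bar> = 1" and c: "c \<ge> 0" and mo: "\<And>t. moebius A t = (real_of_int a * t + b) / (real_of_int c * t + d)"
    using P AP unfolding invertible_int_iff det_2 a_def b_def c_def d_def moebius_def by auto
  have den: "c * t + d \<noteq> 0" if "t \<notin> \<rat>" for t :: real
    unfolding c_def d_def by (rule moebius_denominator[OF that det_ne0[OF P(1)]])
  have xr: "x \<notin> \<rat>" "0 < x" "x < 1" using x(1) by (auto simp: irr01_def)
  have yr: "0 < moebius A x" "moebius A x < 1" using y(1) by (auto simp: irr01_def)
  show ?thesis
  proof (cases "c = 0")
    case True
    have ad: "\<bar>a * d\<bar> = 1" using \<delta> True by simp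
    then have "\<bar>a\<bar> = 1" "\<bar>d\<bar> = 1" using abs_zmult_eq_1[of a d] abs_zmult_eq_1[of d a] by (simp_all add: mult.commute)
    then consider "a = 1" "d = 1" | "a = -1" "d = -1" | "a = 1" "d = -1" | "a = -1" "d = 1"
      by linarith
    then obtain n :: int where "(\<forall>t. moebius A t = t + n) \<or> (\<forall>t. moebius A t = - t + n)"
    proof cases
      case 1 then show ?thesis using that[of b] by (simp add: mo True)
    next
      case 2 then show ?thesis using that[of "- b"] by (simp add: mo True)
    next
      case 3 then show ?thesis using that[of "- b"] by (simp add: mo True)
    next
      case 4 then show ?thesis using that[of b] by (simp add: mo True)
    qed
    then show ?thesis
    proof
      assume h: "\<forall>t. moebius A t = t + n"
      then have "n = 0" using yr xr by simp
      then show ?thesis using h by simp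
    next
      assume h: "\<forall>t. moebius A t = - t + n"
      then have "n > 0" using yr xr by simp
      then have "moebius A z1 > 1" using h x(4) by simp
      then show ?thesis using y(2) by simp
    qed
  next
    case False
    then have c: "c > 0" using c by simp
    have 1: "\<not> a + c \<ge> 1"
      using floor_eq_of_image_below[OF c _ \<delta> den[OF x(2)] den[OF x(3)]] y(2,3) x(6) unfolding mo by blast
    \<comment> \<open>The inverse map with entries -d, b, c, -a: in this sign the lower left entry
      is again the positive c, as \<open>floor_eq_of_image_below\<close> requires.\<close>
    have inv: "real_of_int c * moebius A t + real_of_int (- a) \<noteq> 0 \<and>
       (real_of_int (- d) * moebius A t + real_of_int b) / (real_of_int c * moebius A t + real_of_int (- a)) = t" if "t \<notin> \<rat>" for t
    proof -
      define q where "q = real_of_int c * t + real_of_int d"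
      have q: "q \<noteq> 0" unfolding q_def by (rule den[OF that])
      define e where "e = real_of_int (b * c - a * d)"
      have e: "e \<noteq> 0" using \<delta> unfolding e_def by (metis abs_0 abs_minus_commute diff_0_right minus_diff_eq of_int_0_eq_iff zero_neq_one abs_minus_cancel)
      have Yq: "moebius A t * q = a * t + b" using q unfolding mo q_def[symmetric] by simp
      have "q * (real_of_int c * moebius A t + real_of_int (- a)) = c * (moebius A t * q) - a * q"
        "q * (real_of_int (- d) * moebius A t + real_of_int b) = b * q - d * (moebius A t * q)"
        by (simp_all add: algebra_simps)
      then have "q * (real_of_int c * moebius A t + real_of_int (- a)) = e"
        "q * (real_of_int (- d) * moebius A t + real_of_int b) = e * t"
        unfolding Yq by (simp_all add: q_def e_def algebra_simps)
      then show ?thesis using q e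
        by (metis mult_divide_mult_cancel_left mult_eq_0_iff nonzero_mult_div_cancel_left)
    qed
    have 2: "\<not> - d + c \<ge> 1"
    proof
      assume h: "- d + c \<ge> 1"
      have \<delta>': "\<bar>- d * - a - b * c\<bar> = 1" using \<delta> by (simp add: mult.commute)
      have "\<lfloor>moebius A z1\<rfloor> = \<lfloor>moebius A z2\<rfloor>"
        by (rule floor_eq_of_image_below[OF c h \<delta>']) (use inv[OF x(2)] inv[OF x(3)] x(4,5) in auto)
      then show False using y(4) by simp
    qed
    have ac: "a \<le> - c" "d \<ge> c" using 1 2 by linarith+
    \<comment> \<open>Here a d \<le> -c^2 \<le> -1, so determinant 1 or -1 leaves b c \<le>
      0.\<close>
    have "c * c \<le> (- a) * d" using ac c by (intro mult_mono) auto
    moreover have "1 * 1 \<le> c * c" using c by (intro mult_mono) auto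
    ultimately have "b * c \<le> 0" using \<delta> by linarith
    then have b: "b \<le> 0" using c by (simp add: mult_le_0_iff)
    have "real_of_int a * x < 0" using ac c xr by (simp add: mult_neg_pos)
    then have "real_of_int a * x + b < 0" using b by simp
    moreover have "real_of_int c * x + d > 0" using c ac xr by (simp add: add_pos_pos)
    ultimately have "moebius A x < 0" unfolding mo by (simp add: divide_neg_pos)
    then show ?thesis using yr by simp
  qed
qed

lemma balanced_iff:
  "balanced x \<longleftrightarrow> extremal x \<and> irr01 x \<and> conjugate1 x < -1 \<and> conjugate2 x < -1 \<and>
     \<lfloor>conjugate1 x\<rfloor> \<noteq> \<lfloor>conjugate2 x\<rfloor>"
  unfolding balanced_def reduced_def irr01_def extremal_def by blast

theorem proposition6p6:
  fixes \<xi> :: real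
  assumes "extremal \<xi>"
  shows "\<exists>!\<eta>. balanced \<eta> \<and> GL2Z_equivalent \<xi> \<eta>"
proof (rule ex_ex1I)
  have irr: "\<xi> \<notin> \<rat>" using assms extremal_iff by auto
  have "balanceable \<xi> (conjugate1 \<xi>) (conjugate2 \<xi>)"
    using conjugates_distinct[OF assms] by (intro balanceable_all irr) auto
  then obtain A where A: "invertible A" "irr01 (moebius A \<xi>)" "moebius A (conjugate1 \<xi>) < -1"
    "moebius A (conjugate2 \<xi>) < -1" "\<lfloor>moebius A (conjugate1 \<xi>)\<rfloor> \<noteq> \<lfloor>moebius A (conjugate2 \<xi>)\<rfloor>"
    unfolding balanceable_def by blast
  \<comment> \<open>The transformation may exchange the two conjugates; the conditions on them are
    symmetric.\<close>
  have "balanced (moebius A \<xi>)"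
    unfolding balanced_iff using A(2-) conjugates_moebius[OF assms A(1)] extremal_moebius[OF assms A(1)] by auto
  moreover have "GL2Z_equivalent \<xi> (moebius A \<xi>)"
    unfolding GL2Z_equivalent_def using irr A(1) moebius_irrational[OF irr det_ne0[OF A(1)]] by blast
  ultimately show "\<exists>\<eta>. balanced \<eta> \<and> GL2Z_equivalent \<xi> \<eta>" by blast
next
  fix \<eta> \<theta> assume h: "balanced \<eta> \<and> GL2Z_equivalent \<xi> \<eta>" "balanced \<theta> \<and> GL2Z_equivalent \<xi> \<theta>"
  have irr: "\<xi> \<notin> \<rat>" using assms extremal_iff by auto
  obtain A B where A: "invertible A" "\<eta> = moebius A \<xi>" and B: "invertible B" "\<theta> = moebius B \<xi>"
    using h unfolding GL2Z_equivalent_def by blast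
  obtain A' where A': "invertible A'" "A' ** A = mat 1" using invertible_inverse_int[OF A(1)] by blast
  \<comment> \<open>The transition from \<eta> to \<theta>, to which rigidity applies.\<close>
  define E where "E = B ** A'"
  have E: "invertible E" unfolding E_def by (rule invertible_mult_int[OF B(1) A'(1)])
  have "moebius E \<eta> = moebius (E ** A) \<xi>"
    unfolding A(2) by (rule moebius_mult[symmetric, OF irr det_ne0[OF E] det_ne0[OF A(1)]])
  also have "E ** A = B" unfolding E_def by (simp add: matrix_mul_assoc[symmetric] A'(2))
  finally have E\<eta>: "moebius E \<eta> = \<theta>" using B(2) by simp
  have \<eta>: "extremal \<eta>" "irr01 \<eta>" "conjugate1 \<eta> < -1" "conjugate2 \<eta> < -1" "\<lfloor>conjugate1 \<eta>\<rfloor> \<noteq> \<lfloor>conjugate2 \<eta>\<rfloor>"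
    and \<theta>: "irr01 \<theta>" "conjugate1 \<theta> < -1" "conjugate2 \<theta> < -1" "\<lfloor>conjugate1 \<theta>\<rfloor> \<noteq> \<lfloor>conjugate2 \<theta>\<rfloor>"
    using h unfolding balanced_iff by auto
  have "moebius E \<eta> = \<eta>"
    by (rule balanced_rigid[OF E \<eta>(2) conjugates_distinct(1)[OF \<eta>(1)] conjugates_distinct(2)[OF \<eta>(1)] \<eta>(3-5)])
       (use \<theta> conjugates_moebius[OF \<eta>(1) E] in \<open>auto simp: E\<eta>\<close>)
  then show "\<eta> = \<theta>" using E\<eta> by simp
qed

end
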